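(* Let $(\mathbf{B},\mathbf{p})$ be a Brascamp--Lieb datum with $\mathbf{B}=(H,(H_j)_{1\le j\le m},(B_j)_{1\le j\le m})$ non-degenerate, and let $G:H\to H$ be positive definite. Then there is a finite constant $K$ such that $$\int_H\exp(-\pi\langle Gx,x\rangle_H)\prod_{j=1}^m\big(f_j(B_jx)\big)^{p_j}\,dx\le K\prod_{j=1}^m\left(\int_{H_j}f_j\right)^{p_j}$$ for all non-negative measurable $f_j:H_j\to[0,\infty)$ with $0<\int_{H_j}f_j<\infty$ $(1\le j\le m)$, if and only if $$\dim(H/V)\ge\sum_{j=1}^m p_j\dim\big(H_j/(B_jV)\big)$$ for all subspaces $\{0\}\subseteq V\subseteq H$.
   Context: A Euclidean space is a finite-dimensional real Hilbert space with its Lebesgue measure. An $m$-transformation is a triple $\mathbf{B}=(H,(H_j)_{1\le j\le m},(B_j)_{1\le j\le m})$ with $H,H_1,\dots,H_m$ Euclidean spaces and $B_j:H\to H_j$ linear. It is non-degenerate if all $B_j$ are surjective and $\bigcap_{j=1}^m\ker(B_j)=\{0\}$. An $m$-exponent is a tuple $\mathbf{p}=(p_j)_{1\le j\le m}$ of non-negative reals. A Brascamp--Lieb datum is a pair $(\mathbf{B},\mathbf{p})$ of an $m$-transformation and an $m$-exponent. Positive definite means self-adjoint with positive definite quadratic form. Convention: $r^0=1$, so that indices with $p_j=0$ play no role. *)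

theory Defs
  imports "HOL-Analysis.Analysis"
begin

text \<open>
  Every type of class \<^class>\<open>euclidean_space\<close> has positive dimension, and a family indexed by \<open>j\<close>
  cannot have a type depending on \<open>j\<close>. A Euclidean space is therefore a linear subspace of an
  ambient type of that class, with the inherited inner product; the zero space is included. Up to
  isometry any finite family of finite-dimensional real Hilbert spaces arises as a family of
  subspaces of a single ambient space. Maps are only constrained on the given subspace.
\<close>

definition linear_map_on :: "'a::real_vector set \<Rightarrow> 'b::real_vector set \<Rightarrow> ('a \<Rightarrow> 'b) \<Rightarrow> bool" where
  "linear_map_on S T f \<longleftrightarrow>
     f ` S \<subseteq> T \<and>
     (\<forall>x\<in>S. \<forall>y\<in>S. f (x + y) = f x + f y) \<and>
     (\<forall>c. \<forall>x\<in>S. f (c *\<^sub>R x) = c *\<^sub>R f x)"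

definition positive_definite_on :: "'a::real_inner set \<Rightarrow> ('a \<Rightarrow> 'a) \<Rightarrow> bool" where
  "positive_definite_on S G \<longleftrightarrow>
     linear_map_on S S G \<and>
     (\<forall>x\<in>S. \<forall>y\<in>S. G x \<bullet> y = x \<bullet> G y) \<and>
     (\<forall>x\<in>S. x \<noteq> 0 \<longrightarrow> G x \<bullet> x > 0)"

definition orthonormal_basis_of :: "'a::euclidean_space set \<Rightarrow> 'a set \<Rightarrow> bool" where
  "orthonormal_basis_of S E \<longleftrightarrow>
     pairwise orthogonal E \<and> (\<forall>e\<in>E. norm e = 1) \<and> span E = S"

lemma orthonormal_basis_of_exists:
  assumes "subspace S"
  shows "\<exists>E. orthonormal_basis_of S E"
  using orthonormal_basis_subspace[OF assms] unfolding orthonormal_basis_of_def by metis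

text \<open>
  Lebesgue measure on the subspace \<open>S\<close>, with underlying space \<open>S\<close> and completed like
  \<^term>\<open>lebesgue\<close>; the construction is that of \<^const>\<open>lborel\<close>, with an orthonormal basis of \<open>S\<close> in
  place of \<^const>\<open>Basis\<close>. By invariance of Lebesgue measure under orthogonal maps the choice of
  basis is immaterial. For \<open>S = {0}\<close> this is the unit point mass at \<open>0\<close>.
\<close>

definition lborel_subspace :: "'a::euclidean_space set \<Rightarrow> 'a measure" where
  "lborel_subspace S =
     (let E = (SOME E. orthonormal_basis_of S E) in
      distr (\<Pi>\<^sub>M e\<in>E. lborel) (restrict_space borel S) (\<lambda>t. \<Sum>e\<in>E. t e *\<^sub>R e))"

abbreviation lebesgue_subspace :: "'a::euclidean_space set \<Rightarrow> 'a measure" where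
  "lebesgue_subspace S \<equiv> completion (lborel_subspace S)"

text \<open>
  \<open>B\<close> is a set of representatives, one for each element, of a basis of the quotient space \<open>S/V\<close>:
  the cosets \<open>b + V\<close> span \<open>S/V\<close> and are linearly independent there.
\<close>

definition quotient_basis :: "'a::real_vector set \<Rightarrow> 'a set \<Rightarrow> 'a set \<Rightarrow> bool" where
  "quotient_basis S V B \<longleftrightarrow>
     finite B \<and> B \<subseteq> S \<and>
     (\<forall>x\<in>S. \<exists>c. x - (\<Sum>b\<in>B. c b *\<^sub>R b) \<in> V) \<and>
     (\<forall>c. (\<Sum>b\<in>B. c b *\<^sub>R b) \<in> V \<longrightarrow> (\<forall>b\<in>B. c b = 0))"

definition quotient_dim :: "'a::real_vector set \<Rightarrow> 'a set \<Rightarrow> nat" where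
  "quotient_dim S V = (THE n. \<exists>B. quotient_basis S V B \<and> card B = n)"

lemma quotient_basis_card:
  fixes S V :: "'a::euclidean_space set"
  assumes S: "subspace S" and V: "subspace V" and VS: "V \<subseteq> S" and qb: "quotient_basis S V B"
  shows "card B = dim S - dim V"
proof -
  from qb have fB: "finite B" and BS: "B \<subseteq> S"
    and spn: "\<And>x. x \<in> S \<Longrightarrow> \<exists>c. x - (\<Sum>b\<in>B. c b *\<^sub>R b) \<in> V"
    and ind: "\<And>c. (\<Sum>b\<in>B. c b *\<^sub>R b) \<in> V \<Longrightarrow> (\<forall>b\<in>B. c b = 0)"
    unfolding quotient_basis_def by auto
  obtain C where C: "C \<subseteq> V" "independent C" "V \<subseteq> span C" "card C = dim V"
    using basis_exists by metis
  have fC: "finite C" using C(2) by (rule independent_imp_finite)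
  have sC: "span C = V" using C V by (metis span_minimal subset_antisym)
  have disj: "B \<inter> C = {}"
  proof (rule ccontr)
    assume "B \<inter> C \<noteq> {}"
    then obtain b where b: "b \<in> B" "b \<in> C" by auto
    have "(\<Sum>x\<in>B. (if x = b then 1 else 0) *\<^sub>R x) = (\<Sum>x\<in>B. if x = b then x else 0)"
      by (rule sum.cong) auto
    also have "\<dots> = b" using b fB by (simp add: sum.delta')
    finally have "(\<Sum>x\<in>B. (if x = b then 1 else 0) *\<^sub>R x) \<in> V" using b C(1) by auto
    from ind[OF this] b(1) show False by auto
  qed
  have indep: "independent (B \<union> C)"
  proof (rule independent_if_scalars_zero)
    show "finite (B \<union> C)" using fB fC by simp
    fix f x assume z: "(\<Sum>x\<in>B \<union> C. f x *\<^sub>R x) = 0" and x: "x \<in> B \<union> C"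
    have eq: "(\<Sum>x\<in>B. f x *\<^sub>R x) + (\<Sum>x\<in>C. f x *\<^sub>R x) = 0"
      using z sum.union_disjoint[OF fB fC disj, of "\<lambda>x. f x *\<^sub>R x"] by simp
    have CV: "(\<Sum>x\<in>C. f x *\<^sub>R x) \<in> V"
      using C(1) V by (auto intro!: subspace_sum subspace_scale)
    have "(\<Sum>x\<in>B. f x *\<^sub>R x) = - (\<Sum>x\<in>C. f x *\<^sub>R x)"
      using eq by (simp add: eq_neg_iff_add_eq_0)
    then have "(\<Sum>x\<in>B. f x *\<^sub>R x) \<in> V" using subspace_neg[OF V CV] by simp
    then have B0: "\<forall>b\<in>B. f b = 0" by (rule ind)
    then have "(\<Sum>x\<in>C. f x *\<^sub>R x) = 0" using eq by simp
    then have "\<forall>c\<in>C. f c = 0" using C(2) fC independentD by blast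
    with B0 x show "f x = 0" by auto
  qed
  have "S \<subseteq> span (B \<union> C)"
  proof
    fix x assume "x \<in> S"
    then obtain c where c: "x - (\<Sum>b\<in>B. c b *\<^sub>R b) \<in> V" using spn by blast
    have "x - (\<Sum>b\<in>B. c b *\<^sub>R b) \<in> span (B \<union> C)"
      using c sC span_mono[of C "B \<union> C"] by auto
    moreover have "(\<Sum>b\<in>B. c b *\<^sub>R b) \<in> span (B \<union> C)"
      by (intro span_sum span_scale span_base) auto
    ultimately show "x \<in> span (B \<union> C)" by (metis diff_add_cancel span_add)
  qed
  moreover have "B \<union> C \<subseteq> S" using BS C(1) VS by auto
  ultimately have "card (B \<union> C) = dim S"
    using indep by (metis basis_card_eq_dim)
  then show ?thesis using card_Un_disjoint[OF fB fC disj] C(4) by simp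
qed

lemma quotient_dim_eq:
  fixes S V :: "'a::euclidean_space set"
  assumes S: "subspace S" and V: "subspace V" and VS: "V \<subseteq> S"
  shows "quotient_dim S V = dim S - dim V"
proof -
  obtain C where C: "C \<subseteq> V" "independent C" "V \<subseteq> span C"
    using basis_exists by metis
  have sC: "span C = V" using C V by (metis span_minimal subset_antisym)
  obtain D where D: "C \<subseteq> D" "D \<subseteq> S" "independent D" "S \<subseteq> span D"
    using maximal_independent_subset_extend[OF order_trans[OF C(1) VS] C(2)] by metis
  have fD: "finite D" using D(3) by (rule independent_imp_finite)
  have fC: "finite C" using fD D(1) by (rule finite_subset[rotated])
  have "quotient_basis S V (D - C)"
    unfolding quotient_basis_def
  proof (intro conjI ballI allI impI)
    show "finite (D - C)" using fD by simp
    show "D - C \<subseteq> S" using D by auto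
  next
    fix x assume "x \<in> S"
    then obtain u where u: "x = (\<Sum>v\<in>D. u v *\<^sub>R v)"
      using D(4) span_finite[OF fD] by auto
    have "x - (\<Sum>v\<in>D - C. u v *\<^sub>R v) = (\<Sum>v\<in>C. u v *\<^sub>R v)"
      using sum.subset_diff[OF D(1) fD, of "\<lambda>v. u v *\<^sub>R v"] u by simp
    also have "\<dots> \<in> V" using C(1) V by (auto intro!: subspace_sum subspace_scale)
    finally show "\<exists>c. x - (\<Sum>b\<in>D - C. c b *\<^sub>R b) \<in> V" by blast
  next
    fix c b assume s: "(\<Sum>b\<in>D - C. c b *\<^sub>R b) \<in> V" and b: "b \<in> D - C"
    then obtain u where u: "(\<Sum>b\<in>D - C. c b *\<^sub>R b) = (\<Sum>v\<in>C. u v *\<^sub>R v)"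
      using sC span_finite[OF fC] by auto
    let ?g = "\<lambda>v. if v \<in> C then - u v else c v"
    have "(\<Sum>v\<in>D. ?g v *\<^sub>R v) = (\<Sum>v\<in>D - C. ?g v *\<^sub>R v) + (\<Sum>v\<in>C. ?g v *\<^sub>R v)"
      by (rule sum.subset_diff[OF D(1) fD])
    also have "\<dots> = (\<Sum>v\<in>D - C. c v *\<^sub>R v) + (\<Sum>v\<in>C. - (u v *\<^sub>R v))"
      by (intro arg_cong2[where f = "(+)"] sum.cong) auto
    also have "\<dots> = 0" using u by (simp add: sum_negf)
    finally have "?g b = 0"
      using independentD[OF D(3) fD order_refl, of ?g b] b by auto
    then show "c b = 0" using b by simp
  qed
  then show ?thesis
    unfolding quotient_dim_def
    using quotient_basis_card[OF S V VS] by (intro the_equality) auto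
qed

text \<open>The function \<^const>\<open>powr\<close> has \<open>0 powr 0 = 0\<close>; here \<open>r\<^sup>0 = 1\<close> for all \<open>r\<close>.\<close>

definition rpow :: "real \<Rightarrow> real \<Rightarrow> real" where
  "rpow r p = (if p = 0 then 1 else r powr p)"

definition m_transformation ::
  "nat \<Rightarrow> 'a::euclidean_space set \<Rightarrow> (nat \<Rightarrow> 'b::euclidean_space set) \<Rightarrow> (nat \<Rightarrow> 'a \<Rightarrow> 'b) \<Rightarrow> bool" where
  "m_transformation m H Hs B \<longleftrightarrow>
     subspace H \<and> (\<forall>j\<in>{1..m}. subspace (Hs j) \<and> linear_map_on H (Hs j) (B j))"

definition nondegenerate ::
  "nat \<Rightarrow> 'a::euclidean_space set \<Rightarrow> (nat \<Rightarrow> 'b::euclidean_space set) \<Rightarrow> (nat \<Rightarrow> 'a \<Rightarrow> 'b) \<Rightarrow> bool" where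
  "nondegenerate m H Hs B \<longleftrightarrow>
     (\<forall>j\<in>{1..m}. B j ` H = Hs j) \<and> {x\<in>H. \<forall>j\<in>{1..m}. B j x = 0} = {0}"

definition m_exponent :: "nat \<Rightarrow> (nat \<Rightarrow> real) \<Rightarrow> bool" where
  "m_exponent m p \<longleftrightarrow> (\<forall>j\<in>{1..m}. 0 \<le> p j)"

definition brascamp_lieb_datum ::
  "nat \<Rightarrow> 'a::euclidean_space set \<Rightarrow> (nat \<Rightarrow> 'b::euclidean_space set) \<Rightarrow> (nat \<Rightarrow> 'a \<Rightarrow> 'b) \<Rightarrow>
   (nat \<Rightarrow> real) \<Rightarrow> bool" where
  "brascamp_lieb_datum m H Hs B p \<longleftrightarrow> m_transformation m H Hs B \<and> m_exponent m p"

text \<open>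
  Admissible inputs: for a non-negative function, being \<^const>\<open>integrable\<close> means being measurable
  with finite integral.
\<close>

definition bl_input ::
  "nat \<Rightarrow> (nat \<Rightarrow> 'b::euclidean_space set) \<Rightarrow> (nat \<Rightarrow> 'b \<Rightarrow> real) \<Rightarrow> bool" where
  "bl_input m Hs f \<longleftrightarrow>
     (\<forall>j\<in>{1..m}. (\<forall>y\<in>Hs j. 0 \<le> f j y) \<and>
        integrable (lebesgue_subspace (Hs j)) (f j) \<and>
        0 < (\<integral>y. f j y \<partial>lebesgue_subspace (Hs j)))"

end

theory Submission
  imports Defs "HOL-Probability.Distributions"
begin

text \<open>
  Why the equivalence holds. If the inequality holds, test it on Gaussians that are squeezed to
  width \<open>\<epsilon>\<close> in the directions orthogonal to \<open>B j ` V\<close>: the right-hand side is of order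
  \<open>\<epsilon>\<close> to the power \<open>\<Sum> p j * codim (B j ` V)\<close>, the left-hand side is at least of order
  \<open>\<epsilon>\<close> to the power \<open>codim V\<close>, and \<open>\<epsilon> \<rightarrow> 0\<close> gives the dimension condition
  (\<open>dim_cond_if_inequality\<close>).

  Conversely, a positive definite \<open>G\<close> dominates a multiple of the identity, so the weight may be
  taken to be \<open>exp (- c |x|\<^sup>2)\<close>, which splits as a product along orthogonal decompositions. Three
  facts about inequalities with this weight, called \<open>BL\<close> below, give an elementary proof by
  induction on \<open>dim H\<close>.

  \<^item> Factorisation (\<open>BL_factor\<close>): by Fubini, the inequality for \<open>H\<close> follows from the inequalities
    for \<open>V\<close> and for \<open>H / V\<close>. If equality holds in the dimension condition at \<open>V\<close>, then the
    condition is inherited by \<open>V\<close> (\<open>dim_cond_critical_subspace\<close>); it is always inherited by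
    \<open>H / V\<close> (\<open>dim_cond_quotient\<close>). So a critical \<open>V\<close>, if it is proper and non-trivial, allows
    the induction to proceed.

  \<^item> Interpolation (\<open>BL_interpolate\<close>): the set of exponents \<open>p\<close> for which the inequality holds is
    convex, by the pointwise estimate \<open>a\<^sup>\<theta> b\<^sup>1\<^sup>-\<^sup>\<theta> \<le> a + b\<close>. If there is no critical
    subspace and two exponents are positive, then \<open>p\<close> can be moved in two opposite directions
    inside the polytope of admissible exponents, until it reaches points where a critical
    subspace exists or an exponent vanishes (\<open>dim_cond_move\<close>), and \<open>p\<close> lies between these.

  \<^item> One map (\<open>BL_singleton\<close>): the condition gives \<open>p \<le> 1\<close>, and then \<open>r\<^sup>p \<le> 1 + r\<close> reduces the
    inequality to integrating out the kernel.

  Constants are irrelevant throughout, so measures on subspaces are compared by the uniqueness of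
  Haar measure up to a factor (\<open>haar_on_unique\<close>), and no determinants occur.
\<close>

section \<open>Gaussians and Haar measures of subspaces\<close>

definition gauss :: "real \<Rightarrow> 'a::real_normed_vector \<Rightarrow> ennreal" where
  "gauss c x = ennreal (exp (- c * (norm x)\<^sup>2))"

lemma gauss_measurable [measurable]: "gauss c \<in> borel_measurable borel"
  unfolding gauss_def by measurable

lemma gauss_pos: "0 < gauss c x"
  by (simp add: gauss_def)

lemma gauss_antimono: "c * (norm x)\<^sup>2 \<le> d * (norm y)\<^sup>2 \<Longrightarrow> gauss d y \<le> gauss c x"
  by (simp add: gauss_def)

lemma gauss_add_orthogonal:
  "x \<bullet> y = 0 \<Longrightarrow> gauss c (x + y) = gauss c x * gauss c y"
  by (simp add: gauss_def norm_add_Pythagorean orthogonal_def algebra_simps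
      flip: ennreal_mult exp_add)

text \<open>
  The integration theory needs only a few invariant properties of Lebesgue measure on a subspace,
  and only up to a constant factor, since every constant is absorbed in \<open>K\<close>. They are
  collected here as a notion of Haar measure of \<open>S\<close>, carried by the ambient space so that measures
  of different subspaces live on the same \<open>\<sigma>\<close>-algebra. Integrability of Gaussians, instead of
  finiteness on bounded sets, serves as the normalisation: it is stable under orthogonal sums and
  injective linear images, gives \<open>\<sigma>\<close>-finiteness, and is the form in which finiteness is used.
\<close>

definition haar_on :: "'a::euclidean_space set \<Rightarrow> 'a measure \<Rightarrow> bool" where
  "haar_on S \<mu> \<longleftrightarrow> sets \<mu> = sets borel \<and> (AE x in \<mu>. x \<in> S) \<and>
     (\<forall>a\<in>S. \<forall>f::'a \<Rightarrow> ennreal. f \<in> borel_measurable borel \<longrightarrow> (\<integral>\<^sup>+x. f (x + a) \<partial>\<mu>) = (\<integral>\<^sup>+x. f x \<partial>\<mu>)) \<and>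
     (\<forall>f::'a \<Rightarrow> ennreal. f \<in> borel_measurable borel \<longrightarrow> (\<integral>\<^sup>+x. f (- x) \<partial>\<mu>) = (\<integral>\<^sup>+x. f x \<partial>\<mu>)) \<and>
     (\<forall>c>0. 0 < (\<integral>\<^sup>+x. gauss c x \<partial>\<mu>) \<and> (\<integral>\<^sup>+x. gauss c x \<partial>\<mu>) < top)"

lemma haar_on_sets: "haar_on S \<mu> \<Longrightarrow> sets \<mu> = sets borel"
  and haar_on_AE: "haar_on S \<mu> \<Longrightarrow> AE x in \<mu>. x \<in> S"
  and haar_on_translate: "haar_on S \<mu> \<Longrightarrow> a \<in> S \<Longrightarrow> f \<in> borel_measurable borel \<Longrightarrow>
    (\<integral>\<^sup>+x. f (x + a) \<partial>\<mu>) = (\<integral>\<^sup>+x. f x \<partial>\<mu>)"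
  and haar_on_uminus: "haar_on S \<mu> \<Longrightarrow> f \<in> borel_measurable borel \<Longrightarrow>
    (\<integral>\<^sup>+x. f (- x) \<partial>\<mu>) = (\<integral>\<^sup>+x. f x \<partial>\<mu>)"
  and haar_on_gauss_pos: "haar_on S \<mu> \<Longrightarrow> 0 < c \<Longrightarrow> 0 < (\<integral>\<^sup>+x. gauss c x \<partial>\<mu>)"
  and haar_on_gauss_finite: "haar_on S \<mu> \<Longrightarrow> 0 < c \<Longrightarrow> (\<integral>\<^sup>+x. gauss c x \<partial>\<mu>) < top"
  for f :: "'a::euclidean_space \<Rightarrow> ennreal"
  by (simp_all add: haar_on_def)

text \<open>
  A Gaussian is bounded below on every ball, so a measure giving it finite mass gives finite mass
  to balls.
\<close>

lemma sigma_finite_if_gauss_finite: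
  fixes \<mu> :: "'a::euclidean_space measure"
  assumes [measurable_cong]: "sets \<mu> = sets borel" and fin: "(\<integral>\<^sup>+x. gauss c x \<partial>\<mu>) < top" and c: "0 < c"
  shows "sigma_finite_measure \<mu>"
proof
  have sp: "space \<mu> = UNIV"
    using sets_eq_imp_space_eq[OF assms(1)] by simp
  define A where "A n = cball (0::'a) (real n)" for n
  have "emeasure \<mu> (A n) \<noteq> \<infinity>" for n
  proof -
    have "emeasure \<mu> (A n) = (\<integral>\<^sup>+x. indicator (A n) x \<partial>\<mu>)"
      by (rule nn_integral_indicator[symmetric]) (simp add: assms(1) A_def)
    also have "\<dots> \<le> (\<integral>\<^sup>+x. ennreal (exp (c * (real n)\<^sup>2)) * gauss c x \<partial>\<mu>)"
    proof (rule nn_integral_mono)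
      fix x
      show "indicator (A n) x \<le> ennreal (exp (c * (real n)\<^sup>2)) * gauss c x"
      proof (cases "x \<in> A n")
        case True
        then have "c * (norm x)\<^sup>2 \<le> c * (real n)\<^sup>2"
          using c by (simp add: A_def power_mono)
        then show ?thesis
          by (simp add: gauss_def indicator_def flip: ennreal_mult exp_add)
      qed simp
    qed
    also have "\<dots> = ennreal (exp (c * (real n)\<^sup>2)) * (\<integral>\<^sup>+x. gauss c x \<partial>\<mu>)"
      by (rule nn_integral_cmult) measurable
    also have "\<dots> < top"
      using fin by (simp add: ennreal_mult_less_top)
    finally show ?thesis by simp
  qed
  moreover have "(\<Union>n. A n) = space \<mu>"
    unfolding sp A_def using real_arch_simple by auto
  moreover have "range A \<subseteq> sets \<mu>"
    by (auto simp: A_def assms(1))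
  ultimately show "\<exists>A. countable A \<and> A \<subseteq> sets \<mu> \<and> \<Union> A = space \<mu> \<and> (\<forall>a\<in>A. emeasure \<mu> a \<noteq> \<infinity>)"
    by (intro exI[of _ "range A"]) auto
qed

lemma haar_on_sigma_finite: "haar_on S \<mu> \<Longrightarrow> sigma_finite_measure \<mu>"
  by (rule sigma_finite_if_gauss_finite[of _ 1]) (auto simp: haar_on_def)

text \<open>
  Uniqueness of Haar measure by Fubini: for a Gaussian \<open>g\<close>, the double integral of
  \<open>f x * g (x + y)\<close> over \<open>\<mu> \<Otimes> \<nu>\<close> equals \<open>\<mu>(f) \<nu>(g)\<close> when \<open>y\<close> is translated
  first, and \<open>\<mu>(g) \<nu>(f)\<close> when \<open>x\<close> is translated first and \<open>y\<close> is then reflected.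
  This is what makes measures built from different bases or decompositions comparable without
  determinants.
\<close>

lemma haar_on_unique:
  assumes \<mu>: "haar_on S \<mu>" and \<nu>: "haar_on S \<nu>" and S: "subspace S"
  obtains C :: real where "0 < C"
    "\<And>f. f \<in> borel_measurable borel \<Longrightarrow> (\<integral>\<^sup>+x. f x \<partial>\<mu>) = ennreal C * (\<integral>\<^sup>+x. f x \<partial>\<nu>)"
proof -
  note [measurable_cong] = haar_on_sets[OF \<mu>] haar_on_sets[OF \<nu>]
  interpret \<mu>: sigma_finite_measure \<mu> using \<mu> by (rule haar_on_sigma_finite)
  interpret \<nu>: sigma_finite_measure \<nu> using \<nu> by (rule haar_on_sigma_finite)
  interpret P: pair_sigma_finite \<mu> \<nu> ..
  define m n where "m = enn2real (\<integral>\<^sup>+x. gauss 1 x \<partial>\<mu>)" and "n = enn2real (\<integral>\<^sup>+x. gauss 1 x \<partial>\<nu>)"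
  have m: "(\<integral>\<^sup>+x. gauss 1 x \<partial>\<mu>) = ennreal m" "0 < m"
    using haar_on_gauss_pos[OF \<mu>, of 1] haar_on_gauss_finite[OF \<mu>, of 1]
    by (auto simp: m_def enn2real_positive_iff)
  have n: "(\<integral>\<^sup>+x. gauss 1 x \<partial>\<nu>) = ennreal n" "0 < n"
    using haar_on_gauss_pos[OF \<nu>, of 1] haar_on_gauss_finite[OF \<nu>, of 1]
    by (auto simp: n_def enn2real_positive_iff)
  have key: "(\<integral>\<^sup>+x. f x \<partial>\<mu>) * ennreal n = ennreal m * (\<integral>\<^sup>+x. f x \<partial>\<nu>)"
    if [measurable]: "f \<in> borel_measurable borel" for f
  proof -
    have "(\<integral>\<^sup>+x. f x \<partial>\<mu>) * ennreal n = (\<integral>\<^sup>+x. f x * (\<integral>\<^sup>+y. gauss 1 y \<partial>\<nu>) \<partial>\<mu>)"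
      by (subst nn_integral_multc) (simp_all add: n)
    also have "\<dots> = (\<integral>\<^sup>+x. f x * (\<integral>\<^sup>+y. gauss 1 (y + x) \<partial>\<nu>) \<partial>\<mu>)"
      using haar_on_AE[OF \<mu>]
      by (intro nn_integral_cong_AE, eventually_elim) (simp add: haar_on_translate[OF \<nu>])
    also have "\<dots> = (\<integral>\<^sup>+x. \<integral>\<^sup>+y. f x * gauss 1 (y + x) \<partial>\<nu> \<partial>\<mu>)"
      by (intro nn_integral_cong nn_integral_cmult[symmetric]) measurable
    also have "\<dots> = (\<integral>\<^sup>+y. \<integral>\<^sup>+x. f x * gauss 1 (y + x) \<partial>\<mu> \<partial>\<nu>)"
      by (rule P.Fubini'[symmetric]) measurable
    also have "\<dots> = (\<integral>\<^sup>+y. \<integral>\<^sup>+x. f (x - y) * gauss 1 x \<partial>\<mu> \<partial>\<nu>)"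
    proof (rule nn_integral_cong_AE)
      show "AE y in \<nu>. (\<integral>\<^sup>+x. f x * gauss 1 (y + x) \<partial>\<mu>) = (\<integral>\<^sup>+x. f (x - y) * gauss 1 x \<partial>\<mu>)"
        using haar_on_AE[OF \<nu>]
      proof eventually_elim
        case (elim y)
        then have "- y \<in> S" using S by (simp add: subspace_neg)
        from haar_on_translate[OF \<mu> this, of "\<lambda>x. f x * gauss 1 (y + x)"]
        show ?case by simp
      qed
    qed
    also have "\<dots> = (\<integral>\<^sup>+x. \<integral>\<^sup>+y. f (x - y) * gauss 1 x \<partial>\<nu> \<partial>\<mu>)"
      by (rule P.Fubini') measurable
    also have "\<dots> = (\<integral>\<^sup>+x. (\<integral>\<^sup>+y. f (x - y) \<partial>\<nu>) * gauss 1 x \<partial>\<mu>)"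
      by (intro nn_integral_cong nn_integral_multc) measurable
    also have "\<dots> = (\<integral>\<^sup>+x. (\<integral>\<^sup>+y. f y \<partial>\<nu>) * gauss 1 x \<partial>\<mu>)"
    proof (rule nn_integral_cong_AE)
      show "AE x in \<mu>. (\<integral>\<^sup>+y. f (x - y) \<partial>\<nu>) * gauss 1 x = (\<integral>\<^sup>+y. f y \<partial>\<nu>) * gauss 1 x"
        using haar_on_AE[OF \<mu>]
      proof eventually_elim
        case (elim x)
        have "(\<integral>\<^sup>+y. f (x - y) \<partial>\<nu>) = (\<integral>\<^sup>+y. f (y + x) \<partial>\<nu>)"
          using haar_on_uminus[OF \<nu>, of "\<lambda>y. f (y + x)"] by (simp add: algebra_simps)
        also have "\<dots> = (\<integral>\<^sup>+y. f y \<partial>\<nu>)"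
          using elim by (intro haar_on_translate[OF \<nu>]) auto
        finally show ?case by simp
      qed
    qed
    also have "\<dots> = (\<integral>\<^sup>+y. f y \<partial>\<nu>) * ennreal m"
      by (subst nn_integral_cmult) (simp_all add: m)
    finally show ?thesis by (simp add: mult.commute)
  qed
  show thesis
  proof (rule that[of "m / n"])
    show "0 < m / n" using m n by simp
    fix f :: "'a \<Rightarrow> ennreal" assume "f \<in> borel_measurable borel"
    from key[OF this] have "(\<integral>\<^sup>+x. f x \<partial>\<mu>) * ennreal n * ennreal (1 / n) = ennreal m * (\<integral>\<^sup>+x. f x \<partial>\<nu>) * ennreal (1 / n)"
      by simp
    moreover have "ennreal n * ennreal (1 / n) = 1"
      using n(2) by (simp flip: ennreal_mult)
    moreover have "ennreal m * ennreal (1 / n) = ennreal (m / n)"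
      using n(2) m(2) by (simp flip: ennreal_mult)
    ultimately show "(\<integral>\<^sup>+x. f x \<partial>\<mu>) = ennreal (m / n) * (\<integral>\<^sup>+x. f x \<partial>\<nu>)"
      by (metis mult.assoc mult.commute mult.right_neutral)
  qed
qed

text \<open>
  Orthogonality is what makes the Gaussian condition pass to the sum: a Gaussian on the sum is
  exactly the product of the Gaussians of the two components.
\<close>

lemma haar_on_orthogonal_sum:
  fixes V W :: "'a::euclidean_space set"
  assumes \<mu>: "haar_on V \<mu>" and \<nu>: "haar_on W \<nu>"
    and V: "subspace V" and W: "subspace W"
    and orth: "\<And>v w. v \<in> V \<Longrightarrow> w \<in> W \<Longrightarrow> v \<bullet> w = 0"
  shows "haar_on {v + w |v w. v \<in> V \<and> w \<in> W} (distr (\<mu> \<Otimes>\<^sub>M \<nu>) borel (\<lambda>(v, w). v + w))" (is "haar_on ?S ?D")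
    and "f \<in> borel_measurable borel \<Longrightarrow>
      (\<integral>\<^sup>+x. f x \<partial>distr (\<mu> \<Otimes>\<^sub>M \<nu>) borel (\<lambda>(v, w). v + w)) = (\<integral>\<^sup>+w. \<integral>\<^sup>+v. f (v + w) \<partial>\<mu> \<partial>\<nu>)"
proof -
  note [measurable_cong] = haar_on_sets[OF \<mu>] haar_on_sets[OF \<nu>]
  interpret \<mu>: sigma_finite_measure \<mu> using \<mu> by (rule haar_on_sigma_finite)
  interpret \<nu>: sigma_finite_measure \<nu> using \<nu> by (rule haar_on_sigma_finite)
  interpret P: pair_sigma_finite \<mu> \<nu> ..
  have int: "(\<integral>\<^sup>+x. f x \<partial>?D) = (\<integral>\<^sup>+w. \<integral>\<^sup>+v. f (v + w) \<partial>\<mu> \<partial>\<nu>)"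
    if [measurable]: "f \<in> borel_measurable borel" for f :: "'a \<Rightarrow> ennreal"
  proof -
    have "(\<integral>\<^sup>+x. f x \<partial>?D) = (\<integral>\<^sup>+z. f (fst z + snd z) \<partial>(\<mu> \<Otimes>\<^sub>M \<nu>))"
      by (subst nn_integral_distr) (auto simp: split_beta')
    also have "\<dots> = (\<integral>\<^sup>+w. \<integral>\<^sup>+v. f (v + w) \<partial>\<mu> \<partial>\<nu>)"
      by (subst P.nn_integral_snd[symmetric]) auto
    finally show ?thesis .
  qed
  then show "f \<in> borel_measurable borel \<Longrightarrow> (\<integral>\<^sup>+x. f x \<partial>?D) = (\<integral>\<^sup>+w. \<integral>\<^sup>+v. f (v + w) \<partial>\<mu> \<partial>\<nu>)" .
  show "haar_on ?S ?D"
    unfolding haar_on_def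
  proof (intro conjI ballI allI impI)
    show "sets ?D = sets borel" by simp
    have [measurable]: "V \<in> sets borel" "W \<in> sets borel" "?S \<in> sets borel"
      using V W subspace_sums[OF V W] by (auto intro: borel_closed closed_subspace)
    have "AE z in \<mu> \<Otimes>\<^sub>M \<nu>. fst z \<in> V \<and> snd z \<in> W"
      using haar_on_AE[OF \<mu>] haar_on_AE[OF \<nu>]
      by (intro P.AE_pair_measure) (auto elim!: eventually_mono)
    then have "AE z in \<mu> \<Otimes>\<^sub>M \<nu>. (case z of (v, w) \<Rightarrow> v + w) \<in> ?S"
      by (rule eventually_mono) (unfold split_beta, blast)
    then show "AE x in ?D. x \<in> ?S"
      by (subst AE_distr_iff) (simp_all only: split_beta', measurable)
  next
    fix a and f :: "'a \<Rightarrow> ennreal" assume a: "a \<in> ?S" and [measurable]: "f \<in> borel_measurable borel"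
    then obtain v w where vw: "v \<in> V" "w \<in> W" "a = v + w" by auto
    have "(\<integral>\<^sup>+x. f (x + a) \<partial>?D) = (\<integral>\<^sup>+w'. \<integral>\<^sup>+v'. f (v' + v + w' + w) \<partial>\<mu> \<partial>\<nu>)"
      by (subst int) (auto simp: vw algebra_simps)
    also have "\<dots> = (\<integral>\<^sup>+w'. \<integral>\<^sup>+v'. f (v' + w' + w) \<partial>\<mu> \<partial>\<nu>)"
      by (intro nn_integral_cong haar_on_translate[OF \<mu> vw(1), where f = "\<lambda>v. f (v + _ + _)"]) auto
    also have "\<dots> = (\<integral>\<^sup>+w'. \<integral>\<^sup>+v'. f (v' + (w' + w)) \<partial>\<mu> \<partial>\<nu>)"
      by (simp add: add.assoc)
    also have "\<dots> = (\<integral>\<^sup>+w'. \<integral>\<^sup>+v'. f (v' + w') \<partial>\<mu> \<partial>\<nu>)"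
      by (rule haar_on_translate[OF \<nu> vw(2), where f = "\<lambda>w. \<integral>\<^sup>+v'. f (v' + w) \<partial>\<mu>"]) measurable
    also have "\<dots> = (\<integral>\<^sup>+x. f x \<partial>?D)" by (rule int[symmetric]) fact
    finally show "(\<integral>\<^sup>+x. f (x + a) \<partial>?D) = (\<integral>\<^sup>+x. f x \<partial>?D)" .
  next
    fix f :: "'a \<Rightarrow> ennreal" assume [measurable]: "f \<in> borel_measurable borel"
    have "(\<integral>\<^sup>+x. f (- x) \<partial>?D) = (\<integral>\<^sup>+w. \<integral>\<^sup>+v. f (- v - w) \<partial>\<mu> \<partial>\<nu>)"
      by (subst int) auto
    also have "\<dots> = (\<integral>\<^sup>+w. \<integral>\<^sup>+v. f (v - w) \<partial>\<mu> \<partial>\<nu>)"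
      by (intro nn_integral_cong haar_on_uminus[OF \<mu>, where f = "\<lambda>v. f (v - _)"]) auto
    also have "\<dots> = (\<integral>\<^sup>+w. \<integral>\<^sup>+v. f (v + (- w)) \<partial>\<mu> \<partial>\<nu>)"
      by simp
    also have "\<dots> = (\<integral>\<^sup>+w. \<integral>\<^sup>+v. f (v + w) \<partial>\<mu> \<partial>\<nu>)"
      by (rule haar_on_uminus[OF \<nu>, where f = "\<lambda>w. \<integral>\<^sup>+v'. f (v' + w) \<partial>\<mu>"]) measurable
    also have "\<dots> = (\<integral>\<^sup>+x. f x \<partial>?D)" by (rule int[symmetric]) fact
    finally show "(\<integral>\<^sup>+x. f (- x) \<partial>?D) = (\<integral>\<^sup>+x. f x \<partial>?D)" .
  next
    fix c :: real assume c: "0 < c"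
    have "(\<integral>\<^sup>+x. gauss c x \<partial>?D) = (\<integral>\<^sup>+w. \<integral>\<^sup>+v. gauss c (v + w) \<partial>\<mu> \<partial>\<nu>)"
      by (subst int) auto
    also have "\<dots> = (\<integral>\<^sup>+w. \<integral>\<^sup>+v. gauss c v * gauss c w \<partial>\<mu> \<partial>\<nu>)"
    proof (rule nn_integral_cong_AE)
      show "AE w in \<nu>. (\<integral>\<^sup>+v. gauss c (v + w) \<partial>\<mu>) = (\<integral>\<^sup>+v. gauss c v * gauss c w \<partial>\<mu>)"
        using haar_on_AE[OF \<nu>]
      proof eventually_elim
        case (elim w)
        show ?case
          using haar_on_AE[OF \<mu>]
          by (intro nn_integral_cong_AE, eventually_elim) (simp add: gauss_add_orthogonal orth elim)
      qed
    qed
    also have "\<dots> = (\<integral>\<^sup>+v. gauss c v \<partial>\<mu>) * (\<integral>\<^sup>+w. gauss c w \<partial>\<nu>)"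
      by (simp add: nn_integral_multc nn_integral_cmult)
    finally have eq: "(\<integral>\<^sup>+x. gauss c x \<partial>?D) = (\<integral>\<^sup>+v. gauss c v \<partial>\<mu>) * (\<integral>\<^sup>+w. gauss c w \<partial>\<nu>)" .
    show "0 < (\<integral>\<^sup>+x. gauss c x \<partial>?D)" "(\<integral>\<^sup>+x. gauss c x \<partial>?D) < top"
      unfolding eq using haar_on_gauss_pos[OF \<mu> c] haar_on_gauss_finite[OF \<mu> c]
        haar_on_gauss_pos[OF \<nu> c] haar_on_gauss_finite[OF \<nu> c]
      by (simp_all add: ennreal_mult_less_top ennreal_zero_less_mult_iff)
  qed
qed

lemma linear_borel_measurable:
  fixes L :: "'a::euclidean_space \<Rightarrow> 'b::euclidean_space"
  shows "linear L \<Longrightarrow> L \<in> borel_measurable borel"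
  by (intro borel_measurable_continuous_onI linear_continuous_on) (simp add: linear_conv_bounded_linear)

text \<open>
  An injective linear map distorts norms on \<open>W\<close> by bounded factors only, so Gaussians on the image
  are squeezed between Gaussians on \<open>W\<close>.
\<close>

lemma haar_on_linear_image:
  fixes L :: "'a::euclidean_space \<Rightarrow> 'b::euclidean_space"
  assumes \<mu>: "haar_on W \<mu>" and W: "subspace W" and L: "linear L" and inj: "inj_on L W"
  shows "haar_on (L ` W) (distr \<mu> borel L)"
proof -
  note [measurable_cong] = haar_on_sets[OF \<mu>]
  note [measurable] = linear_borel_measurable[OF L]
  have int: "(\<integral>\<^sup>+x. f x \<partial>distr \<mu> borel L) = (\<integral>\<^sup>+x. f (L x) \<partial>\<mu>)"
    if [measurable]: "f \<in> borel_measurable borel" for f :: "'b \<Rightarrow> ennreal"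
    by (rule nn_integral_distr) measurable
  obtain b where b: "0 < b" "\<And>x. norm (L x) \<le> b * norm x"
    using linear_bounded_pos[OF L] by blast
  have "\<forall>x\<in>W. L x = 0 \<longrightarrow> x = 0"
    using inj W L by (metis inj_onD linear_0 subspace_0)
  then obtain e where e: "0 < e" "\<And>x. x \<in> W \<Longrightarrow> e * norm x \<le> norm (L x)"
    using injective_imp_isometric[of W L] W L
    by (auto simp: closed_subspace linear_conv_bounded_linear mult.commute)
  show ?thesis
    unfolding haar_on_def
  proof (intro conjI ballI allI impI)
    show "sets (distr \<mu> borel L) = sets borel" by simp
    have [measurable]: "L ` W \<in> sets borel"
      using linear_subspace_image[OF L W] by (auto intro: borel_closed closed_subspace)
    have "AE x in \<mu>. L x \<in> L ` W"
      using haar_on_AE[OF \<mu>] by (rule eventually_mono) auto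
    then show "AE x in distr \<mu> borel L. x \<in> L ` W"
      by (subst AE_distr_iff) measurable
  next
    fix a and f :: "'b \<Rightarrow> ennreal" assume "a \<in> L ` W" and [measurable]: "f \<in> borel_measurable borel"
    then obtain w where "w \<in> W" "a = L w" by auto
    then show "(\<integral>\<^sup>+x. f (x + a) \<partial>distr \<mu> borel L) = (\<integral>\<^sup>+x. f x \<partial>distr \<mu> borel L)"
      using haar_on_translate[OF \<mu>, of w "\<lambda>x. f (L x)"] by (simp add: int linear_add[OF L])
  next
    fix f :: "'b \<Rightarrow> ennreal" assume [measurable]: "f \<in> borel_measurable borel"
    show "(\<integral>\<^sup>+x. f (- x) \<partial>distr \<mu> borel L) = (\<integral>\<^sup>+x. f x \<partial>distr \<mu> borel L)"
      using haar_on_uminus[OF \<mu>, of "\<lambda>x. f (L x)"] by (simp add: int linear_neg[OF L])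
  next
    fix c :: real assume c: "0 < c"
    have "0 < (\<integral>\<^sup>+x. gauss (c * b\<^sup>2) x \<partial>\<mu>)"
      using c b by (intro haar_on_gauss_pos[OF \<mu>]) simp
    also have "\<dots> \<le> (\<integral>\<^sup>+x. gauss c (L x) \<partial>\<mu>)"
    proof (intro nn_integral_mono gauss_antimono)
      fix x
      have "(norm (L x))\<^sup>2 \<le> (b * norm x)\<^sup>2" using b by (intro power_mono) auto
      then show "c * (norm (L x))\<^sup>2 \<le> c * b\<^sup>2 * (norm x)\<^sup>2"
        using c by (simp add: power_mult_distrib)
    qed
    finally show "0 < (\<integral>\<^sup>+x. gauss c x \<partial>distr \<mu> borel L)" by (simp add: int)
    have "(\<integral>\<^sup>+x. gauss c (L x) \<partial>\<mu>) \<le> (\<integral>\<^sup>+x. gauss (c * e\<^sup>2) x \<partial>\<mu>)"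
    proof (rule nn_integral_mono_AE)
      show "AE x in \<mu>. gauss c (L x) \<le> gauss (c * e\<^sup>2) x"
        using haar_on_AE[OF \<mu>]
      proof eventually_elim
        case (elim x)
        then have "(e * norm x)\<^sup>2 \<le> (norm (L x))\<^sup>2" using e by (intro power_mono) auto
        then show ?case using c by (intro gauss_antimono) (simp add: power_mult_distrib)
      qed
    qed
    also have "\<dots> < top"
      using c e by (intro haar_on_gauss_finite[OF \<mu>]) simp
    finally show "(\<integral>\<^sup>+x. gauss c x \<partial>distr \<mu> borel L) < top" by (simp add: int)
  qed
qed

section \<open>Lebesgue measure on a subspace\<close>

text \<open>
  Translations and the reflection of a subspace act coordinatewise in an orthonormal basis, so both
  invariances reduce to those of Lebesgue measure on the line.
\<close>

lemma distr_PiM_lborel_invariant: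
  fixes g :: "'i \<Rightarrow> real \<Rightarrow> real"
  assumes fin: "finite E" and g: "\<And>e. e \<in> E \<Longrightarrow> distr lborel borel (g e) = lborel"
    and [measurable]: "\<And>e. e \<in> E \<Longrightarrow> g e \<in> borel_measurable borel"
  shows "distr (\<Pi>\<^sub>M e\<in>E. lborel) (\<Pi>\<^sub>M e\<in>E. lborel) (\<lambda>t. \<lambda>e\<in>E. g e (t e)) = (\<Pi>\<^sub>M e\<in>E. lborel)"
proof -
  interpret product_sigma_finite "\<lambda>_::'i. lborel :: real measure"
    by standard
  have m: "(\<lambda>t. \<lambda>e\<in>E. g e (t e)) \<in> (\<Pi>\<^sub>M e\<in>E. lborel) \<rightarrow>\<^sub>M (\<Pi>\<^sub>M e\<in>E. lborel)"
    by measurable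
  show ?thesis
  proof (rule PiM_eqI[OF fin])
    fix A :: "'i \<Rightarrow> real set" assume A: "\<And>e. e \<in> E \<Longrightarrow> A e \<in> sets lborel"
    have meas: "g e -` A e \<in> sets lborel" if "e \<in> E" for e
      using measurable_sets[of "g e" borel borel "A e"] assms(3)[OF that] A[OF that] by simp
    have "emeasure (distr (\<Pi>\<^sub>M e\<in>E. lborel) (\<Pi>\<^sub>M e\<in>E. lborel) (\<lambda>t. \<lambda>e\<in>E. g e (t e))) (Pi\<^sub>E E A)
       = emeasure (\<Pi>\<^sub>M e\<in>E. lborel) ((\<lambda>t. \<lambda>e\<in>E. g e (t e)) -` Pi\<^sub>E E A \<inter> space (\<Pi>\<^sub>M e\<in>E. lborel))"
      using A fin by (intro emeasure_distr m sets_PiM_I_finite) auto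
    also have "(\<lambda>t. \<lambda>e\<in>E. g e (t e)) -` Pi\<^sub>E E A \<inter> space (\<Pi>\<^sub>M e\<in>E. lborel) = Pi\<^sub>E E (\<lambda>e. g e -` A e)"
      by (auto simp: space_PiM PiE_iff)
    also have "emeasure (\<Pi>\<^sub>M e\<in>E. lborel) \<dots> = (\<Prod>e\<in>E. emeasure lborel (g e -` A e))"
      using fin meas by (intro emeasure_PiM) auto
    also have "\<dots> = (\<Prod>e\<in>E. emeasure lborel (A e))"
    proof (rule prod.cong)
      fix e assume e: "e \<in> E"
      have "emeasure (distr lborel borel (g e)) (A e) = emeasure lborel (g e -` A e)"
        using A[OF e] assms(3)[OF e] by (subst emeasure_distr) auto
      then show "emeasure lborel (g e -` A e) = emeasure lborel (A e)"
        using g[OF e] by simp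
    qed simp
    finally show "emeasure (distr (\<Pi>\<^sub>M e\<in>E. lborel) (\<Pi>\<^sub>M e\<in>E. lborel) (\<lambda>t. \<lambda>e\<in>E. g e (t e))) (Pi\<^sub>E E A)
       = (\<Prod>e\<in>E. emeasure lborel (A e))" .
  qed simp
qed

lemma nn_integral_exp_square:
  fixes c :: real
  assumes "0 < c"
  shows "(\<integral>\<^sup>+t. ennreal (exp (- c * t\<^sup>2)) \<partial>lborel) = ennreal (sqrt (pi / c))"
proof -
  define \<sigma> where "\<sigma> = sqrt (1 / (2 * c))"
  have \<sigma>: "0 < \<sigma>" "\<sigma>\<^sup>2 = 1 / (2 * c)" using assms by (auto simp: \<sigma>_def)
  have "(\<integral>\<^sup>+t. ennreal (normal_density 0 \<sigma> t) \<partial>lborel) = 1"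
    using prob_space.emeasure_space_1[OF prob_space_normal_density[OF \<sigma>(1), of 0]]
    by (simp add: emeasure_density)
  then have "ennreal (sqrt (pi / c)) = ennreal (sqrt (pi / c)) * (\<integral>\<^sup>+t. ennreal (normal_density 0 \<sigma> t) \<partial>lborel)"
    by simp
  also have "\<dots> = (\<integral>\<^sup>+t. ennreal (sqrt (pi / c)) * ennreal (normal_density 0 \<sigma> t) \<partial>lborel)"
    by (rule nn_integral_cmult[symmetric]) measurable
  also have "\<dots> = (\<integral>\<^sup>+t. ennreal (exp (- c * t\<^sup>2)) \<partial>lborel)"
    using assms by (intro nn_integral_cong)
      (simp add: normal_density_def \<sigma> flip: ennreal_mult)
  finally show ?thesis by simp
qed

text \<open>
  The measure \<^const>\<open>lborel_subspace\<close> has \<open>S\<close> itself as its underlying space; here it is pushed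
  forward to the Borel sets of the ambient space, where it is concentrated on \<open>S\<close>.
\<close>

definition lborel_on :: "'a::euclidean_space set \<Rightarrow> 'a measure" where
  "lborel_on S = distr (lborel_subspace S) borel (\<lambda>x. x)"

lemma sets_lborel_on [simp, measurable_cong]: "sets (lborel_on S) = sets borel"
  and space_lborel_on [simp]: "space (lborel_on S) = UNIV"
  by (simp_all add: lborel_on_def)

lemma lborel_subspace_borel:
  "sets (lborel_subspace S) = sets (restrict_space borel S)" "space (lborel_subspace S) = S"
  by (simp_all add: lborel_subspace_def Let_def space_restrict_space)

lemma lborel_subspace_id_measurable: "(\<lambda>x. x) \<in> lborel_subspace S \<rightarrow>\<^sub>M borel"
  unfolding measurable_cong_sets[OF lborel_subspace_borel(1) refl]
  by (rule measurable_restrict_space1) simp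

lemma nn_integral_lborel_on:
  "f \<in> borel_measurable borel \<Longrightarrow> (\<integral>\<^sup>+x. f x \<partial>lborel_on S) = (\<integral>\<^sup>+x. f x \<partial>lborel_subspace S)"
  unfolding lborel_on_def by (rule nn_integral_distr[OF lborel_subspace_id_measurable]) simp

lemma lborel_on_coordinates:
  assumes S: "subspace S"
  obtains E where "orthonormal_basis_of S E" "finite E" "card E = dim S"
    "\<And>f. f \<in> borel_measurable borel \<Longrightarrow>
      (\<integral>\<^sup>+x. f x \<partial>lborel_on S) = (\<integral>\<^sup>+t. f (\<Sum>e\<in>E. t e *\<^sub>R e) \<partial>(\<Pi>\<^sub>M e\<in>E. lborel))"
proof -
  define E where "E = (SOME E. orthonormal_basis_of S E)"
  have E: "orthonormal_basis_of S E"
    unfolding E_def using orthonormal_basis_of_exists[OF S] by (rule someI_ex)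
  then have "0 \<notin> E" by (auto simp: orthonormal_basis_of_def)
  then have ind: "independent E"
    using E pairwise_orthogonal_independent by (auto simp: orthonormal_basis_of_def)
  then have fin: "finite E" and card: "card E = dim S"
    using E by (auto simp: orthonormal_basis_of_def independent_imp_finite dim_span_eq_card_independent dim_eq_card_independent)
  have m: "(\<lambda>t. \<Sum>e\<in>E. t e *\<^sub>R e) \<in> (\<Pi>\<^sub>M e\<in>E. lborel) \<rightarrow>\<^sub>M restrict_space borel S"
  proof (rule measurable_restrict_space2)
    show "(\<lambda>t. \<Sum>e\<in>E. t e *\<^sub>R e) \<in> space (\<Pi>\<^sub>M e\<in>E. lborel) \<rightarrow> S"
    proof
      fix t :: "'a \<Rightarrow> real"
      have "(\<Sum>e\<in>E. t e *\<^sub>R e) \<in> span E"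
        by (intro span_sum span_scale span_base)
      then show "(\<Sum>e\<in>E. t e *\<^sub>R e) \<in> S"
        using E by (simp add: orthonormal_basis_of_def)
    qed
  qed measurable
  show thesis
  proof (rule that[OF E fin card])
    fix f :: "'a \<Rightarrow> ennreal" assume f: "f \<in> borel_measurable borel"
    have "f \<in> borel_measurable (restrict_space borel S)"
      using f by (rule measurable_restrict_space1)
    then show "(\<integral>\<^sup>+x. f x \<partial>lborel_on S) = (\<integral>\<^sup>+t. f (\<Sum>e\<in>E. t e *\<^sub>R e) \<partial>(\<Pi>\<^sub>M e\<in>E. lborel))"
      unfolding nn_integral_lborel_on[OF f]
      by (simp add: lborel_subspace_def E_def[symmetric] nn_integral_distr[OF m])
  qed
qed

text \<open>
  The exact value, not just finiteness, is needed for the necessity of the dimension condition: it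
  shows how the mass of an anisotropic Gaussian scales with the dimension.
\<close>

lemma nn_integral_gauss_lborel_on:
  assumes S: "subspace S" and c: "0 < c"
  shows "(\<integral>\<^sup>+x. gauss c x \<partial>lborel_on S) = ennreal (sqrt (pi / c) ^ dim S)"
proof -
  obtain E where E: "orthonormal_basis_of S E" "finite E" "card E = dim S"
    and int: "\<And>f. f \<in> borel_measurable borel \<Longrightarrow>
      (\<integral>\<^sup>+x. f x \<partial>lborel_on S) = (\<integral>\<^sup>+t. f (\<Sum>e\<in>E. t e *\<^sub>R e) \<partial>(\<Pi>\<^sub>M e\<in>E. lborel))"
    using lborel_on_coordinates[OF S] by blast
  interpret product_sigma_finite "\<lambda>_::'a. lborel :: real measure"
    by standard
  have norm: "(norm (\<Sum>e\<in>E. t e *\<^sub>R e))\<^sup>2 = (\<Sum>e\<in>E. (t e)\<^sup>2)" for t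
  proof -
    have "(norm (\<Sum>e\<in>E. t e *\<^sub>R e))\<^sup>2 = (\<Sum>e\<in>E. (norm (t e *\<^sub>R e))\<^sup>2)"
      using E by (intro norm_sum_Pythagorean)
        (auto simp: orthonormal_basis_of_def pairwise_def orthogonal_def)
    also have "\<dots> = (\<Sum>e\<in>E. (t e)\<^sup>2)"
      using E by (intro sum.cong) (auto simp: orthonormal_basis_of_def)
    finally show ?thesis .
  qed
  have "(\<integral>\<^sup>+x. gauss c x \<partial>lborel_on S) = (\<integral>\<^sup>+t. (\<Prod>e\<in>E. ennreal (exp (- c * (t e)\<^sup>2))) \<partial>(\<Pi>\<^sub>M e\<in>E. lborel))"
    by (subst int) (auto simp: gauss_def norm sum_distrib_left prod_ennreal exp_sum[OF E(2)] simp flip: sum_negf)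
  also have "\<dots> = (\<Prod>e\<in>E. \<integral>\<^sup>+t. ennreal (exp (- c * t\<^sup>2)) \<partial>lborel)"
    by (rule product_nn_integral_prod[OF E(2)]) measurable
  also have "\<dots> = ennreal (sqrt (pi / c) ^ dim S)"
    unfolding nn_integral_exp_square[OF c] using c by (simp add: E ennreal_power)
  finally show ?thesis .
qed

lemma haar_on_lborel_on:
  assumes S: "subspace S"
  shows "haar_on S (lborel_on S)"
proof -
  obtain E where E: "orthonormal_basis_of S E" "finite E" "card E = dim S"
    and int: "\<And>f. f \<in> borel_measurable borel \<Longrightarrow>
      (\<integral>\<^sup>+x. f x \<partial>lborel_on S) = (\<integral>\<^sup>+t. f (\<Sum>e\<in>E. t e *\<^sub>R e) \<partial>(\<Pi>\<^sub>M e\<in>E. lborel))"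
    using lborel_on_coordinates[OF S] by blast
  have inv: "(\<integral>\<^sup>+t. f (\<Sum>e\<in>E. g e (t e) *\<^sub>R e) \<partial>(\<Pi>\<^sub>M e\<in>E. lborel)) = (\<integral>\<^sup>+x. f x \<partial>lborel_on S)"
    if [measurable]: "f \<in> borel_measurable borel" "\<And>e. e \<in> E \<Longrightarrow> g e \<in> borel_measurable borel"
      and g: "\<And>e. e \<in> E \<Longrightarrow> distr lborel borel (g e) = lborel"
    for f :: "'a \<Rightarrow> ennreal" and g :: "'a \<Rightarrow> real \<Rightarrow> real"
  proof -
    have "(\<integral>\<^sup>+x. f x \<partial>lborel_on S) = (\<integral>\<^sup>+t. f (\<Sum>e\<in>E. t e *\<^sub>R e)
        \<partial>distr (\<Pi>\<^sub>M e\<in>E. lborel) (\<Pi>\<^sub>M e\<in>E. lborel) (\<lambda>t. \<lambda>e\<in>E. g e (t e)))"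
      by (subst distr_PiM_lborel_invariant[OF E(2) g that(2)]) (auto simp: int)
    also have "\<dots> = (\<integral>\<^sup>+t. f (\<Sum>e\<in>E. (\<lambda>e\<in>E. g e (t e)) e *\<^sub>R e) \<partial>(\<Pi>\<^sub>M e\<in>E. lborel))"
      by (rule nn_integral_distr) measurable
    finally show ?thesis by simp
  qed
  show ?thesis
    unfolding haar_on_def
  proof (intro conjI ballI allI impI)
    show "sets (lborel_on S) = sets borel" by simp
    have "AE x in lborel_subspace S. x \<in> S"
      using lborel_subspace_borel(2)[of S] by (intro AE_I2) simp
    then show "AE x in lborel_on S. x \<in> S"
      unfolding lborel_on_def using closed_subspace[OF S]
      by (subst AE_distr_iff) (auto simp: lborel_subspace_id_measurable borel_closed)
  next
    fix a and f :: "'a \<Rightarrow> ennreal" assume a: "a \<in> S" and [measurable]: "f \<in> borel_measurable borel"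
    obtain u where u: "a = (\<Sum>e\<in>E. u e *\<^sub>R e)"
      using a E span_finite[OF E(2)] by (auto simp: orthonormal_basis_of_def)
    have "(\<integral>\<^sup>+x. f (x + a) \<partial>lborel_on S) = (\<integral>\<^sup>+t. f (\<Sum>e\<in>E. (u e + t e) *\<^sub>R e) \<partial>(\<Pi>\<^sub>M e\<in>E. lborel))"
      by (subst int) (auto simp: u scaleR_add_left sum.distrib add.commute)
    also have "\<dots> = (\<integral>\<^sup>+x. f x \<partial>lborel_on S)"
      by (rule inv) (auto simp: lborel_distr_plus)
    finally show "(\<integral>\<^sup>+x. f (x + a) \<partial>lborel_on S) = (\<integral>\<^sup>+x. f x \<partial>lborel_on S)" .
  next
    fix f :: "'a \<Rightarrow> ennreal" assume [measurable]: "f \<in> borel_measurable borel"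
    have "(\<integral>\<^sup>+x. f (- x) \<partial>lborel_on S) = (\<integral>\<^sup>+t. f (\<Sum>e\<in>E. (- t e) *\<^sub>R e) \<partial>(\<Pi>\<^sub>M e\<in>E. lborel))"
      by (subst int) (auto simp: sum_negf)
    also have "\<dots> = (\<integral>\<^sup>+x. f x \<partial>lborel_on S)"
      by (rule inv) (auto simp: lborel_distr_uminus)
    finally show "(\<integral>\<^sup>+x. f (- x) \<partial>lborel_on S) = (\<integral>\<^sup>+x. f x \<partial>lborel_on S)" .
  next
    fix c :: real assume "0 < c"
    then show "0 < (\<integral>\<^sup>+x. gauss c x \<partial>lborel_on S)" "(\<integral>\<^sup>+x. gauss c x \<partial>lborel_on S) < top"
      by (simp_all add: nn_integral_gauss_lborel_on[OF S])
  qed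
qed

text \<open>
  Both sides integrate against Haar measures of the same subspace, so they are proportional.
\<close>

lemma lborel_on_Fubini:
  assumes V: "subspace V" and W: "subspace W"
    and orth: "\<And>v w. v \<in> V \<Longrightarrow> w \<in> W \<Longrightarrow> v \<bullet> w = 0"
  obtains C :: real where "0 < C"
    "\<And>f. f \<in> borel_measurable borel \<Longrightarrow> (\<integral>\<^sup>+x. f x \<partial>lborel_on {v + w |v w. v \<in> V \<and> w \<in> W})
       = ennreal C * (\<integral>\<^sup>+w. \<integral>\<^sup>+v. f (v + w) \<partial>lborel_on V \<partial>lborel_on W)"
proof -
  note fub = haar_on_orthogonal_sum[OF haar_on_lborel_on[OF V] haar_on_lborel_on[OF W] V W orth]
  obtain C :: real where C: "0 < C" "\<And>f. f \<in> borel_measurable borel \<Longrightarrow>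
      (\<integral>\<^sup>+x. f x \<partial>lborel_on {v + w |v w. v \<in> V \<and> w \<in> W})
      = ennreal C * (\<integral>\<^sup>+x. f x \<partial>distr (lborel_on V \<Otimes>\<^sub>M lborel_on W) borel (\<lambda>(v, w). v + w))"
    using haar_on_unique[OF haar_on_lborel_on[OF subspace_sums[OF V W]] fub(1) subspace_sums[OF V W]]
    by blast
  show thesis
    by (rule that[OF C(1)]) (simp add: C(2) fub(2))
qed

section \<open>Orthogonal complements and quotients\<close>

definition orth_comp :: "'a::euclidean_space set \<Rightarrow> 'a set \<Rightarrow> 'a set" where
  "orth_comp H V = {w \<in> H. \<forall>v\<in>V. orthogonal v w}"

lemma subspace_orth_comp: "subspace H \<Longrightarrow> subspace (orth_comp H V)"
  unfolding subspace_def orth_comp_def by (auto simp: orthogonal_clauses)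

lemma sum_orth_comp:
  assumes H: "subspace H" and V: "subspace V" "V \<subseteq> H"
  shows "{v + w |v w. v \<in> V \<and> w \<in> orth_comp H V} = H"
proof (intro set_eqI iffI)
  fix x assume "x \<in> {v + w |v w. v \<in> V \<and> w \<in> orth_comp H V}"
  then show "x \<in> H" using H V by (auto simp: orth_comp_def intro: subspace_add)
next
  fix x assume x: "x \<in> H"
  obtain y z where yz: "y \<in> span V" "\<And>v. v \<in> span V \<Longrightarrow> orthogonal z v" "x = y + z"
    using orthogonal_subspace_decomp_exists[of V x] by blast
  have "y \<in> V" using yz(1) V by (simp add: span_eq_iff[THEN iffD2])
  moreover have "z = x - y" using yz by simp
  moreover have "z \<in> H" using calculation x H V by (auto intro: subspace_diff)
  ultimately have "z \<in> orth_comp H V"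
    using yz(2) by (auto simp: orth_comp_def span_base orthogonal_commute)
  with \<open>y \<in> V\<close> yz(3) show "x \<in> {v + w |v w. v \<in> V \<and> w \<in> orth_comp H V}"
    by blast
qed

lemma dim_orth_comp:
  assumes "subspace H" "subspace V" "V \<subseteq> H"
  shows "dim (orth_comp H V) + dim V = dim H"
  unfolding orth_comp_def using dim_subspace_orthogonal_to_vectors[OF assms(2,1,3)] .

text \<open>
  \<open>P\<close> annihilates \<open>Y\<close> and is the orthogonal projection of the ambient space onto the orthogonal
  complement of \<open>Y\<close>. It realises the quotient by \<open>Y\<close> inside the same type: \<open>P ` X\<close> is a copy
  of \<open>X / Y\<close> whenever \<open>Y \<subseteq> X\<close>.
\<close>

definition orth_proj :: "('a::euclidean_space \<Rightarrow> 'a) \<Rightarrow> 'a set \<Rightarrow> bool" where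
  "orth_proj P Y \<longleftrightarrow> linear P \<and> (\<forall>y. y - P y \<in> Y) \<and> (\<forall>y. \<forall>z\<in>Y. orthogonal z (P y))"

lemma orth_proj_exists:
  assumes "subspace Y"
  shows "\<exists>P. orth_proj P Y"
proof -
  obtain E where E: "orthonormal_basis_of Y E" using orthonormal_basis_of_exists[OF assms] ..
  then have "0 \<notin> E" by (auto simp: orthonormal_basis_of_def)
  then have fin: "finite E"
    using E pairwise_orthogonal_independent independent_imp_finite by (auto simp: orthonormal_basis_of_def)
  have ee: "e \<bullet> e' = (if e = e' then 1 else 0)" if "e \<in> E" "e' \<in> E" for e e'
    using E that by (auto simp: orthonormal_basis_of_def pairwise_def orthogonal_def dot_square_norm)
  define P where "P y = y - (\<Sum>e\<in>E. (y \<bullet> e) *\<^sub>R e)" for y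
  have "linear P"
    unfolding P_def
    by (rule linearI) (simp_all add: inner_add_left scaleR_add_left sum.distrib algebra_simps scaleR_sum_right)
  moreover have "y - P y \<in> Y" for y
  proof -
    have "(\<Sum>e\<in>E. (y \<bullet> e) *\<^sub>R e) \<in> span E" by (intro span_sum span_scale span_base)
    then show ?thesis using E by (simp add: P_def orthonormal_basis_of_def)
  qed
  moreover have "orthogonal z (P y)" if "z \<in> Y" for y z
  proof -
    have "e \<bullet> P y = 0" if "e \<in> E" for e
      using that fin by (simp add: P_def inner_diff_right inner_sum_right ee inner_commute sum.delta if_distrib cong: if_cong)
    then have "orthogonal (P y) e" if "e \<in> E" for e
      using that by (simp add: orthogonal_def inner_commute)
    moreover have "z \<in> span E" using that E by (simp add: orthonormal_basis_of_def)
    ultimately show ?thesis using orthogonal_to_span orthogonal_commute by metis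
  qed
  ultimately show ?thesis unfolding orth_proj_def by blast
qed

lemma orth_proj_image:
  assumes P: "orth_proj P Y" and X: "subspace X" and Y: "subspace Y" "Y \<subseteq> X"
  shows "P ` X = orth_comp X Y"
proof (intro set_eqI iffI)
  fix z assume "z \<in> P ` X"
  then obtain x where x: "x \<in> X" "z = P x" by auto
  have "x - P x \<in> X" using P Y by (auto simp: orth_proj_def)
  from subspace_diff[OF X x(1) this] have "P x \<in> X" by simp
  then show "z \<in> orth_comp X Y" using P x by (auto simp: orth_comp_def orth_proj_def)
next
  fix z assume z: "z \<in> orth_comp X Y"
  have "orthogonal y (z - P z)" if "y \<in> Y" for y
    using z P that by (auto simp: orth_comp_def orth_proj_def orthogonal_clauses)
  then have "orthogonal (z - P z) (z - P z)" using P by (auto simp: orth_proj_def)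
  then have "z = P z" by (simp add: orthogonal_def)
  then show "z \<in> P ` X" using z by (auto simp: orth_comp_def)
qed

lemma orth_proj_zero:
  assumes "orth_proj P Y" "subspace Y" "y \<in> Y"
  shows "P y = 0"
proof -
  have "y - P y \<in> Y" using assms by (auto simp: orth_proj_def)
  from subspace_diff[OF assms(2,3) this] have "P y \<in> Y" by simp
  then have "orthogonal (P y) (P y)" using assms by (auto simp: orth_proj_def)
  then show ?thesis by (simp add: orthogonal_def)
qed

lemma lborel_on_Fubini_orth_comp:
  assumes H: "subspace H" and V: "subspace V" "V \<subseteq> H"
  obtains C :: real where "0 < C"
    "\<And>f. f \<in> borel_measurable borel \<Longrightarrow> (\<integral>\<^sup>+x. f x \<partial>lborel_on H)
       = ennreal C * (\<integral>\<^sup>+w. \<integral>\<^sup>+v. f (v + w) \<partial>lborel_on V \<partial>lborel_on (orth_comp H V))"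
  using lborel_on_Fubini[OF V(1) subspace_orth_comp[OF H, of V]]
  unfolding sum_orth_comp[OF H V] by (auto simp: orth_comp_def orthogonal_def)

lemma sigma_finite_lborel_on: "subspace S \<Longrightarrow> sigma_finite_measure (lborel_on S)"
  by (rule haar_on_sigma_finite[OF haar_on_lborel_on])

lemma AE_lborel_on: "subspace S \<Longrightarrow> AE x in lborel_on S. x \<in> S"
  by (rule haar_on_AE[OF haar_on_lborel_on])

lemma measurable_nn_integral_lborel_on [measurable]:
  assumes "subspace V" and [measurable]: "f \<in> borel_measurable borel"
  shows "(\<lambda>w. \<integral>\<^sup>+v. f (v + w) \<partial>lborel_on V) \<in> borel_measurable borel"
proof -
  interpret sigma_finite_measure "lborel_on V" using assms(1) by (rule sigma_finite_lborel_on)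
  show ?thesis by measurable
qed

section \<open>Powers of extended non-negative reals\<close>

text \<open>
  Powers of extended non-negative reals with \<open>x\<^sup>0 = 1\<close> for all \<open>x\<close>, including \<open>0\<close> and
  \<open>\<infinity>\<close>. Infinite values have to be allowed because the fibre integrals of an integrable function
  can be infinite on a null set.
\<close>

definition epow :: "ennreal \<Rightarrow> real \<Rightarrow> ennreal" where
  "epow x p = (if p = 0 then 1 else if x = top then top else ennreal (enn2real x powr p))"

lemma epow_measurable [measurable (raw)]:
  assumes [measurable]: "f \<in> borel_measurable M"
  shows "(\<lambda>x. epow (f x) p) \<in> borel_measurable M"
  unfolding epow_def by measurable

lemma epow_0 [simp]: "epow x 0 = 1"
  by (simp add: epow_def)

lemma epow_top: "p \<noteq> 0 \<Longrightarrow> epow top p = top"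
  by (simp add: epow_def)

lemma epow_zero: "p \<noteq> 0 \<Longrightarrow> epow 0 p = 0"
  by (simp add: epow_def)

lemma epow_ennreal: "0 \<le> r \<Longrightarrow> epow (ennreal r) p = ennreal (rpow r p)"
  by (simp add: epow_def rpow_def)

lemma epow_ennreal_pos: "0 < r \<Longrightarrow> epow (ennreal r) p = ennreal (r powr p)"
  by (simp add: epow_def)

lemma epow_mono:
  assumes "0 \<le> p" "x \<le> y"
  shows "epow x p \<le> epow y p"
proof (cases "p = 0 \<or> y = top")
  case True then show ?thesis by (auto simp: epow_def)
next
  case False
  then have "x \<noteq> top" using assms by (auto simp: top_unique)
  moreover have "enn2real x \<le> enn2real y" using False assms by (intro enn2real_mono) (auto simp: top.not_eq_extremum)
  ultimately show ?thesis using False assms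
    by (auto simp: epow_def intro!: ennreal_leI powr_mono2)
qed

lemma epow_cmult:
  assumes "0 < c"
  shows "epow (ennreal c * x) p = ennreal (c powr p) * epow x p"
proof (cases x)
  case (real r)
  then show ?thesis using assms
    by (auto simp: epow_def powr_mult simp flip: ennreal_mult)
next
  case top
  then show ?thesis using assms by (auto simp: epow_def ennreal_mult_top)
qed

lemma epow_pos: "0 < x \<Longrightarrow> 0 < epow x p"
  by (cases x) (auto simp: epow_def)

lemma epow_le_one_plus:
  assumes "0 \<le> p" "p \<le> 1"
  shows "epow x p \<le> 1 + x"
proof (cases x)
  case (real r)
  have "r powr p \<le> 1 + r"
  proof (cases "r \<le> 1")
    case True
    then have "r powr p \<le> 1" using real assms by (intro powr_le1) auto
    then show ?thesis using real by simp
  next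
    case False
    then have "r powr p \<le> r powr 1" using assms by (intro powr_mono) auto
    then show ?thesis using real False by simp
  qed
  then have "ennreal (r powr p) \<le> ennreal (1 + r)"
    by (rule ennreal_leI)
  also have "\<dots> = 1 + x"
    using real by simp
  finally have "ennreal (r powr p) \<le> 1 + x" .
  moreover have "epow x p = (if p = 0 then 1 else ennreal (r powr p))"
    using real by (simp add: epow_def)
  ultimately show ?thesis by (simp split: if_splits)
qed simp

lemma prod_ennreal_pos:
  fixes g :: "'i \<Rightarrow> ennreal"
  shows "(\<And>j. j \<in> J \<Longrightarrow> 0 < g j) \<Longrightarrow> 0 < prod g J"
  by (induction J rule: infinite_finite_induct) (auto simp: ennreal_zero_less_mult_iff)

lemma prod_ennreal_eq_top:
  fixes g :: "'i \<Rightarrow> ennreal"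
  assumes "finite J" "\<And>j. j \<in> J \<Longrightarrow> 0 < g j" "i \<in> J" "g i = top"
  shows "prod g J = top"
proof -
  have "prod g J = g i * prod g (J - {i})" using assms by (simp add: prod.remove)
  moreover have "0 < prod g (J - {i})" using assms by (intro prod_ennreal_pos) auto
  ultimately show ?thesis using assms by (metis ennreal_top_mult less_irrefl)
qed

text \<open>
  With \<open>a\<close> and \<open>b\<close> the two products on the right, the left-hand side is
  \<open>a\<^sup>\<theta> b\<^sup>1\<^sup>-\<^sup>\<theta>\<close>, hence at most \<open>max a b\<close>. The zero and infinite values need separate
  attention: the convention \<open>0 * \<infinity> = 0\<close> is harmless because an exponent on the left vanishes
  only if both exponents on the right do.
\<close>

lemma prod_epow_interpolate:
  fixes x :: "'i \<Rightarrow> ennreal"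
  assumes J: "finite J" and pq: "\<And>j. j \<in> J \<Longrightarrow> 0 \<le> p j" "\<And>j. j \<in> J \<Longrightarrow> 0 \<le> q j"
    and \<theta>: "0 < \<theta>" "\<theta> < 1"
  shows "(\<Prod>j\<in>J. epow (x j) (\<theta> * p j + (1 - \<theta>) * q j))
    \<le> (\<Prod>j\<in>J. epow (x j) (p j)) + (\<Prod>j\<in>J. epow (x j) (q j))"
proof -
  define r where "r j = \<theta> * p j + (1 - \<theta>) * q j" for j
  have r0: "r j = 0 \<longleftrightarrow> p j = 0 \<and> q j = 0" if "j \<in> J" for j
    using pq[OF that] \<theta> by (auto simp: r_def add_nonneg_eq_0_iff)
  consider (zero) j where "j \<in> J" "r j \<noteq> 0" "x j = 0"
    | (top) j where "j \<in> J" "r j \<noteq> 0" "x j = top" "\<And>i. i \<in> J \<Longrightarrow> r i \<noteq> 0 \<Longrightarrow> 0 < x i"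
    | (real) "\<And>i. i \<in> J \<Longrightarrow> r i \<noteq> 0 \<Longrightarrow> 0 < x i \<and> x i < top"
    by (metis not_gr_zero top.not_eq_extremum)
  then have "(\<Prod>j\<in>J. epow (x j) (r j)) \<le> (\<Prod>j\<in>J. epow (x j) (p j)) + (\<Prod>j\<in>J. epow (x j) (q j))"
  proof cases
    case zero
    then have "(\<Prod>j\<in>J. epow (x j) (r j)) = 0"
      using J by (intro prod_zero) (auto simp: epow_zero intro!: bexI[of _ j])
    then show ?thesis by (simp only: zero_le)
  next
    case top
    have pos: "0 < epow (x i) (p i)" "0 < epow (x i) (q i)" if "i \<in> J" for i
      using top(4)[OF that] r0[OF that] by (cases "r i = 0"; auto intro: epow_pos)+
    have "p j \<noteq> 0 \<or> q j \<noteq> 0" using top r0 by auto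
    then have "(\<Prod>j\<in>J. epow (x j) (p j)) = \<infinity> \<or> (\<Prod>j\<in>J. epow (x j) (q j)) = \<infinity>"
      using prod_ennreal_eq_top[OF J pos(1) top(1)] prod_ennreal_eq_top[OF J pos(2) top(1)] top
      by (auto simp: epow_top)
    then show ?thesis by auto
  next
    case real
    have x: "0 < enn2real (x j)" if "j \<in> J" "r j \<noteq> 0" for j
      using real[OF that] by (simp add: enn2real_positive_iff)
    \<comment> \<open>where both exponents vanish, the value of the base is immaterial and is set to \<open>1\<close>\<close>
    define y where "y j = (if r j = 0 then 1 else enn2real (x j))" for j
    have y: "0 < y j" "epow (x j) (r j) = ennreal (y j powr r j)"
      "epow (x j) (p j) = ennreal (y j powr p j)" "epow (x j) (q j) = ennreal (y j powr q j)" if "j \<in> J" for j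
      using x[OF that] real[OF that] r0[OF that]
      by (auto simp: y_def epow_def split: if_splits)
    define A B where "A = (\<Prod>j\<in>J. y j powr p j)" and "B = (\<Prod>j\<in>J. y j powr q j)"
    have AB: "0 < A" "0 < B" unfolding A_def B_def using y(1) by (metis (mono_tags, lifting) less_irrefl powr_gt_zero prod_pos)+
    have "(\<Prod>j\<in>J. y j powr r j) = A powr \<theta> * B powr (1 - \<theta>)"
      unfolding A_def B_def r_def using y(1)
      by (simp add: powr_add prod.distrib prod_powr_distrib less_imp_le powr_powr mult.commute)
    also have "\<dots> \<le> max A B powr \<theta> * max A B powr (1 - \<theta>)"
      using AB \<theta> by (intro mult_mono powr_mono2) auto
    also have "\<dots> = max A B" using AB by (simp flip: powr_add)
    also have "\<dots> \<le> A + B" using AB by simp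
    finally have "ennreal (\<Prod>j\<in>J. y j powr r j) \<le> ennreal (A + B)"
      by (rule ennreal_leI)
    also have "\<dots> = ennreal A + ennreal B"
      using AB by simp
    finally have "ennreal (\<Prod>j\<in>J. y j powr r j) \<le> ennreal A + ennreal B" .
    moreover have "(\<Prod>j\<in>J. epow (x j) (r j)) = ennreal (\<Prod>j\<in>J. y j powr r j)"
      "(\<Prod>j\<in>J. epow (x j) (p j)) = ennreal A" "(\<Prod>j\<in>J. epow (x j) (q j)) = ennreal B"
      using y by (simp_all add: A_def B_def flip: prod_ennreal)
    ultimately show ?thesis by simp
  qed
  then show ?thesis by (simp add: r_def)
qed

section \<open>Gaussian-localised Brascamp--Lieb inequalities\<close>

lemma BL_integrand_measurable:
  fixes B :: "'i \<Rightarrow> 'a::euclidean_space \<Rightarrow> 'b::euclidean_space"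
  assumes B: "\<And>j. j \<in> J \<Longrightarrow> linear (B j)" and f: "\<And>j. j \<in> J \<Longrightarrow> f j \<in> borel_measurable borel"
  shows "(\<lambda>x. gauss c x * (\<Prod>j\<in>J. epow (f j (B j x)) (p j))) \<in> borel_measurable borel"
    and "(\<lambda>x. gauss c x * (\<Prod>j\<in>J. epow (f j (B j x)) (p j))) \<in> borel_measurable (lborel_on H)"
  unfolding measurable_cong_sets[OF sets_lborel_on refl]
  by (intro borel_measurable_times_ennreal gauss_measurable borel_measurable_prod_ennreal
      epow_measurable measurable_compose[OF linear_borel_measurable[OF B] f]; assumption)+

text \<open>
  Normalising the inputs by \<open>\<integral> f j \<le> 1\<close> rather than dividing by \<open>\<integral> f j\<close> avoids the
  degenerate cases \<open>0\<close> and \<open>\<infinity>\<close>. Taking the images \<open>B j ` H\<close> as targets makes the class of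
  these inequalities stable under restriction to subspaces, passage to quotients and omission of
  indices, on which the induction relies.
\<close>

definition BL :: "real \<Rightarrow> 'a::euclidean_space set \<Rightarrow> 'i set \<Rightarrow> ('i \<Rightarrow> 'a \<Rightarrow> 'b::euclidean_space) \<Rightarrow> ('i \<Rightarrow> real) \<Rightarrow> bool" where
  "BL c H J B p \<longleftrightarrow> (\<exists>K::real. 0 < K \<and> (\<forall>f::'i \<Rightarrow> 'b \<Rightarrow> ennreal.
     (\<forall>j\<in>J. f j \<in> borel_measurable borel \<and> (\<integral>\<^sup>+y. f j y \<partial>lborel_on (B j ` H)) \<le> 1) \<longrightarrow>
     (\<integral>\<^sup>+x. gauss c x * (\<Prod>j\<in>J. epow (f j (B j x)) (p j)) \<partial>lborel_on H) \<le> ennreal K))"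

lemma BL_I:
  fixes B :: "'i \<Rightarrow> 'a::euclidean_space \<Rightarrow> 'b::euclidean_space"
  assumes "K < top"
    and "\<And>f::'i \<Rightarrow> 'b \<Rightarrow> ennreal. (\<And>j. j \<in> J \<Longrightarrow> f j \<in> borel_measurable borel) \<Longrightarrow>
      (\<And>j. j \<in> J \<Longrightarrow> (\<integral>\<^sup>+y. f j y \<partial>lborel_on (B j ` H)) \<le> 1) \<Longrightarrow>
      (\<integral>\<^sup>+x. gauss c x * (\<Prod>j\<in>J. epow (f j (B j x)) (p j)) \<partial>lborel_on H) \<le> K"
  shows "BL c H J B p"
proof -
  have "K \<le> ennreal (enn2real K + 1)"
    using assms(1) by (cases K) (auto simp: ennreal_leI)
  moreover have "0 < enn2real K + 1" by (simp add: add_nonneg_pos)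
  ultimately show ?thesis
    unfolding BL_def using assms(2) by (meson order_trans)
qed

text \<open>
  Homogeneity: bounds \<open>C j\<close> for the integrals instead of \<open>1\<close> enter with the power \<open>p j\<close>.
\<close>

lemma BL_D:
  fixes B :: "'i \<Rightarrow> 'a::euclidean_space \<Rightarrow> 'b::euclidean_space"
  assumes BL: "BL c H J B p" and B: "\<And>j. j \<in> J \<Longrightarrow> linear (B j)"
  obtains K :: real where "0 < K"
    "\<And>(f::'i \<Rightarrow> 'b \<Rightarrow> ennreal) C. (\<And>j. j \<in> J \<Longrightarrow> f j \<in> borel_measurable borel) \<Longrightarrow> (\<And>j. j \<in> J \<Longrightarrow> 0 < C j) \<Longrightarrow>
      (\<And>j. j \<in> J \<Longrightarrow> (\<integral>\<^sup>+y. f j y \<partial>lborel_on (B j ` H)) \<le> ennreal (C j)) \<Longrightarrow>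
      (\<integral>\<^sup>+x. gauss c x * (\<Prod>j\<in>J. epow (f j (B j x)) (p j)) \<partial>lborel_on H) \<le> ennreal (K * (\<Prod>j\<in>J. C j powr p j))"
proof -
  obtain K :: real where K: "0 < K"
    "\<And>f::'i \<Rightarrow> 'b \<Rightarrow> ennreal. (\<And>j. j \<in> J \<Longrightarrow> f j \<in> borel_measurable borel \<and> (\<integral>\<^sup>+y. f j y \<partial>lborel_on (B j ` H)) \<le> 1) \<Longrightarrow>
     (\<integral>\<^sup>+x. gauss c x * (\<Prod>j\<in>J. epow (f j (B j x)) (p j)) \<partial>lborel_on H) \<le> ennreal K"
    using BL unfolding BL_def by blast
  show thesis
  proof (rule that[OF K(1)])
    fix f :: "'i \<Rightarrow> 'b \<Rightarrow> ennreal" and C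
    assume f: "\<And>j. j \<in> J \<Longrightarrow> f j \<in> borel_measurable borel" and C: "\<And>j. j \<in> J \<Longrightarrow> 0 < C j"
      and le: "\<And>j. j \<in> J \<Longrightarrow> (\<integral>\<^sup>+y. f j y \<partial>lborel_on (B j ` H)) \<le> ennreal (C j)"
    define g where "g j y = ennreal (1 / C j) * f j y" for j y
    have fg: "f j y = ennreal (C j) * g j y" if "j \<in> J" for j y
      using C[OF that] by (simp add: g_def mult.assoc[symmetric] flip: ennreal_mult)
    have g1: "(\<integral>\<^sup>+y. g j y \<partial>lborel_on (B j ` H)) \<le> 1" if "j \<in> J" for j
    proof -
      have "(\<integral>\<^sup>+y. g j y \<partial>lborel_on (B j ` H)) = ennreal (1 / C j) * (\<integral>\<^sup>+y. f j y \<partial>lborel_on (B j ` H))"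
        unfolding g_def using f[OF that] by (intro nn_integral_cmult) simp
      also have "\<dots> \<le> ennreal (1 / C j) * ennreal (C j)"
        by (intro mult_left_mono le that) simp
      also have "\<dots> = 1" using C[OF that] by (simp flip: ennreal_mult)
      finally show ?thesis .
    qed
    define D where "D = (\<Prod>j\<in>J. C j powr p j)"
    have D: "0 < D" unfolding D_def using C by (metis (mono_tags, lifting) less_irrefl powr_gt_zero prod_pos)
    have "gauss c x * (\<Prod>j\<in>J. epow (f j (B j x)) (p j)) = gauss c x * (\<Prod>j\<in>J. epow (g j (B j x)) (p j)) * ennreal D" for x
    proof -
      have "(\<Prod>j\<in>J. epow (f j (B j x)) (p j)) = (\<Prod>j\<in>J. ennreal (C j powr p j) * epow (g j (B j x)) (p j))"
        by (intro prod.cong) (simp_all add: fg epow_cmult C)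
      also have "\<dots> = ennreal D * (\<Prod>j\<in>J. epow (g j (B j x)) (p j))"
        by (simp add: prod.distrib prod_ennreal D_def)
      finally show ?thesis by (simp add: ac_simps)
    qed
    then have "(\<integral>\<^sup>+x. gauss c x * (\<Prod>j\<in>J. epow (f j (B j x)) (p j)) \<partial>lborel_on H)
      = (\<integral>\<^sup>+x. ennreal D * (gauss c x * (\<Prod>j\<in>J. epow (g j (B j x)) (p j))) \<partial>lborel_on H)"
      by (simp add: mult.commute)
    also have "\<dots> = ennreal D * (\<integral>\<^sup>+x. (gauss c x * (\<Prod>j\<in>J. epow (g j (B j x)) (p j))) \<partial>lborel_on H)"
      using f by (intro nn_integral_cmult BL_integrand_measurable B) (auto simp: g_def)
    also have "\<dots> \<le> ennreal D * ennreal K"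
      by (intro mult_left_mono K(2)) (use f g1 in \<open>auto simp: g_def\<close>)
    finally show "(\<integral>\<^sup>+x. gauss c x * (\<Prod>j\<in>J. epow (f j (B j x)) (p j)) \<partial>lborel_on H) \<le> ennreal (K * (\<Prod>j\<in>J. C j powr p j))"
      using D K(1) by (simp add: D_def mult.commute flip: ennreal_mult)
  qed
qed


text \<open>
  Because the inputs \<open>f j\<close> are the same for all exponents, interpolation between exponents is a
  pointwise matter and needs no complex interpolation theorem.
\<close>

lemma BL_interpolate:
  fixes B :: "'i \<Rightarrow> 'a::euclidean_space \<Rightarrow> 'b::euclidean_space"
  assumes p: "BL c H J B p" "\<And>j. j \<in> J \<Longrightarrow> 0 \<le> p j" and q: "BL c H J B q" "\<And>j. j \<in> J \<Longrightarrow> 0 \<le> q j"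
    and J: "finite J" and B: "\<And>j. j \<in> J \<Longrightarrow> linear (B j)" and \<theta>: "0 < \<theta>" "\<theta> < 1"
    and r: "\<And>j. j \<in> J \<Longrightarrow> r j = \<theta> * p j + (1 - \<theta>) * q j"
  shows "BL c H J B r"
proof -
  obtain K where K: "0 < K"
    "\<And>f::'i \<Rightarrow> 'b \<Rightarrow> ennreal. (\<And>j. j \<in> J \<Longrightarrow> f j \<in> borel_measurable borel \<and> (\<integral>\<^sup>+y. f j y \<partial>lborel_on (B j ` H)) \<le> 1) \<Longrightarrow>
     (\<integral>\<^sup>+x. gauss c x * (\<Prod>j\<in>J. epow (f j (B j x)) (p j)) \<partial>lborel_on H) \<le> ennreal K"
    using p(1) unfolding BL_def by blast
  obtain L where L: "0 < L"
    "\<And>f::'i \<Rightarrow> 'b \<Rightarrow> ennreal. (\<And>j. j \<in> J \<Longrightarrow> f j \<in> borel_measurable borel \<and> (\<integral>\<^sup>+y. f j y \<partial>lborel_on (B j ` H)) \<le> 1) \<Longrightarrow>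
     (\<integral>\<^sup>+x. gauss c x * (\<Prod>j\<in>J. epow (f j (B j x)) (q j)) \<partial>lborel_on H) \<le> ennreal L"
    using q(1) unfolding BL_def by blast
  show ?thesis
  proof (rule BL_I)
    show "ennreal K + ennreal L < top" by simp
    fix f :: "'i \<Rightarrow> 'b \<Rightarrow> ennreal"
    assume f: "\<And>j. j \<in> J \<Longrightarrow> f j \<in> borel_measurable borel"
      "\<And>j. j \<in> J \<Longrightarrow> (\<integral>\<^sup>+y. f j y \<partial>lborel_on (B j ` H)) \<le> 1"
    have m: "(\<lambda>x. gauss c x * (\<Prod>j\<in>J. epow (f j (B j x)) (p j))) \<in> borel_measurable (lborel_on H)" for p
      by (intro BL_integrand_measurable B f)
    have "(\<integral>\<^sup>+x. gauss c x * (\<Prod>j\<in>J. epow (f j (B j x)) (r j)) \<partial>lborel_on H)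
      \<le> (\<integral>\<^sup>+x. gauss c x * (\<Prod>j\<in>J. epow (f j (B j x)) (p j)) + gauss c x * (\<Prod>j\<in>J. epow (f j (B j x)) (q j)) \<partial>lborel_on H)"
    proof (rule nn_integral_mono)
      fix x
      have "(\<Prod>j\<in>J. epow (f j (B j x)) (r j)) = (\<Prod>j\<in>J. epow (f j (B j x)) (\<theta> * p j + (1 - \<theta>) * q j))"
        by (intro prod.cong) (simp_all add: r)
      also have "\<dots> \<le> (\<Prod>j\<in>J. epow (f j (B j x)) (p j)) + (\<Prod>j\<in>J. epow (f j (B j x)) (q j))"
        by (rule prod_epow_interpolate) (use J p(2) q(2) \<theta> in auto)
      finally show "gauss c x * (\<Prod>j\<in>J. epow (f j (B j x)) (r j))
        \<le> gauss c x * (\<Prod>j\<in>J. epow (f j (B j x)) (p j)) + gauss c x * (\<Prod>j\<in>J. epow (f j (B j x)) (q j))"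
        unfolding distrib_left[symmetric] by (rule mult_left_mono) simp
    qed
    also have "\<dots> = (\<integral>\<^sup>+x. gauss c x * (\<Prod>j\<in>J. epow (f j (B j x)) (p j)) \<partial>lborel_on H)
      + (\<integral>\<^sup>+x. gauss c x * (\<Prod>j\<in>J. epow (f j (B j x)) (q j)) \<partial>lborel_on H)"
      by (rule nn_integral_add[OF m m])
    also have "\<dots> \<le> ennreal K + ennreal L"
      by (intro add_mono K(2) L(2)) (use f in auto)
    finally show "(\<integral>\<^sup>+x. gauss c x * (\<Prod>j\<in>J. epow (f j (B j x)) (r j)) \<partial>lborel_on H) \<le> ennreal K + ennreal L" .
  qed
qed

lemma nn_integral_lborel_on_0:
  fixes f :: "'a::euclidean_space \<Rightarrow> ennreal"
  assumes "f \<in> borel_measurable borel"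
  shows "(\<integral>\<^sup>+y. f y \<partial>lborel_on {0}) = f 0"
proof -
  have s: "subspace {0::'a}" by (simp add: subspace_def)
  have "(\<integral>\<^sup>+y. f y \<partial>lborel_on {0}) = (\<integral>\<^sup>+y. f 0 * gauss 1 y \<partial>lborel_on {0::'a})"
  proof (rule nn_integral_cong_AE)
    show "AE y in lborel_on {0}. f y = f 0 * gauss 1 y"
      using AE_lborel_on[OF s] by eventually_elim (simp add: gauss_def)
  qed
  also have "\<dots> = f 0"
    by (subst nn_integral_cmult) (simp_all add: nn_integral_gauss_lborel_on[OF s])
  finally show ?thesis .
qed

text \<open>
  Indices with zero exponent contribute the factor \<open>1\<close>; indices with trivial target contribute at
  most \<open>1\<close>, since the measure on \<open>{0}\<close> is a unit point mass and so \<open>f j 0 \<le> 1\<close>.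
\<close>

lemma BL_subset:
  fixes B :: "'i \<Rightarrow> 'a::euclidean_space \<Rightarrow> 'b::euclidean_space"
  assumes BL: "BL c H J' B p" and J: "J' \<subseteq> J" "finite J" and p: "\<And>j. j \<in> J \<Longrightarrow> 0 \<le> p j"
    and triv: "\<And>j. j \<in> J - J' \<Longrightarrow> p j = 0 \<or> B j ` H = {0}" and H: "subspace H"
  shows "BL c H J B p"
proof -
  obtain K where K: "0 < K"
    "\<And>f::'i \<Rightarrow> 'b \<Rightarrow> ennreal. (\<And>j. j \<in> J' \<Longrightarrow> f j \<in> borel_measurable borel \<and> (\<integral>\<^sup>+y. f j y \<partial>lborel_on (B j ` H)) \<le> 1) \<Longrightarrow>
     (\<integral>\<^sup>+x. gauss c x * (\<Prod>j\<in>J'. epow (f j (B j x)) (p j)) \<partial>lborel_on H) \<le> ennreal K"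
    using BL unfolding BL_def by blast
  show ?thesis
  proof (rule BL_I)
    show "ennreal K < top" by simp
    fix f :: "'i \<Rightarrow> 'b \<Rightarrow> ennreal"
    assume f: "\<And>j. j \<in> J \<Longrightarrow> f j \<in> borel_measurable borel"
      "\<And>j. j \<in> J \<Longrightarrow> (\<integral>\<^sup>+y. f j y \<partial>lborel_on (B j ` H)) \<le> 1"
    have le1: "epow (f j (B j x)) (p j) \<le> 1" if j: "j \<in> J - J'" and x: "x \<in> H" for j x
    proof (cases "p j = 0")
      case False
      then have 0: "B j ` H = {0}" using triv[OF j] by simp
      then have "B j x = 0" using x by blast
      then have "f j (B j x) \<le> 1" using 0 f(2)[of j] f(1)[of j] j by (simp add: nn_integral_lborel_on_0)
      then have "epow (f j (B j x)) (p j) \<le> epow 1 (p j)" using p j by (intro epow_mono) auto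
      also have "epow 1 (p j) = 1" by (simp add: epow_def)
      finally show ?thesis .
    qed simp
    have "(\<integral>\<^sup>+x. gauss c x * (\<Prod>j\<in>J. epow (f j (B j x)) (p j)) \<partial>lborel_on H)
      \<le> (\<integral>\<^sup>+x. gauss c x * (\<Prod>j\<in>J'. epow (f j (B j x)) (p j)) \<partial>lborel_on H)"
    proof (rule nn_integral_mono_AE)
      show "AE x in lborel_on H. gauss c x * (\<Prod>j\<in>J. epow (f j (B j x)) (p j)) \<le> gauss c x * (\<Prod>j\<in>J'. epow (f j (B j x)) (p j))"
        using AE_lborel_on[OF H]
      proof eventually_elim
        case (elim x)
        have "(\<Prod>j\<in>J. epow (f j (B j x)) (p j)) = (\<Prod>j\<in>J - J'. epow (f j (B j x)) (p j)) * (\<Prod>j\<in>J'. epow (f j (B j x)) (p j))"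
          by (rule prod.subset_diff) (use J in auto)
        also have "\<dots> \<le> 1 * (\<Prod>j\<in>J'. epow (f j (B j x)) (p j))"
          using le1[OF _ elim] by (intro mult_right_mono prod_le_1) auto
        finally show ?case by (intro mult_left_mono) auto
      qed
    qed
    also have "\<dots> \<le> ennreal K" by (rule K(2)) (use f J in auto)
    finally show "(\<integral>\<^sup>+x. gauss c x * (\<Prod>j\<in>J. epow (f j (B j x)) (p j)) \<partial>lborel_on H) \<le> ennreal K" .
  qed
qed

text \<open>
  The orthogonal complement of the kernel in \<open>H\<close> parametrises the image; this replaces
  rank-nullity and the first isomorphism theorem for maps restricted to a subspace.
\<close>

lemma kernel_complement:
  fixes L :: "'a::euclidean_space \<Rightarrow> 'b::euclidean_space"
  assumes H: "subspace H" and L: "linear L"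
  defines "V \<equiv> {x \<in> H. L x = 0}"
  shows "subspace V" "V \<subseteq> H" "L ` orth_comp H V = L ` H" "inj_on L (orth_comp H V)"
proof -
  let ?W = "orth_comp H V"
  have "V = H \<inter> {x. L x = 0}" by (auto simp: V_def)
  then show V: "subspace V" "V \<subseteq> H"
    using H subspace_inter[OF H linear_subspace_kernel[OF L]] by auto
  have W: "subspace ?W" "?W \<subseteq> H" using subspace_orth_comp[OF H] by (auto simp: orth_comp_def)
  show "L ` ?W = L ` H"
  proof (intro subset_antisym)
    show "L ` ?W \<subseteq> L ` H" using W(2) by (rule image_mono)
    show "L ` H \<subseteq> L ` ?W"
    proof
      fix y assume "y \<in> L ` H"
      then obtain x where "x \<in> {v + w |v w. v \<in> V \<and> w \<in> ?W}" "y = L x"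
        unfolding sum_orth_comp[OF H V] by blast
      then obtain v w where "v \<in> V" "w \<in> ?W" "y = L (v + w)" by blast
      then show "y \<in> L ` ?W" by (auto simp: linear_add[OF L] V_def)
    qed
  qed
  show "inj_on L ?W"
  proof (rule inj_onI)
    fix x y assume xy: "x \<in> ?W" "y \<in> ?W" "L x = L y"
    then have "x - y \<in> ?W" using W by (intro subspace_diff)
    moreover have "x - y \<in> V" using xy W H by (auto simp: V_def linear_diff[OF L] intro: subspace_diff)
    ultimately have "orthogonal (x - y) (x - y)" by (auto simp: orth_comp_def)
    then show "x = y" by (simp add: orthogonal_def)
  qed
qed

text \<open>
  Integrating out the kernel of \<open>L\<close> costs only the finite mass of a Gaussian; on a complement of
  the kernel, \<open>L\<close> is injective and transports Haar measure to Haar measure.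
\<close>

lemma nn_integral_gauss_linear_bound:
  fixes L :: "'a::euclidean_space \<Rightarrow> 'b::euclidean_space"
  assumes H: "subspace H" and L: "linear L" and c: "0 < c"
  obtains C :: real where "0 \<le> C" "\<And>f. f \<in> borel_measurable borel \<Longrightarrow>
    (\<integral>\<^sup>+x. gauss c x * f (L x) \<partial>lborel_on H) \<le> ennreal C * (\<integral>\<^sup>+y. f y \<partial>lborel_on (L ` H))"
proof -
  define V where "V = {x \<in> H. L x = 0}"
  define W where "W = orth_comp H V"
  have V: "subspace V" "V \<subseteq> H" and LW: "L ` W = L ` H" and inj: "inj_on L W"
    using kernel_complement[OF H L] by (simp_all add: V_def W_def)
  have W: "subspace W" using subspace_orth_comp[OF H] by (simp add: W_def)
  obtain C1 :: real where C1: "0 < C1" "\<And>f. f \<in> borel_measurable borel \<Longrightarrow> (\<integral>\<^sup>+x. f x \<partial>lborel_on H)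
       = ennreal C1 * (\<integral>\<^sup>+w. \<integral>\<^sup>+v. f (v + w) \<partial>lborel_on V \<partial>lborel_on W)"
    using lborel_on_Fubini_orth_comp[OF H V] unfolding W_def by blast
  have "haar_on (L ` H) (distr (lborel_on W) borel L)"
    unfolding LW[symmetric] by (rule haar_on_linear_image[OF haar_on_lborel_on[OF W] W L inj])
  then obtain C2 :: real where C2: "0 < C2" "\<And>f. f \<in> borel_measurable borel \<Longrightarrow>
      (\<integral>\<^sup>+y. f y \<partial>distr (lborel_on W) borel L) = ennreal C2 * (\<integral>\<^sup>+y. f y \<partial>lborel_on (L ` H))"
    using haar_on_unique[OF _ haar_on_lborel_on] linear_subspace_image[OF L H] by blast
  define A where "A = sqrt (pi / c) ^ dim V"
  have A: "0 \<le> A" using c by (simp add: A_def)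
  show thesis
  proof (rule that)
    show "0 \<le> C1 * (A * C2)" using C1 C2 A by simp
    fix f :: "'b \<Rightarrow> ennreal" assume f: "f \<in> borel_measurable borel"
    note [measurable] = f linear_borel_measurable[OF L]
    have "(\<integral>\<^sup>+x. gauss c x * f (L x) \<partial>lborel_on H) = ennreal C1 * (\<integral>\<^sup>+w. \<integral>\<^sup>+v. gauss c (v + w) * f (L (v + w)) \<partial>lborel_on V \<partial>lborel_on W)"
      by (subst C1(2)) auto
    also have "(\<integral>\<^sup>+w. \<integral>\<^sup>+v. gauss c (v + w) * f (L (v + w)) \<partial>lborel_on V \<partial>lborel_on W) \<le> (\<integral>\<^sup>+w. ennreal A * f (L w) \<partial>lborel_on W)"
    proof (rule nn_integral_mono_AE)
      show "AE w in lborel_on W. (\<integral>\<^sup>+v. gauss c (v + w) * f (L (v + w)) \<partial>lborel_on V) \<le> ennreal A * f (L w)"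
        using AE_lborel_on[OF W]
      proof eventually_elim
        case (elim w)
        have "(\<integral>\<^sup>+v. gauss c (v + w) * f (L (v + w)) \<partial>lborel_on V) \<le> (\<integral>\<^sup>+v. gauss c v * f (L w) \<partial>lborel_on V)"
        proof (rule nn_integral_mono_AE)
          show "AE v in lborel_on V. gauss c (v + w) * f (L (v + w)) \<le> gauss c v * f (L w)"
            using AE_lborel_on[OF V(1)]
          proof eventually_elim
            case (elim v)
            have "orthogonal v w" using elim \<open>w \<in> W\<close> by (auto simp: W_def orth_comp_def)
            then have "(norm v)\<^sup>2 \<le> (norm (v + w))\<^sup>2" by (simp add: norm_add_Pythagorean)
            then have "gauss c (v + w) \<le> gauss c v" using c by (intro gauss_antimono) simp
            moreover have "L (v + w) = L w" using elim by (simp add: linear_add[OF L] V_def)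
            ultimately show ?case by (simp add: mult_right_mono)
          qed
        qed
        also have "\<dots> = ennreal A * f (L w)"
          by (subst nn_integral_multc) (simp_all add: nn_integral_gauss_lborel_on[OF V(1) c] A_def)
        finally show ?case .
      qed
    qed
    also have "\<dots> = ennreal A * (\<integral>\<^sup>+w. f (L w) \<partial>lborel_on W)"
      by (rule nn_integral_cmult) measurable
    also have "(\<integral>\<^sup>+w. f (L w) \<partial>lborel_on W) = ennreal C2 * (\<integral>\<^sup>+y. f y \<partial>lborel_on (L ` H))"
      using C2(2)[OF f] by (simp add: nn_integral_distr)
    finally show "(\<integral>\<^sup>+x. gauss c x * f (L x) \<partial>lborel_on H) \<le> ennreal (C1 * (A * C2)) * (\<integral>\<^sup>+y. f y \<partial>lborel_on (L ` H))"
      using C1 C2 A by (simp add: ennreal_mult mult.assoc mult_left_mono)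
  qed
qed

lemma BL_empty: "subspace H \<Longrightarrow> 0 < c \<Longrightarrow> BL c H {} B p"
  by (rule BL_I[of "ennreal (sqrt (pi / c) ^ dim H)"]) (simp_all add: nn_integral_gauss_lborel_on)

text \<open>
  Immediate from \<open>r\<^sup>p \<le> 1 + r\<close> for \<open>0 \<le> p \<le> 1\<close>.
\<close>

lemma BL_singleton:
  fixes B :: "'i \<Rightarrow> 'a::euclidean_space \<Rightarrow> 'b::euclidean_space"
  assumes H: "subspace H" and L: "linear (B i)" and c: "0 < c" and p: "0 \<le> p i" "p i \<le> 1"
  shows "BL c H {i} B p"
proof -
  obtain C :: real where C: "0 \<le> C" "\<And>f. f \<in> borel_measurable borel \<Longrightarrow>
    (\<integral>\<^sup>+x. gauss c x * f (B i x) \<partial>lborel_on H) \<le> ennreal C * (\<integral>\<^sup>+y. f y \<partial>lborel_on (B i ` H))"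
    using nn_integral_gauss_linear_bound[OF H L c] by blast
  show ?thesis
  proof (rule BL_I)
    show "ennreal (sqrt (pi / c) ^ dim H) + ennreal C < top" by simp
    fix f :: "'i \<Rightarrow> 'b \<Rightarrow> ennreal"
    assume f': "\<And>j. j \<in> {i} \<Longrightarrow> f j \<in> borel_measurable borel"
      "\<And>j. j \<in> {i} \<Longrightarrow> (\<integral>\<^sup>+y. f j y \<partial>lborel_on (B j ` H)) \<le> 1"
    then have f: "f i \<in> borel_measurable borel" "(\<integral>\<^sup>+y. f i y \<partial>lborel_on (B i ` H)) \<le> 1" by auto
    note [measurable] = f(1) linear_borel_measurable[OF L]
    have "(\<integral>\<^sup>+x. gauss c x * (\<Prod>j\<in>{i}. epow (f j (B j x)) (p j)) \<partial>lborel_on H) \<le> (\<integral>\<^sup>+x. gauss c x + gauss c x * f i (B i x) \<partial>lborel_on H)"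
    proof (rule nn_integral_mono)
      fix x
      have "gauss c x * epow (f i (B i x)) (p i) \<le> gauss c x * (1 + f i (B i x))"
        by (intro mult_left_mono epow_le_one_plus p) simp
      then show "gauss c x * (\<Prod>j\<in>{i}. epow (f j (B j x)) (p j)) \<le> gauss c x + gauss c x * f i (B i x)"
        by (simp add: distrib_left)
    qed
    also have "\<dots> = (\<integral>\<^sup>+x. gauss c x \<partial>lborel_on H) + (\<integral>\<^sup>+x. gauss c x * f i (B i x) \<partial>lborel_on H)"
      by (rule nn_integral_add) measurable
    also have "\<dots> \<le> ennreal (sqrt (pi / c) ^ dim H) + ennreal C * (\<integral>\<^sup>+y. f i y \<partial>lborel_on (B i ` H))"
      by (intro add_mono C(2) f) (simp add: nn_integral_gauss_lborel_on[OF H c])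
    also have "\<dots> \<le> ennreal (sqrt (pi / c) ^ dim H) + ennreal C * 1"
      by (intro add_left_mono mult_left_mono f) simp
    finally show "(\<integral>\<^sup>+x. gauss c x * (\<Prod>j\<in>{i}. epow (f j (B j x)) (p j)) \<partial>lborel_on H) \<le> ennreal (sqrt (pi / c) ^ dim H) + ennreal C" by simp
  qed
qed

lemma orth_proj_image_sum:
  assumes L: "linear L" and P: "orth_proj P (L ` V)" and V: "subspace V"
  shows "P ` L ` {v + u |v u. v \<in> V \<and> u \<in> U} = (P \<circ> L) ` U"
proof -
  have "P (L (v + u)) = P (L u)" if "v \<in> V" for v u
  proof -
    have "P (L v) = 0"
      using that by (intro orth_proj_zero[OF P linear_subspace_image[OF L V]]) simp
    then show ?thesis
      using P by (simp add: orth_proj_def linear_add[OF L] linear_add)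
  qed
  then show ?thesis
    using subspace_0[OF V] by (force simp: image_iff)
qed

text \<open>
  The inequality for \<open>H\<close> follows from those for a subspace \<open>V\<close> and for the quotient \<open>H / V\<close>. The
  quotient is modelled by the orthogonal complement \<open>W\<close> of \<open>V\<close>, with the maps \<open>B j\<close> followed by
  the projection along \<open>B j ` V\<close>. For fixed \<open>w \<in> W\<close>, the functions
  \<open>y \<mapsto> f j (y + B j w)\<close> on \<open>B j ` V\<close> have as integral a function \<open>F j\<close> of the projection of
  \<open>B j w\<close>, because \<open>B j w\<close> differs from it by an element of \<open>B j ` V\<close>. The inequality on \<open>V\<close>
  bounds the inner integral by a product of powers of the \<open>F j\<close>, and the inequality on \<open>W\<close>,
  applied to the \<open>F j\<close>, bounds the rest. No null sets have to be pulled back through \<open>B j\<close>: a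
  Gaussian is added to \<open>F j\<close>, so that it vanishes nowhere, and where some \<open>F j\<close> is infinite the
  asserted bound is infinite as well.
\<close>

lemma BL_factor:
  fixes B :: "'i \<Rightarrow> 'a::euclidean_space \<Rightarrow> 'b::euclidean_space"
  assumes H: "subspace H" and V: "subspace V" "V \<subseteq> H" and J: "finite J"
    and B: "\<And>j. j \<in> J \<Longrightarrow> linear (B j)" and p: "\<And>j. j \<in> J \<Longrightarrow> 0 < p j" and c: "0 < c"
    and P: "\<And>j. j \<in> J \<Longrightarrow> orth_proj (P j) (B j ` V)"
    and BL_V: "BL c V J B p" and BL_W: "BL c (orth_comp H V) J (\<lambda>j. P j \<circ> B j) p"
  shows "BL c H J B p"
proof -
  define W where "W = orth_comp H V"
  define Y where "Y j = B j ` V" for j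
  define Z where "Z j = (P j \<circ> B j) ` W" for j
  have W: "subspace W" "W \<subseteq> H" using subspace_orth_comp[OF H] by (auto simp: W_def orth_comp_def)
  note sum = sum_orth_comp[OF H V, folded W_def]
  have Y: "subspace (Y j)" "Y j \<subseteq> B j ` H" if "j \<in> J" for j
    using V linear_subspace_image[OF B[OF that]] by (auto simp: Y_def)
  have Plin: "linear (P j)" and Pdiff: "y - P j y \<in> Y j" if "j \<in> J" for j y
    using P[OF that] by (auto simp: orth_proj_def Y_def)
  have Z: "Z j = orth_comp (B j ` H) (Y j)" if j: "j \<in> J" for j
  proof -
    have "P j ` B j ` H = Z j"
      using orth_proj_image_sum[OF B[OF j] P[OF j] V(1), of W] unfolding sum Z_def .
    then show ?thesis
      using orth_proj_image[OF P[OF j] linear_subspace_image[OF B[OF j] H]] Y[OF j] by (simp add: Y_def)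
  qed
  obtain C0 :: real where C0: "0 < C0" "\<And>f. f \<in> borel_measurable borel \<Longrightarrow> (\<integral>\<^sup>+x. f x \<partial>lborel_on H)
       = ennreal C0 * (\<integral>\<^sup>+w. \<integral>\<^sup>+v. f (v + w) \<partial>lborel_on V \<partial>lborel_on W)"
    using lborel_on_Fubini_orth_comp[OF H V] unfolding W_def by blast
  have "\<forall>j\<in>J. \<exists>C>0. \<forall>f. f \<in> borel_measurable borel \<longrightarrow> (\<integral>\<^sup>+x. f x \<partial>lborel_on (B j ` H))
       = ennreal C * (\<integral>\<^sup>+z. \<integral>\<^sup>+y. f (y + z) \<partial>lborel_on (Y j) \<partial>lborel_on (Z j))"
  proof
    fix j assume j: "j \<in> J"
    show "\<exists>C>0. \<forall>f. f \<in> borel_measurable borel \<longrightarrow> (\<integral>\<^sup>+x. f x \<partial>lborel_on (B j ` H))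
       = ennreal C * (\<integral>\<^sup>+z. \<integral>\<^sup>+y. f (y + z) \<partial>lborel_on (Y j) \<partial>lborel_on (Z j))"
      using lborel_on_Fubini_orth_comp[OF linear_subspace_image[OF B[OF j] H] Y[OF j]]
      unfolding Z[OF j] by metis
  qed
  from bchoice[OF this] obtain C where "\<forall>j\<in>J. 0 < C j \<and> (\<forall>f. f \<in> borel_measurable borel \<longrightarrow> (\<integral>\<^sup>+x. f x \<partial>lborel_on (B j ` H))
       = ennreal (C j) * (\<integral>\<^sup>+z. \<integral>\<^sup>+y. f (y + z) \<partial>lborel_on (Y j) \<partial>lborel_on (Z j)))"
    by blast
  then have C: "j \<in> J \<Longrightarrow> 0 < C j"
    "j \<in> J \<Longrightarrow> f \<in> borel_measurable borel \<Longrightarrow> (\<integral>\<^sup>+x. f x \<partial>lborel_on (B j ` H))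
       = ennreal (C j) * (\<integral>\<^sup>+z. \<integral>\<^sup>+y. f (y + z) \<partial>lborel_on (Y j) \<partial>lborel_on (Z j))"
    for j f by blast+
  have PB: "linear (P j \<circ> B j)" if "j \<in> J" for j
    using linear_compose[OF B[OF that] Plin[OF that]] .
  have subZ: "subspace (Z j)" if "j \<in> J" for j
    unfolding Z_def using linear_subspace_image[OF PB[OF that] W(1)] .
  obtain K1 where K1: "0 < K1"
    "\<And>(f::'i \<Rightarrow> 'b \<Rightarrow> ennreal) C. (\<And>j. j \<in> J \<Longrightarrow> f j \<in> borel_measurable borel) \<Longrightarrow> (\<And>j. j \<in> J \<Longrightarrow> 0 < C j) \<Longrightarrow>
      (\<And>j. j \<in> J \<Longrightarrow> (\<integral>\<^sup>+y. f j y \<partial>lborel_on (Y j)) \<le> ennreal (C j)) \<Longrightarrow>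
      (\<integral>\<^sup>+x. gauss c x * (\<Prod>j\<in>J. epow (f j (B j x)) (p j)) \<partial>lborel_on V) \<le> ennreal (K1 * (\<Prod>j\<in>J. C j powr p j))"
    using BL_D[OF BL_V B] unfolding Y_def by blast
  obtain K2 where K2: "0 < K2"
    "\<And>(f::'i \<Rightarrow> 'b \<Rightarrow> ennreal) C. (\<And>j. j \<in> J \<Longrightarrow> f j \<in> borel_measurable borel) \<Longrightarrow> (\<And>j. j \<in> J \<Longrightarrow> 0 < C j) \<Longrightarrow>
      (\<And>j. j \<in> J \<Longrightarrow> (\<integral>\<^sup>+y. f j y \<partial>lborel_on (Z j)) \<le> ennreal (C j)) \<Longrightarrow>
      (\<integral>\<^sup>+x. gauss c x * (\<Prod>j\<in>J. epow (f j ((P j \<circ> B j) x)) (p j)) \<partial>lborel_on W) \<le> ennreal (K2 * (\<Prod>j\<in>J. C j powr p j))"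
    using BL_D[OF BL_W PB] unfolding Z_def W_def by blast
  define M where "M j = 1 / C j + sqrt pi ^ dim (Z j)" for j
  have M: "0 < M j" if "j \<in> J" for j
    using C(1)[OF that] by (simp add: M_def add_pos_pos)
  show ?thesis
  proof (rule BL_I)
    show "ennreal C0 * (ennreal K1 * ennreal (K2 * (\<Prod>j\<in>J. M j powr p j))) < top"
      by (simp add: ennreal_mult_less_top)
    fix f :: "'i \<Rightarrow> 'b \<Rightarrow> ennreal"
    assume f: "\<And>j. j \<in> J \<Longrightarrow> f j \<in> borel_measurable borel"
      "\<And>j. j \<in> J \<Longrightarrow> (\<integral>\<^sup>+y. f j y \<partial>lborel_on (B j ` H)) \<le> 1"
    \<comment> \<open>the added Gaussian keeps \<open>F j\<close> positive and costs only a constant in its integral\<close>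
    define F where "F j z = (\<integral>\<^sup>+y. f j (y + z) \<partial>lborel_on (Y j)) + gauss 1 z" for j z
    have F_meas: "F j \<in> borel_measurable borel" if "j \<in> J" for j
      unfolding F_def
      by (intro borel_measurable_add measurable_nn_integral_lborel_on Y f that gauss_measurable)
    have F_pos: "0 < F j z" for j z
      unfolding F_def using gauss_pos[of 1 z] by (simp add: add_nonneg_pos)
    have F_int: "(\<integral>\<^sup>+z. F j z \<partial>lborel_on (Z j)) \<le> ennreal (M j)" if j: "j \<in> J" for j
    proof -
      let ?I = "\<integral>\<^sup>+z. \<integral>\<^sup>+y. f j (y + z) \<partial>lborel_on (Y j) \<partial>lborel_on (Z j)"
      have "?I = ennreal (1 / C j) * (ennreal (C j) * ?I)"
        using C(1)[OF j] by (simp add: mult.assoc[symmetric] flip: ennreal_mult)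
      also have "\<dots> \<le> ennreal (1 / C j) * 1"
        using f(2)[OF j] unfolding C(2)[OF j f(1)[OF j]] by (rule mult_left_mono) simp
      finally have "?I \<le> ennreal (1 / C j)" by simp
      moreover have "(\<integral>\<^sup>+z. F j z \<partial>lborel_on (Z j)) = ?I + ennreal (sqrt pi ^ dim (Z j))"
        unfolding F_def using nn_integral_gauss_lborel_on[OF subZ[OF j], of 1]
        by (subst nn_integral_add)
          (auto simp: measurable_cong_sets[OF sets_lborel_on refl] intro!: measurable_nn_integral_lborel_on Y f j)
      ultimately show ?thesis
        using C(1)[OF j] by (simp add: M_def add_mono)
    qed
    have inner: "(\<integral>\<^sup>+v. gauss c (v + w) * (\<Prod>j\<in>J. epow (f j (B j (v + w))) (p j)) \<partial>lborel_on V)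
        \<le> ennreal K1 * (gauss c w * (\<Prod>j\<in>J. epow (F j ((P j \<circ> B j) w)) (p j)))" if w: "w \<in> W" for w
    proof -
      have "(\<integral>\<^sup>+v. gauss c (v + w) * (\<Prod>j\<in>J. epow (f j (B j (v + w))) (p j)) \<partial>lborel_on V)
        = (\<integral>\<^sup>+v. gauss c w * (gauss c v * (\<Prod>j\<in>J. epow (f j (B j v + B j w)) (p j))) \<partial>lborel_on V)"
      proof (rule nn_integral_cong_AE, rule eventually_mono[OF AE_lborel_on[OF V(1)]])
        fix v assume "v \<in> V"
        then have "v \<bullet> w = 0" using w by (auto simp: W_def orth_comp_def orthogonal_def)
        then show "gauss c (v + w) * (\<Prod>j\<in>J. epow (f j (B j (v + w))) (p j))
          = gauss c w * (gauss c v * (\<Prod>j\<in>J. epow (f j (B j v + B j w)) (p j)))"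
          by (simp add: gauss_add_orthogonal linear_add[OF B] ac_simps cong: prod.cong)
      qed
      also have "\<dots> = gauss c w * (\<integral>\<^sup>+v. gauss c v * (\<Prod>j\<in>J. epow (f j (B j v + B j w)) (p j)) \<partial>lborel_on V)"
        using BL_integrand_measurable(2)[of J B "\<lambda>j y. f j (y + B j w)"] B f(1)
        by (intro nn_integral_cmult) auto
      finally have eq: "(\<integral>\<^sup>+v. gauss c (v + w) * (\<Prod>j\<in>J. epow (f j (B j (v + w))) (p j)) \<partial>lborel_on V)
        = gauss c w * (\<integral>\<^sup>+v. gauss c v * (\<Prod>j\<in>J. epow (f j (B j v + B j w)) (p j)) \<partial>lborel_on V)" .
      have "(\<integral>\<^sup>+v. gauss c v * (\<Prod>j\<in>J. epow (f j (B j v + B j w)) (p j)) \<partial>lborel_on V)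
        \<le> ennreal K1 * (\<Prod>j\<in>J. epow (F j ((P j \<circ> B j) w)) (p j))"
      proof (cases "\<exists>i\<in>J. F i ((P i \<circ> B i) w) = top")
        case True
        then obtain i where i: "i \<in> J" "F i ((P i \<circ> B i) w) = top" by blast
        have "(\<Prod>j\<in>J. epow (F j ((P j \<circ> B j) w)) (p j)) = top"
          by (rule prod_ennreal_eq_top[OF J _ i(1)])
            (use p[OF i(1)] i(2) F_pos in \<open>auto simp: epow_top intro: epow_pos\<close>)
        then show ?thesis using K1 by (simp add: ennreal_mult_top)
      next
        case False
        define D where "D j = enn2real (F j ((P j \<circ> B j) w))" for j
        have D: "F j ((P j \<circ> B j) w) = ennreal (D j)" "0 < D j" if "j \<in> J" for j
          using False that F_pos[of j "(P j \<circ> B j) w"]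
          by (auto simp: D_def enn2real_positive_iff top.not_eq_extremum)
        have le: "(\<integral>\<^sup>+y. f j (y + B j w) \<partial>lborel_on (Y j)) \<le> ennreal (D j)" if j: "j \<in> J" for j
        proof -
          \<comment> \<open>\<open>B j w\<close> and its projection differ by a vector of \<open>Y j\<close>, so translation invariance applies\<close>
          have "(\<integral>\<^sup>+y. f j (y + B j w) \<partial>lborel_on (Y j))
            = (\<integral>\<^sup>+y. f j ((y + (B j w - P j (B j w))) + P j (B j w)) \<partial>lborel_on (Y j))"
            by simp
          also have "\<dots> = (\<integral>\<^sup>+y. f j (y + P j (B j w)) \<partial>lborel_on (Y j))"
            by (rule haar_on_translate[OF haar_on_lborel_on[OF Y(1)[OF j]] Pdiff[OF j]]) (use f(1)[OF j] in measurable)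
          also have "\<dots> \<le> F j ((P j \<circ> B j) w)" by (simp add: F_def)
          finally show ?thesis unfolding D(1)[OF j] .
        qed
        have "(\<integral>\<^sup>+v. gauss c v * (\<Prod>j\<in>J. epow (f j (B j v + B j w)) (p j)) \<partial>lborel_on V)
          \<le> ennreal (K1 * (\<Prod>j\<in>J. D j powr p j))"
          by (rule K1(2)[where f = "\<lambda>j y. f j (y + B j w)"]) (use f(1) D(2) le in auto)
        also have "\<dots> = ennreal K1 * (\<Prod>j\<in>J. epow (F j ((P j \<circ> B j) w)) (p j))"
          using K1(1) D by (simp add: ennreal_mult prod_nonneg epow_ennreal_pos prod_ennreal cong: prod.cong)
        finally show ?thesis .
      qed
      then show ?thesis
        unfolding eq mult.left_commute[of "ennreal K1"] by (rule mult_left_mono) simp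
    qed
    have "(\<integral>\<^sup>+x. gauss c x * (\<Prod>j\<in>J. epow (f j (B j x)) (p j)) \<partial>lborel_on H)
      = ennreal C0 * (\<integral>\<^sup>+w. \<integral>\<^sup>+v. gauss c (v + w) * (\<Prod>j\<in>J. epow (f j (B j (v + w))) (p j)) \<partial>lborel_on V \<partial>lborel_on W)"
      by (rule C0(2)) (intro BL_integrand_measurable B f)
    also have "\<dots> \<le> ennreal C0 * (\<integral>\<^sup>+w. ennreal K1 * (gauss c w * (\<Prod>j\<in>J. epow (F j ((P j \<circ> B j) w)) (p j))) \<partial>lborel_on W)"
      by (intro mult_left_mono nn_integral_mono_AE eventually_mono[OF AE_lborel_on[OF W(1)] inner]) auto
    also have "\<dots> = ennreal C0 * (ennreal K1 * (\<integral>\<^sup>+w. gauss c w * (\<Prod>j\<in>J. epow (F j ((P j \<circ> B j) w)) (p j)) \<partial>lborel_on W))"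
      by (subst nn_integral_cmult) (auto intro!: BL_integrand_measurable PB[unfolded comp_def] F_meas simp: comp_def)
    also have "\<dots> \<le> ennreal C0 * (ennreal K1 * ennreal (K2 * (\<Prod>j\<in>J. M j powr p j)))"
      by (intro mult_left_mono K2(2) F_meas F_int M) auto
    finally show "(\<integral>\<^sup>+x. gauss c x * (\<Prod>j\<in>J. epow (f j (B j x)) (p j)) \<partial>lborel_on H)
      \<le> ennreal C0 * (ennreal K1 * ennreal (K2 * (\<Prod>j\<in>J. M j powr p j)))" .
  qed
qed

section \<open>The dimension condition\<close>

text \<open>
  The slack of the dimension inequality at \<open>V\<close>. Differences are taken in the reals, so that the
  slack is affine in \<open>p\<close> and additive along chains of subspaces.
\<close>

definition codim_gap :: "'a::euclidean_space set \<Rightarrow> 'i set \<Rightarrow> ('i \<Rightarrow> 'a \<Rightarrow> 'b::euclidean_space) \<Rightarrow> ('i \<Rightarrow> real) \<Rightarrow> 'a set \<Rightarrow> real" where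
  "codim_gap H J B p V = real (dim H) - real (dim V) - (\<Sum>j\<in>J. p j * (real (dim (B j ` H)) - real (dim (B j ` V))))"

definition dim_cond :: "'a::euclidean_space set \<Rightarrow> 'i set \<Rightarrow> ('i \<Rightarrow> 'a \<Rightarrow> 'b::euclidean_space) \<Rightarrow> ('i \<Rightarrow> real) \<Rightarrow> bool" where
  "dim_cond H J B p \<longleftrightarrow> (\<forall>V. subspace V \<and> V \<subseteq> H \<longrightarrow> 0 \<le> codim_gap H J B p V)"

text \<open>
  Proper non-trivial subspaces with equality, i.e. those along which the datum can be factored into
  two data of smaller dimension.
\<close>

definition critical :: "'a::euclidean_space set \<Rightarrow> 'i set \<Rightarrow> ('i \<Rightarrow> 'a \<Rightarrow> 'b::euclidean_space) \<Rightarrow> ('i \<Rightarrow> real) \<Rightarrow> 'a set \<Rightarrow> bool" where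
  "critical H J B p V \<longleftrightarrow> subspace V \<and> V \<subseteq> H \<and> 0 < dim V \<and> dim V < dim H \<and> codim_gap H J B p V = 0"

text \<open>
  For \<open>U \<subseteq> V\<close> the gap of \<open>U\<close> in \<open>H\<close> is the gap of \<open>U\<close> in \<open>V\<close> plus the gap of \<open>V\<close> in \<open>H\<close>, and
  the latter is zero.
\<close>

lemma dim_cond_critical_subspace:
  assumes "dim_cond H J B p" "critical H J B p V"
  shows "dim_cond V J B p"
  unfolding dim_cond_def
proof (intro allI impI, elim conjE)
  fix U assume U: "subspace U" "U \<subseteq> V"
  have "codim_gap V J B p U = codim_gap H J B p U - codim_gap H J B p V"
    by (simp add: codim_gap_def algebra_simps sum_subtractf sum.distrib)
  then show "0 \<le> codim_gap V J B p U"
    using U assms by (auto simp: dim_cond_def critical_def)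
qed

text \<open>
  Subspaces \<open>U\<close> of the complement correspond to subspaces \<open>V + U\<close> of \<open>H\<close> containing \<open>V\<close>, and this
  correspondence preserves all codimensions involved. So the condition passes to the quotient by
  any \<open>V\<close>.
\<close>

lemma dim_cond_quotient:
  fixes B :: "'i \<Rightarrow> 'a::euclidean_space \<Rightarrow> 'b::euclidean_space"
  assumes cond: "dim_cond H J B p" and H: "subspace H" and V: "subspace V" "V \<subseteq> H"
    and B: "\<And>j. j \<in> J \<Longrightarrow> linear (B j)" and P: "\<And>j. j \<in> J \<Longrightarrow> orth_proj (P j) (B j ` V)"
  shows "dim_cond (orth_comp H V) J (\<lambda>j. P j \<circ> B j) p"
  unfolding dim_cond_def
proof (intro allI impI, elim conjE)
  let ?W = "orth_comp H V"
  \<comment> \<open>the subspace of \<open>H\<close> containing \<open>V\<close> that corresponds to \<open>U\<close>\<close>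
  define S where "S U = {v + u |v u. v \<in> V \<and> u \<in> U}" for U
  have S: "subspace (S U)" "S U \<subseteq> H" "V \<subseteq> S U" "dim (S U) = dim V + dim U"
    "\<And>j. j \<in> J \<Longrightarrow> real (dim ((P j \<circ> B j) ` U)) = real (dim (B j ` S U)) - real (dim (B j ` V))"
    if U: "subspace U" "U \<subseteq> ?W" for U
  proof -
    show sub: "subspace (S U)" unfolding S_def by (rule subspace_sums[OF V(1) U(1)])
    show "S U \<subseteq> H" using U V H by (auto simp: S_def orth_comp_def intro!: subspace_add)
    show VS: "V \<subseteq> S U" using subspace_0[OF U(1)] by (force simp: S_def)
    have "V \<inter> U = {0}"
      using U(2) subspace_0[OF V(1)] subspace_0[OF U(1)]
      by (auto simp: orth_comp_def orthogonal_self[symmetric] simp del: orthogonal_self)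
    then show "dim (S U) = dim V + dim U"
      using dim_sums_Int[OF V(1) U(1)] by (simp add: S_def)
    fix j assume j: "j \<in> J"
    have "(P j \<circ> B j) ` U = P j ` B j ` S U"
      unfolding S_def using orth_proj_image_sum[OF B[OF j] P[OF j] V(1)] by simp
    also have "\<dots> = orth_comp (B j ` S U) (B j ` V)"
      by (intro orth_proj_image[OF P[OF j]] linear_subspace_image B j sub V image_mono VS)
    finally have "(P j \<circ> B j) ` U = orth_comp (B j ` S U) (B j ` V)" .
    moreover have "dim (orth_comp (B j ` S U) (B j ` V)) + dim (B j ` V) = dim (B j ` S U)"
      by (intro dim_orth_comp linear_subspace_image B j sub V image_mono VS)
    ultimately show "real (dim ((P j \<circ> B j) ` U)) = real (dim (B j ` S U)) - real (dim (B j ` V))"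
      by simp
  qed
  fix U assume U: "subspace U" "U \<subseteq> ?W"
  note SU = S[OF U]
  have SW: "S ?W = H" unfolding S_def by (rule sum_orth_comp[OF H V])
  note SW' = S[OF subspace_orth_comp[OF H] order_refl, unfolded SW]
  have "codim_gap ?W J (\<lambda>j. P j \<circ> B j) p U = codim_gap H J B p (S U)"
  proof -
    have "(\<Sum>j\<in>J. p j * (real (dim ((P j \<circ> B j) ` ?W)) - real (dim ((P j \<circ> B j) ` U))))
      = (\<Sum>j\<in>J. p j * (real (dim (B j ` H)) - real (dim (B j ` S U))))"
      by (intro sum.cong refl) (simp only: SU(5) SW'(5), simp)
    then show ?thesis
      unfolding codim_gap_def using SU(4) SW'(4) by simp
  qed
  then show "0 \<le> codim_gap ?W J (\<lambda>j. P j \<circ> B j) p U"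
    using cond SU(1,2) by (simp add: dim_cond_def)
qed

text \<open>
  Without critical subspaces the exponent can be moved: raising \<open>p i\<close> and lowering \<open>p k\<close> at rates
  inversely proportional to the dimensions of their targets keeps \<open>\<Sum> p j * dim (B j ` H)\<close>, and
  hence the gap of \<open>{0}\<close>, unchanged. The gap of \<open>H\<close> is always zero. The gaps of the other subspaces
  are positive at the start and take only finitely many affine forms, because they depend on
  dimensions only. So the motion can continue for a positive time until one of them reaches zero
  or \<open>p k\<close> vanishes.
\<close>

lemma dim_cond_move:
  fixes B :: "'i \<Rightarrow> 'a::euclidean_space \<Rightarrow> 'b::euclidean_space"
  assumes H: "subspace H" and J: "finite J" and ik: "i \<in> J" "k \<in> J" "i \<noteq> k"
    and B: "\<And>j. j \<in> J \<Longrightarrow> linear (B j)" and p: "\<And>j. j \<in> J \<Longrightarrow> 0 < p j"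
    and d: "\<And>j. j \<in> J \<Longrightarrow> 0 < dim (B j ` H)"
    and cond: "dim_cond H J B p" and nocrit: "\<And>V. \<not> critical H J B p V"
  obtains t q where "0 < t" "q = p (i := p i + t / dim (B i ` H), k := p k - t / dim (B k ` H))"
    "0 \<le> q k" "dim_cond H J B q" "q k = 0 \<or> (\<exists>V. critical H J B q V)"
proof -
  \<comment> \<open>the rate at which the gap of \<open>V\<close> decreases\<close>
  define \<rho> where "\<rho> V = (real (dim (B i ` H)) - real (dim (B i ` V))) / dim (B i ` H)
    - (real (dim (B k ` H)) - real (dim (B k ` V))) / dim (B k ` H)" for V
  define q where "q t = p (i := p i + t / dim (B i ` H), k := p k - t / dim (B k ` H))" for t
  have gap: "codim_gap H J B (q t) V = codim_gap H J B p V - t * \<rho> V" for t V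
  proof -
    define e where "e j = real (dim (B j ` H)) - real (dim (B j ` V))" for j
    have "(\<Sum>j\<in>J. q t j * e j) = (\<Sum>j\<in>J. p j * e j + (if j = i then t / dim (B i ` H) * e i else 0)
      - (if j = k then t / dim (B k ` H) * e k else 0))"
      using ik(3) by (intro sum.cong) (auto simp: q_def algebra_simps)
    also have "\<dots> = (\<Sum>j\<in>J. p j * e j) + (t / dim (B i ` H) * e i - t / dim (B k ` H) * e k)"
      using J ik by (simp add: sum.distrib sum_subtractf)
    also have "t / dim (B i ` H) * e i - t / dim (B k ` H) * e k = t * \<rho> V"
      unfolding \<rho>_def e_def[symmetric] by (simp add: right_diff_distrib)
    finally show ?thesis
      unfolding codim_gap_def e_def[symmetric] by simp
  qed
  \<comment> \<open>the subspaces that can obstruct the motion, and the times at which an obstruction occurs\<close>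
  define VV where "VV = {V. subspace V \<and> V \<subseteq> H \<and> 0 < dim V \<and> dim V < dim H \<and> 0 < \<rho> V}"
  define T where "T = insert (p k * dim (B k ` H)) ((\<lambda>V. codim_gap H J B p V / \<rho> V) ` VV)"
  have "finite ((\<lambda>V. codim_gap H J B p V / \<rho> V) ` VV)"
  proof -
    \<comment> \<open>the dimensions on which the obstruction time depends; they take finitely many values\<close>
    define D where "D V = (dim V, \<lambda>j\<in>J. dim (B j ` V))" for V
    have "D ` VV \<subseteq> {..dim H} \<times> (\<Pi>\<^sub>E j\<in>J. {..dim (B j ` H)})"
      by (auto simp: D_def VV_def intro!: dim_subset image_mono)
    then have fin: "finite (D ` VV)"
      by (rule finite_subset) (use J in \<open>auto intro!: finite_PiE\<close>)
    have "codim_gap H J B p V / \<rho> V = codim_gap H J B p V' / \<rho> V'" if "D V = D V'" for V V'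
    proof -
      have "dim V = dim V'" "\<And>j. j \<in> J \<Longrightarrow> dim (B j ` V) = dim (B j ` V')"
        using that by (auto simp: D_def dest: fun_cong split: if_splits)
      then show ?thesis using ik by (simp add: codim_gap_def \<rho>_def cong: sum.cong)
    qed
    then have "\<exists>h. \<forall>V\<in>VV. codim_gap H J B p V / \<rho> V = h (D V)"
      by (intro exI[of _ "\<lambda>x. codim_gap H J B p (SOME V. D V = x) / \<rho> (SOME V. D V = x)"]) (metis (mono_tags, lifting) someI)
    then obtain h where "\<forall>V\<in>VV. codim_gap H J B p V / \<rho> V = h (D V)" ..
    then have "(\<lambda>V. codim_gap H J B p V / \<rho> V) ` VV = h ` D ` VV" by (auto simp: image_iff)
    then show ?thesis using fin by simp
  qed
  then have T: "finite T" "T \<noteq> {}" by (auto simp: T_def)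
  define t where "t = Min T"
  have t_in: "t \<in> T" and t_le: "\<And>x. x \<in> T \<Longrightarrow> t \<le> x" using T by (auto simp: t_def)
  have strict: "0 < codim_gap H J B p V" if "subspace V" "V \<subseteq> H" "0 < dim V" "dim V < dim H" for V
    using that cond nocrit[of V] by (auto simp: dim_cond_def critical_def less_le)
  have t0: "0 < t"
    using t_in p[OF ik(2)] d[OF ik(2)] strict by (auto simp: T_def VV_def)
  show thesis
  proof (rule that[OF t0 q_def[of t]])
    have "t \<le> p k * dim (B k ` H)" by (rule t_le) (simp add: T_def)
    then show "0 \<le> q t k" using d[OF ik(2)] by (simp add: q_def field_simps)
    show "dim_cond H J B (q t)"
      unfolding dim_cond_def
    proof (intro allI impI, elim conjE)
      fix V assume V: "subspace V" "V \<subseteq> H"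
      have 0: "0 \<le> codim_gap H J B p V" using cond V by (simp add: dim_cond_def)
      have "t * \<rho> V \<le> codim_gap H J B p V"
      proof (cases "dim V = 0 \<or> dim V = dim H")
        case True
        then have "V = {0} \<or> V = H"
          using V H subspace_dim_equal[OF V(1) H V(2)] subspace_0[OF V(1)] by (auto simp: dim_eq_0)
        then have "\<rho> V = 0"
        proof
          assume "V = {0}"
          then have 0: "dim (B i ` V) = 0" "dim (B k ` V) = 0"
            using linear_0[OF B[OF ik(1)]] linear_0[OF B[OF ik(2)]] by simp_all
          have nz: "real (dim (B i ` H)) \<noteq> 0" "real (dim (B k ` H)) \<noteq> 0"
            using d[OF ik(1)] d[OF ik(2)] by linarith+
          show ?thesis
            unfolding \<rho>_def 0 of_nat_0 diff_zero nz[THEN divide_self] by simp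
        qed (simp add: \<rho>_def)
        then show ?thesis using 0 by simp
      next
        case False
        have "dim V \<le> dim H" using V by (intro dim_subset)
        show ?thesis
        proof (cases "0 < \<rho> V")
          case True
          have "0 < dim V" "dim V < dim H" using False \<open>dim V \<le> dim H\<close> by linarith+
          then have "V \<in> VV" using True V unfolding VV_def by blast
          then have "t \<le> codim_gap H J B p V / \<rho> V"
            by (intro t_le) (simp add: T_def)
          then show ?thesis using True by (simp add: field_simps)
        next
          case False
          then have "t * \<rho> V \<le> 0" using t0 by (simp add: mult_nonneg_nonpos)
          then show ?thesis using 0 by simp
        qed
      qed
      then show "0 \<le> codim_gap H J B (q t) V" by (simp add: gap)
    qed
    consider "t = p k * dim (B k ` H)" | V where "V \<in> VV" "t = codim_gap H J B p V / \<rho> V"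
      using t_in by (auto simp: T_def)
    then show "q t k = 0 \<or> (\<exists>V. critical H J B (q t) V)"
    proof cases
      case 1
      have nz: "real (dim (B k ` H)) \<noteq> 0" using d[OF ik(2)] by linarith
      have "q t k = p k - t / dim (B k ` H)" by (simp add: q_def)
      then show ?thesis unfolding 1 nonzero_mult_div_cancel_right[OF nz] by simp
    next
      case 2
      then have "codim_gap H J B (q t) V = 0" by (simp add: gap VV_def)
      then show ?thesis using 2(1) by (auto simp: critical_def VV_def)
    qed
  qed
qed

text \<open>
  Test the condition on the kernel of \<open>B i\<close>.
\<close>

lemma dim_cond_singleton:
  fixes B :: "'i \<Rightarrow> 'a::euclidean_space \<Rightarrow> 'b::euclidean_space"
  assumes H: "subspace H" and L: "linear (B i)" and d: "0 < dim (B i ` H)" and cond: "dim_cond H {i} B p"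
  shows "p i \<le> 1"
proof -
  define V where "V = {x \<in> H. B i x = 0}"
  note V = kernel_complement[OF H L, folded V_def]
  have "B i ` V = {0}" using subspace_0[OF V(1)] by (force simp: V_def)
  then have "codim_gap H {i} B p V = real (dim H) - real (dim V) - p i * real (dim (B i ` H))"
    by (simp add: codim_gap_def)
  moreover have "dim (B i ` H) = dim (orth_comp H V)"
    using dim_image_eq[OF L, of "orth_comp H V"] V subspace_orth_comp[OF H, of V]
    by (simp add: span_eq_iff[THEN iffD2])
  moreover have "dim (orth_comp H V) + dim V = dim H" by (rule dim_orth_comp[OF H V(1,2)])
  moreover have "0 \<le> codim_gap H {i} B p V" using cond V by (simp add: dim_cond_def)
  ultimately have "p i * real (dim (B i ` H)) \<le> real (dim (B i ` H))"
    by simp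
  then show ?thesis using d by simp
qed

lemma dim_cond_subset:
  assumes J: "J' \<subseteq> J" "finite J" and triv: "\<And>j. j \<in> J - J' \<Longrightarrow> p j = 0 \<or> B j ` H = {0}" and cond: "dim_cond H J B p"
  shows "dim_cond H J' B p"
  unfolding dim_cond_def
proof (intro allI impI, elim conjE)
  fix V assume V: "subspace V" "V \<subseteq> H"
  have eq: "(\<Sum>j\<in>J. p j * (real (dim (B j ` H)) - real (dim (B j ` V))))
    = (\<Sum>j\<in>J'. p j * (real (dim (B j ` H)) - real (dim (B j ` V))))"
  proof (rule sum.mono_neutral_right[OF J(2,1)], rule ballI)
    fix j assume j: "j \<in> J - J'"
    show "p j * (real (dim (B j ` H)) - real (dim (B j ` V))) = 0"
    proof (cases "p j = 0")
      case False
      then have "B j ` H = {0}" using triv[OF j] by simp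
      moreover from this V(2) have "B j ` V \<subseteq> {0}" by blast
      ultimately show ?thesis by (simp add: dim_eq_0)
    qed simp
  qed
  have "0 \<le> codim_gap H J B p V" using cond V by (simp add: dim_cond_def)
  then show "0 \<le> codim_gap H J' B p V" unfolding codim_gap_def eq .
qed

section \<open>Sufficiency by induction on dimension\<close>

text \<open>
  Sufficiency of the dimension condition, by induction on \<open>dim H\<close> and then on the number of indices.
  Indices that contribute at most the factor \<open>1\<close> are dropped. If there is a critical subspace, the
  problem factors into two of smaller dimension. Otherwise two exponents can be traded against each
  other in either direction until a critical subspace appears or an exponent vanishes; the
  inequality holds at both end points by what was just said, and \<open>p\<close> lies between them. A single
  remaining exponent is at most \<open>1\<close>.
\<close>

theorem BL_if_dim_cond:
  fixes B :: "'i \<Rightarrow> 'a::euclidean_space \<Rightarrow> 'b::euclidean_space"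
  assumes "subspace H" "finite J" "\<And>j. j \<in> J \<Longrightarrow> linear (B j)" "\<And>j. j \<in> J \<Longrightarrow> 0 \<le> p j" "0 < c" "dim_cond H J B p"
  shows "BL c H J B p"
  using assms
proof (induction "dim H" arbitrary: H J B p rule: less_induct)
  case (less H J B p)
  note H = less.prems(1) and c = less.prems(5)
  have crit: "BL c H J B p"
    if J: "finite J" and B: "\<And>j. j \<in> J \<Longrightarrow> linear (B j)" and p: "\<And>j. j \<in> J \<Longrightarrow> 0 < p j"
      and cond: "dim_cond H J B p" and V: "critical H J B p V" for J p V
  proof -
    have V': "subspace V" "V \<subseteq> H" "0 < dim V" "dim V < dim H" using V by (auto simp: critical_def)
    have "\<forall>j\<in>J. \<exists>P. orth_proj P (B j ` V)"
      using B V'(1) by (auto intro!: orth_proj_exists linear_subspace_image)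
    from bchoice[OF this] obtain P where P: "\<And>j. j \<in> J \<Longrightarrow> orth_proj (P j) (B j ` V)" by blast
    show ?thesis
    proof (rule BL_factor[OF H V'(1,2) J B p c P])
      show "BL c V J B p"
        by (rule less.hyps[OF V'(4,1) J B less_imp_le[OF p] c dim_cond_critical_subspace[OF cond V]])
      have "dim (orth_comp H V) < dim H" using dim_orth_comp[OF H V'(1,2)] V' by simp
      then show "BL c (orth_comp H V) J (\<lambda>j. P j \<circ> B j) p"
      proof (rule less.hyps[OF _ subspace_orth_comp[OF H] J _ less_imp_le[OF p] c dim_cond_quotient[OF cond H V'(1,2) B P]])
        fix j assume "j \<in> J"
        then show "linear (P j \<circ> B j)"
          using B P by (intro linear_compose) (auto simp: orth_proj_def)
      qed
    qed
  qed
  show ?case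
    using less.prems(2,3,4,6)
  proof (induction "card J" arbitrary: J p rule: less_induct)
    case (less J p)
    note J = less.prems(1) and B = less.prems(2) and p = less.prems(3) and cond = less.prems(4)
    have drop: "BL c H J B q"
      if "J' \<subset> J" "\<And>j. j \<in> J - J' \<Longrightarrow> q j = 0 \<or> B j ` H = {0}" "\<And>j. j \<in> J \<Longrightarrow> 0 \<le> q j" "dim_cond H J B q" for J' q
    proof -
      have "BL c H J' B q"
        using that J B by (intro less.hyps psubset_card_mono dim_cond_subset[of J' J]) (auto intro: finite_subset)
      then show ?thesis
        by (rule BL_subset) (use that J H in auto)
    qed
    show ?case
    proof (cases "\<exists>j\<in>J. p j = 0 \<or> B j ` H = {0}")
      case True
      then obtain j where "j \<in> J" "p j = 0 \<or> B j ` H = {0}" by blast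
      then show ?thesis using p cond by (intro drop[of "J - {j}"]) auto
    next
      case False
      then have p': "0 < p j" and d: "0 < dim (B j ` H)" if "j \<in> J" for j
        using p[OF that] that linear_subspace_image[OF B[OF that] H] subspace_0
        by (fastforce simp: less_le dim_eq_0)+
      consider "J = {}" | i where "J = {i}" | i k where "i \<in> J" "k \<in> J" "i \<noteq> k"
        by (metis insertI1 is_singletonI' is_singleton_def)
      then show ?thesis
      proof cases
        case 1
        then show ?thesis using BL_empty[OF H c] by simp
      next
        case (2 i)
        then show ?thesis
          using BL_singleton[OF H, of B i c p] dim_cond_singleton[OF H, of B i p] B c p d cond by simp
      next
        case (3 i k)
        show ?thesis
        proof (cases "\<exists>V. critical H J B p V")
          case True
          then show ?thesis using crit[OF J B p' cond] by blast
        next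
          case False
          then have nocrit: "\<And>V. \<not> critical H J B p V" by blast
          have endpoint: "BL c H J B q"
            if l: "l \<in> J" "\<And>j. j \<in> J \<Longrightarrow> j \<noteq> l \<Longrightarrow> 0 < q j" "0 \<le> q l" and cond: "dim_cond H J B q"
              and endp: "q l = 0 \<or> (\<exists>V. critical H J B q V)" for l q
          proof (cases "q l = 0")
            case True
            have "0 \<le> q j" if "j \<in> J" for j
              using l(2)[OF that] l(3) by (cases "j = l") auto
            then show ?thesis using True l(1) cond by (intro drop[of "J - {l}"]) auto
          next
            case False
            then obtain V where "critical H J B q V" using endp by blast
            moreover have "0 < q j" if "j \<in> J" for j
              using l(2)[OF that] l(3) False by (cases "j = l") auto
            ultimately show ?thesis using crit[OF J B _ cond] by blast
          qed
          obtain s q where q: "0 < s" "q = p (i := p i + s / dim (B i ` H), k := p k - s / dim (B k ` H))"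
            "0 \<le> q k" "dim_cond H J B q" "q k = 0 \<or> (\<exists>V. critical H J B q V)"
            using dim_cond_move[OF H J 3 B p' d cond nocrit] by blast
          obtain t r where r: "0 < t" "r = p (k := p k + t / dim (B k ` H), i := p i - t / dim (B i ` H))"
            "0 \<le> r i" "dim_cond H J B r" "r i = 0 \<or> (\<exists>V. critical H J B r V)"
            using dim_cond_move[OF H J 3(2,1) 3(3)[symmetric] B p' d cond nocrit] by blast
          have q_pos: "0 < q j" if "j \<in> J" "j \<noteq> k" for j
            using that q(1,2) p'[OF that(1)] by (auto intro!: add_pos_nonneg)
          have r_pos: "0 < r j" if "j \<in> J" "j \<noteq> i" for j
            using that r(1,2) p'[OF that(1)] by (auto intro!: add_pos_nonneg)
          show ?thesis
          proof (rule BL_interpolate[where \<theta> = "t / (s + t)"])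
            show "BL c H J B q" by (rule endpoint[OF 3(2) q_pos q(3-5)])
            show "BL c H J B r" by (rule endpoint[OF 3(1) r_pos r(3-5)])
            show "0 \<le> q j" if "j \<in> J" for j using q_pos[OF that] q(3) by (cases "j = k") auto
            show "0 \<le> r j" if "j \<in> J" for j using r_pos[OF that] r(3) by (cases "j = i") auto
            show "0 < t / (s + t)" "t / (s + t) < 1" using q(1) r(1) by auto
            show "p j = t / (s + t) * q j + (1 - t / (s + t)) * r j" for j
            proof -
              have "1 - t / (s + t) = s / (s + t)" using q(1) r(1) by (simp add: field_simps)
              moreover have "(s + t) * p j = t * q j + s * r j"
                using 3(3) by (simp add: q(2) r(2) algebra_simps)
              then have "p j = (t * q j + s * r j) / (s + t)"
                using q(1) r(1) by (simp add: field_simps)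
              ultimately show ?thesis by (simp add: add_divide_distrib)
            qed
          qed (use J B in auto)
        qed
      qed
    qed
  qed
qed

section \<open>Lebesgue measurable inputs and general positive definite forms\<close>

text \<open>
  Composing with the orthogonal projection onto \<open>H\<close>, here \<open>x \<mapsto> x - P x\<close>, extends the map to the
  whole space.
\<close>

lemma linear_map_on_extend:
  fixes f :: "'a::euclidean_space \<Rightarrow> 'b::euclidean_space"
  assumes f: "linear_map_on H T f" and H: "subspace H"
  obtains g where "linear g" "\<And>x. x \<in> H \<Longrightarrow> g x = f x"
proof -
  obtain P where P: "orth_proj P H" using orth_proj_exists[OF H] ..
  then have lin: "linear P" and PH: "x - P x \<in> H" for x by (auto simp: orth_proj_def)
  show thesis
  proof (rule that)
    show "linear (\<lambda>x. f (x - P x))"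
    proof (rule linearI)
      fix x y
      have "f ((x - P x) + (y - P y)) = f (x - P x) + f (y - P y)"
        using f PH by (auto simp: linear_map_on_def)
      then show "f (x + y - P (x + y)) = f (x - P x) + f (y - P y)"
        by (simp add: linear_add[OF lin] algebra_simps)
    next
      fix c x
      have "f (c *\<^sub>R (x - P x)) = c *\<^sub>R f (x - P x)"
        using f PH by (auto simp: linear_map_on_def)
      then show "f (c *\<^sub>R x - P (c *\<^sub>R x)) = c *\<^sub>R f (x - P x)"
        by (simp add: linear_scale[OF lin] algebra_simps)
    qed
    show "f (x - P x) = f x" if "x \<in> H" for x
      using orth_proj_zero[OF P H that] by simp
  qed
qed

text \<open>
  A Lebesgue measurable function need not remain measurable after composition with a linear map, so
  it is replaced by a Borel majorant with the same integral: a Borel representative, raised to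
  \<open>\<infinity>\<close> on a Borel null set containing all points where the two differ.
\<close>

lemma lebesgue_borel_majorant:
  fixes f :: "'a::euclidean_space \<Rightarrow> real"
  assumes S: "subspace S" and f: "integrable (lebesgue_subspace S) f" and pos: "\<And>y. y \<in> S \<Longrightarrow> 0 \<le> f y"
  obtains g :: "'a \<Rightarrow> ennreal" where "g \<in> borel_measurable borel" "\<And>y. y \<in> S \<Longrightarrow> ennreal (f y) \<le> g y"
    "(\<integral>\<^sup>+y. g y \<partial>lborel_on S) = ennreal (\<integral>y. f y \<partial>lebesgue_subspace S)"
proof -
  let ?M = "lborel_subspace S"
  note sp = lborel_subspace_borel(2)[of S]
  have "(\<lambda>y. ennreal (f y)) \<in> borel_measurable (completion ?M)"
    using borel_measurable_integrable[OF f] by simp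
  from completion_ex_borel_measurable[OF this] obtain g' where
    g'[measurable]: "g' \<in> borel_measurable ?M" and ae: "AE y in ?M. ennreal (f y) = g' y" by blast
  from ae obtain N where N: "{y \<in> space ?M. \<not> ennreal (f y) = g' y} \<subseteq> N" "N \<in> null_sets ?M"
    by (auto elim!: AE_E simp: null_sets_def)
  have [measurable]: "N \<in> sets ?M" using N by auto
  define h where "h y = g' y + top * indicator N y" for y
  have h[measurable]: "h \<in> borel_measurable ?M" unfolding h_def by measurable
  have "h \<in> borel_measurable (restrict_space borel S)"
    using h unfolding measurable_cong_sets[OF lborel_subspace_borel(1) refl] .
  then have hS: "(\<lambda>y. h y * indicator S y) \<in> borel_measurable borel"
    using closed_subspace[OF S] by (subst (asm) borel_measurable_restrict_space_iff_ennreal) (auto simp: borel_closed)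
  show thesis
  proof (rule that[OF hS])
    fix y assume y: "y \<in> S"
    show "ennreal (f y) \<le> h y * indicator S y"
      using N(1) y sp by (cases "y \<in> N") (auto simp: h_def)
  next
    have "(\<integral>\<^sup>+y. h y * indicator S y \<partial>lborel_on S) = (\<integral>\<^sup>+y. h y * indicator S y \<partial>?M)"
      by (rule nn_integral_lborel_on[OF hS])
    also have "\<dots> = (\<integral>\<^sup>+y. ennreal (f y) \<partial>?M)"
    proof (rule nn_integral_cong_AE)
      have "AE y in ?M. y \<notin> N" using N(2) by (rule AE_not_in)
      moreover have "AE y in ?M. y \<in> S" using sp by (intro AE_I2) simp
      ultimately show "AE y in ?M. h y * indicator S y = ennreal (f y)"
        using ae by eventually_elim (simp add: h_def)
    qed
    also have "\<dots> = (\<integral>\<^sup>+y. ennreal (f y) \<partial>lebesgue_subspace S)"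
      by (rule nn_integral_completion[symmetric])
    also have "\<dots> = ennreal (\<integral>y. f y \<partial>lebesgue_subspace S)"
      using f pos sp by (intro nn_integral_eq_integral AE_I2) auto
    finally show "(\<integral>\<^sup>+y. h y * indicator S y \<partial>lborel_on S) = ennreal (\<integral>y. f y \<partial>lebesgue_subspace S)" .
  qed
qed

lemma nn_integral_lebesgue_subspace:
  assumes f: "f \<in> borel_measurable borel"
  shows "(\<integral>\<^sup>+x. f x \<partial>lebesgue_subspace S) = (\<integral>\<^sup>+x. f x \<partial>lborel_on S)"
  by (simp add: nn_integral_completion nn_integral_lborel_on[OF f])

lemma integral_lebesgue_subspace:
  fixes f :: "'a::euclidean_space \<Rightarrow> real"
  assumes f: "f \<in> borel_measurable borel" "\<And>x. 0 \<le> f x" and r: "(\<integral>\<^sup>+x. ennreal (f x) \<partial>lborel_on S) = ennreal r" "0 \<le> r"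
  shows "integrable (lebesgue_subspace S) f" "(\<integral>x. f x \<partial>lebesgue_subspace S) = r"
proof -
  have "f \<in> borel_measurable (restrict_space borel S)"
    using f(1) by (rule measurable_restrict_space1)
  then have "f \<in> borel_measurable (lborel_subspace S)"
    unfolding measurable_cong_sets[OF lborel_subspace_borel(1) refl] .
  then have "f \<in> borel_measurable (lebesgue_subspace S)" by (rule measurable_completion)
  moreover have "(\<integral>\<^sup>+x. ennreal (f x) \<partial>lebesgue_subspace S) = ennreal r"
    using r(1) f(1) by (simp add: nn_integral_lebesgue_subspace)
  ultimately show "integrable (lebesgue_subspace S) f" "(\<integral>x. f x \<partial>lebesgue_subspace S) = r"
    using nn_integral_eq_integrable[of f "lebesgue_subspace S" r] f(2) r(2) by auto
qed

text \<open>
  The quadratic form attains a positive minimum on the unit sphere of \<open>H\<close>.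
\<close>

lemma positive_definite_lower_bound:
  fixes H :: "'a::euclidean_space set"
  assumes G: "positive_definite_on H G" and H: "subspace H"
  obtains a :: real where "0 < a" "\<And>x. x \<in> H \<Longrightarrow> a * (norm x)\<^sup>2 \<le> G x \<bullet> x"
proof -
  obtain G' where G': "linear G'" "\<And>x. x \<in> H \<Longrightarrow> G' x = G x"
    using linear_map_on_extend[of H H G] G H by (auto simp: positive_definite_on_def)
  let ?S = "sphere 0 1 \<inter> H"
  show thesis
  proof (cases "?S = {}")
    case True
    have "x = 0" if "x \<in> H" for x
    proof (rule ccontr)
      assume "x \<noteq> 0"
      then have "(1 / norm x) *\<^sub>R x \<in> ?S" using that H by (auto simp: subspace_scale)
      then show False using True by blast
    qed
    then have "1 * (norm x)\<^sup>2 \<le> G x \<bullet> x" if "x \<in> H" for x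
      using that by fastforce
    then show ?thesis by (rule that[OF zero_less_one])
  next
    case False
    have "continuous_on ?S (\<lambda>x. G' x \<bullet> x)"
      using G'(1) by (intro continuous_intros linear_continuous_on) (simp add: linear_conv_bounded_linear)
    moreover have "compact ?S"
      using closed_subspace[OF H] by (intro compact_Int_closed) auto
    ultimately have "\<exists>u\<in>?S. \<forall>x\<in>?S. G' u \<bullet> u \<le> G' x \<bullet> x"
      by (intro continuous_attains_inf False)
    then obtain u where u: "u \<in> ?S" "\<And>x. x \<in> ?S \<Longrightarrow> G' u \<bullet> u \<le> G' x \<bullet> x"
      by blast
    have "0 < G' u \<bullet> u"
      using u(1) G G'(2)[of u] by (auto simp: positive_definite_on_def)
    moreover have "G' u \<bullet> u * (norm x)\<^sup>2 \<le> G x \<bullet> x" if x: "x \<in> H" for x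
    proof (cases "x = 0")
      case False
      have "(1 / norm x) *\<^sub>R x \<in> ?S" using x H False by (auto simp: subspace_scale)
      from u(2)[OF this] have "G' u \<bullet> u \<le> (G' x \<bullet> x) / (norm x)\<^sup>2"
        by (simp add: linear_scale[OF G'(1)] power2_eq_square)
      then show ?thesis using False G'(2)[OF x] by (simp add: field_simps)
    qed (use x G' H in \<open>simp add: linear_0\<close>)
    ultimately show ?thesis by (rule that)
  qed
qed

section \<open>Squeezed Gaussians and the two implications\<close>

text \<open>
  The test functions for necessity: Gaussians with different widths along \<open>V\<close> and orthogonally to
  it. Their mass shows how many directions are squeezed when \<open>\<beta>\<close> grows.
\<close>

lemma nn_integral_split_gauss:
  assumes H: "subspace H" and V: "subspace V" "V \<subseteq> H" and P: "orth_proj P V"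
  obtains C :: real where "0 < C" "\<And>\<alpha> \<beta>. 0 < \<alpha> \<Longrightarrow> 0 < \<beta> \<Longrightarrow>
    (\<integral>\<^sup>+x. ennreal (exp (- (\<alpha> * (norm (x - P x))\<^sup>2 + \<beta> * (norm (P x))\<^sup>2))) \<partial>lborel_on H)
      = ennreal (C * sqrt (pi / \<alpha>) ^ dim V * sqrt (pi / \<beta>) ^ (dim H - dim V))"
proof -
  let ?W = "orth_comp H V"
  have W: "subspace ?W" by (rule subspace_orth_comp[OF H])
  have dW: "dim ?W = dim H - dim V" using dim_orth_comp[OF H V] by simp
  have lin: "linear P" using P by (simp add: orth_proj_def)
  note [measurable] = linear_borel_measurable[OF lin]
  obtain C :: real where C: "0 < C" "\<And>f. f \<in> borel_measurable borel \<Longrightarrow> (\<integral>\<^sup>+x. f x \<partial>lborel_on H)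
       = ennreal C * (\<integral>\<^sup>+w. \<integral>\<^sup>+v. f (v + w) \<partial>lborel_on V \<partial>lborel_on ?W)"
    using lborel_on_Fubini_orth_comp[OF H V] by blast
  show thesis
  proof (rule that[OF C(1)])
    fix \<alpha> \<beta> :: real assume pos: "0 < \<alpha>" "0 < \<beta>"
    define f where "f x = ennreal (exp (- (\<alpha> * (norm (x - P x))\<^sup>2 + \<beta> * (norm (P x))\<^sup>2)))" for x
    have f[measurable]: "f \<in> borel_measurable borel" unfolding f_def by measurable
    have split: "f (v + w) = gauss \<alpha> v * gauss \<beta> w" if "v \<in> V" "w \<in> ?W" for v w
    proof -
      have "w - P w \<in> V" using P by (auto simp: orth_proj_def)
      then have "orthogonal (w - P w) (w - P w)"
        using P that by (auto simp: orth_comp_def orth_proj_def orthogonal_clauses)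
      then have "P w = w" by (simp add: orthogonal_def)
      moreover have "P v = 0" by (rule orth_proj_zero[OF P V(1) that(1)])
      ultimately show ?thesis
        by (simp add: f_def linear_add[OF lin] gauss_def flip: ennreal_mult exp_add)
    qed
    have "(\<integral>\<^sup>+x. f x \<partial>lborel_on H) = ennreal C * (\<integral>\<^sup>+w. \<integral>\<^sup>+v. f (v + w) \<partial>lborel_on V \<partial>lborel_on ?W)"
      by (rule C(2)[OF f])
    also have "(\<integral>\<^sup>+w. \<integral>\<^sup>+v. f (v + w) \<partial>lborel_on V \<partial>lborel_on ?W) = (\<integral>\<^sup>+w. \<integral>\<^sup>+v. gauss \<alpha> v * gauss \<beta> w \<partial>lborel_on V \<partial>lborel_on ?W)"
    proof (rule nn_integral_cong_AE, rule eventually_mono[OF AE_lborel_on[OF W]])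
      fix w assume w: "w \<in> ?W"
      show "(\<integral>\<^sup>+v. f (v + w) \<partial>lborel_on V) = (\<integral>\<^sup>+v. gauss \<alpha> v * gauss \<beta> w \<partial>lborel_on V)"
        by (rule nn_integral_cong_AE, rule eventually_mono[OF AE_lborel_on[OF V(1)]]) (rule split[OF _ w])
    qed
    also have "\<dots> = ennreal (sqrt (pi / \<alpha>) ^ dim V) * ennreal (sqrt (pi / \<beta>) ^ (dim H - dim V))"
      by (simp add: nn_integral_multc nn_integral_cmult nn_integral_gauss_lborel_on V W dW pos)
    finally show "(\<integral>\<^sup>+x. ennreal (exp (- (\<alpha> * (norm (x - P x))\<^sup>2 + \<beta> * (norm (P x))\<^sup>2))) \<partial>lborel_on H)
      = ennreal (C * sqrt (pi / \<alpha>) ^ dim V * sqrt (pi / \<beta>) ^ (dim H - dim V))"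
      using C(1) pos by (simp add: f_def ennreal_mult mult.assoc)
  qed
qed

lemma orth_proj_Pythagoras:
  assumes "orth_proj P Y"
  shows "(norm y)\<^sup>2 = (norm (y - P y))\<^sup>2 + (norm (P y))\<^sup>2"
proof -
  have "orthogonal (y - P y) (P y)" using assms by (auto simp: orth_proj_def)
  from norm_add_Pythagorean[OF this] show ?thesis by simp
qed

text \<open>
  Compare the two powers as \<open>\<epsilon>\<close> tends to \<open>0\<close>.
\<close>

lemma powr_le_imp_exponent_le:
  fixes A K :: real
  assumes A: "0 < A" and le: "\<And>\<epsilon>. 0 < \<epsilon> \<Longrightarrow> \<epsilon> \<le> 1 \<Longrightarrow> A * \<epsilon> powr a \<le> K * \<epsilon> powr s"
  shows "s \<le> a"
proof (rule ccontr)
  assume "\<not> s \<le> a"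
  then have d: "0 < s - a" by simp
  have K: "0 < K" using le[of 1] A by simp
  \<comment> \<open>small enough for \<open>K\<close> times the surplus power of \<open>\<epsilon>\<close> to stay below \<open>A / 2\<close>\<close>
  define \<epsilon> where "\<epsilon> = min 1 ((A / (2 * K)) powr (1 / (s - a)))"
  have \<epsilon>: "0 < \<epsilon>" "\<epsilon> \<le> 1" using A K by (auto simp: \<epsilon>_def)
  have "\<epsilon> powr (s - a) \<le> ((A / (2 * K)) powr (1 / (s - a))) powr (s - a)"
    using \<epsilon> d by (intro powr_mono2) (auto simp: \<epsilon>_def)
  also have "\<dots> = A / (2 * K)" using A K d by (simp add: powr_powr)
  finally have "K * \<epsilon> powr (s - a) \<le> A / 2" using K by (simp add: field_simps)
  moreover have "A * \<epsilon> powr a \<le> K * \<epsilon> powr (s - a) * \<epsilon> powr a"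
    using le[OF \<epsilon>] by (simp add: mult.assoc flip: powr_add)
  then have "A \<le> K * \<epsilon> powr (s - a)" using \<epsilon> by simp
  ultimately show False using A by simp
qed

lemma rpow_eq_powr: "0 < r \<Longrightarrow> rpow r p = r powr p"
  by (simp add: rpow_def)

text \<open>
  Transfer to Lebesgue measurable inputs: both the weight and the inputs are replaced by larger
  Borel functions, a centred isotropic Gaussian and the majorants constructed above.
\<close>

lemma inequality_if_BL:
  fixes H :: "'a::euclidean_space set" and Hs :: "nat \<Rightarrow> 'b::euclidean_space set"
    and B L :: "nat \<Rightarrow> 'a \<Rightarrow> 'b"
  assumes BL: "BL (pi * a) H {1..m} L p" and Hs: "\<And>j. j \<in> {1..m} \<Longrightarrow> subspace (Hs j) \<and> L j ` H = Hs j"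
    and L: "\<And>j. j \<in> {1..m} \<Longrightarrow> linear (L j)" "\<And>j x. j \<in> {1..m} \<Longrightarrow> x \<in> H \<Longrightarrow> L j x = B j x"
    and p: "\<And>j. j \<in> {1..m} \<Longrightarrow> 0 \<le> p j" and G: "\<And>x. x \<in> H \<Longrightarrow> a * (norm x)\<^sup>2 \<le> G x \<bullet> x"
  shows "\<exists>K::real. 0 \<le> K \<and> (\<forall>f. bl_input m Hs f \<longrightarrow>
            (\<integral>\<^sup>+x. ennreal (exp (- pi * (G x \<bullet> x)) * (\<Prod>j\<in>{1..m}. rpow (f j (B j x)) (p j)))
               \<partial>lebesgue_subspace H)
            \<le> ennreal (K * (\<Prod>j\<in>{1..m}. rpow (\<integral>y. f j y \<partial>lebesgue_subspace (Hs j)) (p j))))"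
proof -
  let ?J = "{1..m}"
  obtain K where K: "0 < K"
    "\<And>(f::nat \<Rightarrow> 'b \<Rightarrow> ennreal) C. (\<And>j. j \<in> ?J \<Longrightarrow> f j \<in> borel_measurable borel) \<Longrightarrow> (\<And>j. j \<in> ?J \<Longrightarrow> 0 < C j) \<Longrightarrow>
      (\<And>j. j \<in> ?J \<Longrightarrow> (\<integral>\<^sup>+y. f j y \<partial>lborel_on (L j ` H)) \<le> ennreal (C j)) \<Longrightarrow>
      (\<integral>\<^sup>+x. gauss (pi * a) x * (\<Prod>j\<in>?J. epow (f j (L j x)) (p j)) \<partial>lborel_on H) \<le> ennreal (K * (\<Prod>j\<in>?J. C j powr p j))"
    using BL_D[OF BL L(1)] by blast
  show ?thesis
  proof (intro exI[of _ K] conjI allI impI)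
    show "0 \<le> K" using K(1) by simp
    fix f assume f: "bl_input m Hs f"
    define I where "I j = (\<integral>y. f j y \<partial>lebesgue_subspace (Hs j))" for j
    have I: "0 < I j" and f0: "\<And>y. y \<in> Hs j \<Longrightarrow> 0 \<le> f j y" if "j \<in> ?J" for j
      using f that by (auto simp: bl_input_def I_def)
    have "\<forall>j\<in>?J. \<exists>g::'b \<Rightarrow> ennreal. g \<in> borel_measurable borel \<and> (\<forall>y\<in>Hs j. ennreal (f j y) \<le> g y) \<and>
        (\<integral>\<^sup>+y. g y \<partial>lborel_on (Hs j)) = ennreal (I j)"
    proof
      fix j assume j: "j \<in> ?J"
      have "subspace (Hs j)" "integrable (lebesgue_subspace (Hs j)) (f j)"
        using f Hs j by (auto simp: bl_input_def)
      from lebesgue_borel_majorant[OF this f0[OF j]]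
      show "\<exists>g::'b \<Rightarrow> ennreal. g \<in> borel_measurable borel \<and> (\<forall>y\<in>Hs j. ennreal (f j y) \<le> g y) \<and>
        (\<integral>\<^sup>+y. g y \<partial>lborel_on (Hs j)) = ennreal (I j)"
        unfolding I_def by metis
    qed
    from bchoice[OF this] obtain g :: "nat \<Rightarrow> 'b \<Rightarrow> ennreal" where
      g: "\<And>j. j \<in> ?J \<Longrightarrow> g j \<in> borel_measurable borel" "\<And>j y. j \<in> ?J \<Longrightarrow> y \<in> Hs j \<Longrightarrow> ennreal (f j y) \<le> g j y"
        "\<And>j. j \<in> ?J \<Longrightarrow> (\<integral>\<^sup>+y. g j y \<partial>lborel_on (Hs j)) = ennreal (I j)"
      by blast
    have "(\<integral>\<^sup>+x. ennreal (exp (- pi * (G x \<bullet> x)) * (\<Prod>j\<in>?J. rpow (f j (B j x)) (p j))) \<partial>lebesgue_subspace H)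
      = (\<integral>\<^sup>+x. ennreal (exp (- pi * (G x \<bullet> x)) * (\<Prod>j\<in>?J. rpow (f j (B j x)) (p j))) \<partial>lborel_subspace H)"
      by (rule nn_integral_completion)
    also have "\<dots> \<le> (\<integral>\<^sup>+x. gauss (pi * a) x * (\<Prod>j\<in>?J. epow (g j (L j x)) (p j)) \<partial>lborel_subspace H)"
    proof (rule nn_integral_mono)
      fix x assume "x \<in> space (lborel_subspace H)"
      then have x: "x \<in> H" by (simp add: lborel_subspace_borel)
      have BH: "B j x \<in> Hs j" if "j \<in> ?J" for j
        using Hs[OF that] L(2)[OF that x] x by force
      have "ennreal (exp (- pi * (G x \<bullet> x)) * (\<Prod>j\<in>?J. rpow (f j (B j x)) (p j)))
        = ennreal (exp (- pi * (G x \<bullet> x))) * (\<Prod>j\<in>?J. epow (ennreal (f j (B j x))) (p j))"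
      proof -
        have "(\<Prod>j\<in>?J. epow (ennreal (f j (B j x))) (p j)) = (\<Prod>j\<in>?J. ennreal (rpow (f j (B j x)) (p j)))"
          using f0 BH by (intro prod.cong refl epow_ennreal) blast
        also have "\<dots> = ennreal (\<Prod>j\<in>?J. rpow (f j (B j x)) (p j))"
          by (rule prod_ennreal) (simp add: rpow_def)
        finally show ?thesis by (simp only: ennreal_mult' exp_ge_zero)
      qed
      also have "\<dots> \<le> gauss (pi * a) x * (\<Prod>j\<in>?J. epow (g j (L j x)) (p j))"
      proof (rule mult_mono)
        show "ennreal (exp (- pi * (G x \<bullet> x))) \<le> gauss (pi * a) x"
          using G[OF x] by (auto simp: gauss_def mult.assoc intro!: ennreal_leI)
        have "epow (ennreal (f j (B j x))) (p j) \<le> epow (g j (L j x)) (p j)" if "j \<in> ?J" for j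
          using g(2)[OF that BH[OF that]] p[OF that] L(2)[OF that x] by (simp add: epow_mono)
        then show "(\<Prod>j\<in>?J. epow (ennreal (f j (B j x))) (p j)) \<le> (\<Prod>j\<in>?J. epow (g j (L j x)) (p j))"
          by (rule prod_mono_ennreal)
      qed simp_all
      finally show "ennreal (exp (- pi * (G x \<bullet> x)) * (\<Prod>j\<in>?J. rpow (f j (B j x)) (p j)))
        \<le> gauss (pi * a) x * (\<Prod>j\<in>?J. epow (g j (L j x)) (p j))" .
    qed
    also have "\<dots> = (\<integral>\<^sup>+x. gauss (pi * a) x * (\<Prod>j\<in>?J. epow (g j (L j x)) (p j)) \<partial>lborel_on H)"
      by (intro nn_integral_lborel_on[symmetric] BL_integrand_measurable L g)
    also have "\<dots> \<le> ennreal (K * (\<Prod>j\<in>?J. I j powr p j))"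
      using g Hs I by (intro K(2)) auto
    also have "(\<Prod>j\<in>?J. I j powr p j) = (\<Prod>j\<in>?J. rpow (I j) (p j))"
      using I by (intro prod.cong refl) (simp add: rpow_eq_powr)
    finally show "(\<integral>\<^sup>+x. ennreal (exp (- pi * (G x \<bullet> x)) * (\<Prod>j\<in>?J. rpow (f j (B j x)) (p j))) \<partial>lebesgue_subspace H)
      \<le> ennreal (K * (\<Prod>j\<in>?J. rpow (\<integral>y. f j y \<partial>lebesgue_subspace (Hs j)) (p j)))"
      by (simp only: I_def)
  qed
qed

text \<open>
  Necessity. For a subspace \<open>V\<close>, let \<open>f j\<close> be a Gaussian of width \<open>1\<close> along \<open>B j ` V\<close> and width
  \<open>\<epsilon>\<close> orthogonally to it. Its integral is a constant times \<open>\<epsilon>\<close> to the codimension of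
  \<open>B j ` V\<close>. The maps \<open>B j\<close> are bounded and send \<open>V\<close> into \<open>B j ` V\<close>, so the integrand on the left
  is at least a Gaussian of width comparable to \<open>1\<close> along \<open>V\<close> and to \<open>\<epsilon>\<close> orthogonally to
  it, with integral a constant times \<open>\<epsilon>\<close> to the codimension of \<open>V\<close>. Letting \<open>\<epsilon>\<close> tend to
  \<open>0\<close>, the inequality forces the comparison of exponents.
\<close>

lemma dim_cond_if_inequality:
  fixes H :: "'a::euclidean_space set" and Hs :: "nat \<Rightarrow> 'b::euclidean_space set"
    and B L :: "nat \<Rightarrow> 'a \<Rightarrow> 'b"
  assumes H: "subspace H" and Hs: "\<And>j. j \<in> {1..m} \<Longrightarrow> L j ` H = Hs j"
    and L: "\<And>j. j \<in> {1..m} \<Longrightarrow> linear (L j)" "\<And>j x. j \<in> {1..m} \<Longrightarrow> x \<in> H \<Longrightarrow> L j x = B j x"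
    and p: "\<And>j. j \<in> {1..m} \<Longrightarrow> 0 \<le> p j" and G: "linear_map_on H H G"
    and ineq: "\<And>f. bl_input m Hs f \<Longrightarrow>
            (\<integral>\<^sup>+x. ennreal (exp (- pi * (G x \<bullet> x)) * (\<Prod>j\<in>{1..m}. rpow (f j (B j x)) (p j)))
               \<partial>lebesgue_subspace H)
            \<le> ennreal (K * (\<Prod>j\<in>{1..m}. rpow (\<integral>y. f j y \<partial>lebesgue_subspace (Hs j)) (p j)))"
  shows "dim_cond H {1..m} L p"
  unfolding dim_cond_def
proof (intro allI impI, elim conjE)
  let ?J = "{1..m}"
  fix V assume V: "subspace V" "V \<subseteq> H"
  define q where "q j = dim (L j ` H) - dim (L j ` V)" for j
  have LV: "subspace (L j ` H)" "subspace (L j ` V)" "L j ` V \<subseteq> L j ` H" if "j \<in> ?J" for j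
    using linear_subspace_image[OF L(1)[OF that]] H V by auto
  obtain Q where Q: "orth_proj Q V" using orth_proj_exists[OF V(1)] ..
  have "\<forall>j\<in>?J. \<exists>P. orth_proj P (L j ` V)" using LV(2) orth_proj_exists by blast
  from bchoice[OF this] obtain P where P: "\<And>j. j \<in> ?J \<Longrightarrow> orth_proj (P j) (L j ` V)" by blast
  obtain C0 where C0: "0 < C0" "\<And>\<alpha> \<beta>. 0 < \<alpha> \<Longrightarrow> 0 < \<beta> \<Longrightarrow>
    (\<integral>\<^sup>+x. ennreal (exp (- (\<alpha> * (norm (x - Q x))\<^sup>2 + \<beta> * (norm (Q x))\<^sup>2))) \<partial>lborel_on H)
      = ennreal (C0 * sqrt (pi / \<alpha>) ^ dim V * sqrt (pi / \<beta>) ^ (dim H - dim V))"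
    using nn_integral_split_gauss[OF H V Q] by blast
  have "\<forall>j\<in>?J. \<exists>C>0. \<forall>\<alpha> \<beta>. 0 < \<alpha> \<longrightarrow> 0 < \<beta> \<longrightarrow>
    (\<integral>\<^sup>+x. ennreal (exp (- (\<alpha> * (norm (x - P j x))\<^sup>2 + \<beta> * (norm (P j x))\<^sup>2))) \<partial>lborel_on (L j ` H))
      = ennreal (C * sqrt (pi / \<alpha>) ^ dim (L j ` V) * sqrt (pi / \<beta>) ^ q j)"
  proof
    fix j assume j: "j \<in> ?J"
    obtain C :: real where "0 < C" "\<And>\<alpha> \<beta>. 0 < \<alpha> \<Longrightarrow> 0 < \<beta> \<Longrightarrow>
      (\<integral>\<^sup>+x. ennreal (exp (- (\<alpha> * (norm (x - P j x))\<^sup>2 + \<beta> * (norm (P j x))\<^sup>2))) \<partial>lborel_on (L j ` H))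
      = ennreal (C * sqrt (pi / \<alpha>) ^ dim (L j ` V) * sqrt (pi / \<beta>) ^ q j)"
      using nn_integral_split_gauss[OF LV[OF j] P[OF j]] unfolding q_def by blast
    then show "\<exists>C>0. \<forall>\<alpha> \<beta>. 0 < \<alpha> \<longrightarrow> 0 < \<beta> \<longrightarrow>
      (\<integral>\<^sup>+x. ennreal (exp (- (\<alpha> * (norm (x - P j x))\<^sup>2 + \<beta> * (norm (P j x))\<^sup>2))) \<partial>lborel_on (L j ` H))
      = ennreal (C * sqrt (pi / \<alpha>) ^ dim (L j ` V) * sqrt (pi / \<beta>) ^ q j)" by blast
  qed
  from bchoice[OF this] obtain C where C: "\<And>j. j \<in> ?J \<Longrightarrow> 0 < C j"
    "\<And>j \<alpha> \<beta>. j \<in> ?J \<Longrightarrow> 0 < \<alpha> \<Longrightarrow> 0 < \<beta> \<Longrightarrow>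
      (\<integral>\<^sup>+x. ennreal (exp (- (\<alpha> * (norm (x - P j x))\<^sup>2 + \<beta> * (norm (P j x))\<^sup>2))) \<partial>lborel_on (L j ` H))
      = ennreal (C j * sqrt (pi / \<alpha>) ^ dim (L j ` V) * sqrt (pi / \<beta>) ^ q j)"
    by blast
  obtain G' where G': "linear G'" "\<And>x. x \<in> H \<Longrightarrow> G' x = G x"
    using linear_map_on_extend[OF G H] by blast
  obtain \<gamma> where \<gamma>: "0 < \<gamma>" "\<And>x. norm (G' x) \<le> \<gamma> * norm x"
    using linear_bounded_pos[OF G'(1)] by blast
  obtain b where b: "0 < b" "\<And>j x. j \<in> ?J \<Longrightarrow> norm (L j x) \<le> b * norm x"
  proof -
    have "\<forall>j\<in>?J. \<exists>b>0. \<forall>x. norm (L j x) \<le> b * norm x"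
      using linear_bounded_pos[OF L(1)] by metis
    from bchoice[OF this] obtain b where b: "\<And>j. j \<in> ?J \<Longrightarrow> 0 < b j"
      "\<And>j x. j \<in> ?J \<Longrightarrow> norm (L j x) \<le> b j * norm x" by blast
    show thesis
    proof (rule that[of "1 + (\<Sum>j\<in>?J. b j)"])
      show "0 < 1 + (\<Sum>j\<in>?J. b j)" using b(1) by (intro add_pos_nonneg sum_nonneg) (auto intro: less_imp_le)
      fix j and x :: 'a assume j: "j \<in> ?J"
      have "b j \<le> (\<Sum>j\<in>?J. b j)" using b(1) j by (intro member_le_sum) (auto intro: less_imp_le)
      then have "b j * norm x \<le> (1 + (\<Sum>j\<in>?J. b j)) * norm x" by (intro mult_right_mono) auto
      then show "norm (L j x) \<le> (1 + (\<Sum>j\<in>?J. b j)) * norm x" using b(2)[OF j, of x] by linarith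
    qed
  qed
  \<comment> \<open>collects the upper bounds for all quadratic forms in the exponent of the integrand\<close>
  define D where "D = pi * \<gamma> + (\<Sum>j\<in>?J. p j) * b\<^sup>2"
  have D: "0 < D" using \<gamma>(1) p by (auto simp: D_def intro!: add_pos_nonneg mult_nonneg_nonneg sum_nonneg)
  define A where "A = C0 * sqrt (pi / D) ^ dim V * sqrt (pi / (2 * D)) ^ (dim H - dim V)"
  have A: "0 < A" using C0(1) D by (simp add: A_def)
  define K' where "K' = K * (\<Prod>j\<in>?J. (C j * sqrt pi ^ dim (L j ` V) * sqrt pi ^ q j) powr p j)"
  have main: "A * \<epsilon> powr real (dim H - dim V) \<le> K' * \<epsilon> powr (\<Sum>j\<in>?J. p j * real (q j))"
    if \<epsilon>: "0 < \<epsilon>" "\<epsilon> \<le> 1" for \<epsilon>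
  proof -
    define f where "f j y = exp (- (1 * (norm (y - P j y))\<^sup>2 + 1 / \<epsilon>\<^sup>2 * (norm (P j y))\<^sup>2))" for j and y :: 'b
    define r where "r j = C j * sqrt pi ^ dim (L j ` V) * sqrt pi ^ q j * \<epsilon> ^ q j" for j
    have r0: "0 < r j" if "j \<in> ?J" for j using C(1)[OF that] \<epsilon> by (simp add: r_def)
    have sq: "sqrt (pi / (1 / \<epsilon>\<^sup>2)) = sqrt pi * \<epsilon>" using \<epsilon> by (simp add: real_sqrt_mult)
    have fm: "f j \<in> borel_measurable borel" if "j \<in> ?J" for j
    proof -
      have "linear (P j)" using P[OF that] by (simp add: orth_proj_def)
      note [measurable] = linear_borel_measurable[OF this]
      show ?thesis unfolding f_def by measurable
    qed
    have "(\<integral>\<^sup>+y. ennreal (f j y) \<partial>lborel_on (Hs j)) = ennreal (r j)" if "j \<in> ?J" for j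
      unfolding f_def Hs[OF that, symmetric] using \<epsilon>
      by (subst C(2)[OF that]) (simp_all add: sq r_def power_mult_distrib mult.assoc del: divide_divide_eq_right)
    then have fint: "integrable (lebesgue_subspace (Hs j)) (f j)" "(\<integral>y. f j y \<partial>lebesgue_subspace (Hs j)) = r j" if "j \<in> ?J" for j
      using integral_lebesgue_subspace[OF fm, of j "Hs j" "r j"] r0[of j] that by (auto simp: f_def)
    have "bl_input m Hs f" using fint r0 by (auto simp: bl_input_def f_def)
    have lower: "exp (- (D * (norm (x - Q x))\<^sup>2 + (2 * D / \<epsilon>\<^sup>2) * (norm (Q x))\<^sup>2))
      \<le> exp (- pi * (G x \<bullet> x)) * (\<Prod>j\<in>?J. rpow (f j (B j x)) (p j))" if x: "x \<in> H" for x
    proof -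
      define v w where "v = (norm (x - Q x))\<^sup>2" and "w = (norm (Q x))\<^sup>2"
      have vw: "(norm x)\<^sup>2 = v + w" unfolding v_def w_def by (rule orth_proj_Pythagoras[OF Q])
      have 0: "0 \<le> v" "0 \<le> w" by (simp_all add: v_def w_def)
      have "\<epsilon>\<^sup>2 \<le> 1" using \<epsilon> by (simp add: power_le_one)
      then have weps: "w \<le> w / \<epsilon>\<^sup>2" using 0 \<epsilon> by (simp add: le_divide_eq mult_left_le)
      define E where "E j = 1 * (norm (L j x - P j (L j x)))\<^sup>2 + 1 / \<epsilon>\<^sup>2 * (norm (P j (L j x)))\<^sup>2" for j
      have E: "E j \<le> b\<^sup>2 * (v + w + w / \<epsilon>\<^sup>2)" if j: "j \<in> ?J" for j
      proof -
        have bsq: "(norm (L j z))\<^sup>2 \<le> b\<^sup>2 * (norm z)\<^sup>2" for z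
          using power_mono[OF b(2)[OF j, of z] norm_ge_zero, of 2] by (simp add: power_mult_distrib)
        have lin: "linear (P j)" using P[OF j] by (simp add: orth_proj_def)
        have "L j (x - Q x) \<in> L j ` V" using Q by (auto simp: orth_proj_def)
        then have "P j (L j (x - Q x)) = 0" by (rule orth_proj_zero[OF P[OF j] LV(2)[OF j]])
        then have "P j (L j x) = P j (L j (Q x))"
          by (simp add: linear_diff[OF L(1)[OF j]] linear_diff[OF lin])
        then have "(norm (P j (L j x)))\<^sup>2 \<le> (norm (L j (Q x)))\<^sup>2"
          using orth_proj_Pythagoras[OF P[OF j], of "L j (Q x)"] by simp
        also have "\<dots> \<le> b\<^sup>2 * w" unfolding w_def by (rule bsq)
        finally have 1: "1 / \<epsilon>\<^sup>2 * (norm (P j (L j x)))\<^sup>2 \<le> 1 / \<epsilon>\<^sup>2 * (b\<^sup>2 * w)"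
          by (intro mult_left_mono) auto
        have "(norm (L j x - P j (L j x)))\<^sup>2 \<le> (norm (L j x))\<^sup>2"
          using orth_proj_Pythagoras[OF P[OF j], of "L j x"] by simp
        also have "\<dots> \<le> b\<^sup>2 * (v + w)" unfolding vw[symmetric] by (rule bsq)
        finally show ?thesis using 1 by (simp add: E_def algebra_simps)
      qed
      have "G' x \<bullet> x \<le> norm (G' x) * norm x" by (rule norm_cauchy_schwarz)
      also have "\<dots> \<le> \<gamma> * norm x * norm x" by (intro mult_right_mono \<gamma>) simp
      finally have Gx: "G x \<bullet> x \<le> \<gamma> * (v + w)"
        using G'(2)[OF x] by (simp add: vw[symmetric] power2_eq_square mult.assoc)
      have "(\<Sum>j\<in>?J. p j * E j) \<le> (\<Sum>j\<in>?J. p j * (b\<^sup>2 * (v + w + w / \<epsilon>\<^sup>2)))"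
        using E p by (intro sum_mono mult_left_mono) auto
      also have "\<dots> = (\<Sum>j\<in>?J. p j) * b\<^sup>2 * (v + w + w / \<epsilon>\<^sup>2)"
        by (simp add: sum_distrib_right mult.assoc)
      finally have "pi * (G x \<bullet> x) + (\<Sum>j\<in>?J. p j * E j)
        \<le> pi * (\<gamma> * (v + w)) + (\<Sum>j\<in>?J. p j) * b\<^sup>2 * (v + w + w / \<epsilon>\<^sup>2)"
        using Gx by (intro add_mono mult_left_mono) auto
      also have "\<dots> \<le> pi * (\<gamma> * (v + w + w / \<epsilon>\<^sup>2)) + (\<Sum>j\<in>?J. p j) * b\<^sup>2 * (v + w + w / \<epsilon>\<^sup>2)"
        using weps \<gamma>(1) by (intro add_right_mono mult_left_mono) (auto intro: order_trans[OF 0(2)])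
      also have "\<dots> = D * (v + w + w / \<epsilon>\<^sup>2)" by (simp add: D_def algebra_simps)
      also have "\<dots> \<le> D * (v + w / \<epsilon>\<^sup>2 + w / \<epsilon>\<^sup>2)"
        using weps D by (intro mult_left_mono) auto
      also have "\<dots> = D * v + (2 * D / \<epsilon>\<^sup>2) * w" by (simp add: algebra_simps)
      finally have "exp (- (D * v + (2 * D / \<epsilon>\<^sup>2) * w)) \<le> exp (- (pi * (G x \<bullet> x) + (\<Sum>j\<in>?J. p j * E j)))"
        by simp
      also have "\<dots> = exp (- pi * (G x \<bullet> x)) * (\<Prod>j\<in>?J. exp (- (p j * E j)))"
        by (simp add: exp_sum[symmetric] sum_negf flip: exp_add)
      also have "(\<Prod>j\<in>?J. exp (- (p j * E j))) = (\<Prod>j\<in>?J. rpow (f j (B j x)) (p j))"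
      proof (rule prod.cong[OF refl])
        fix j assume "j \<in> ?J"
        then have "f j (B j x) = exp (- E j)" using L(2)[OF _ x] by (simp add: f_def E_def)
        then show "exp (- (p j * E j)) = rpow (f j (B j x)) (p j)"
          by (simp add: rpow_eq_powr powr_def)
      qed
      finally show ?thesis by (simp add: v_def w_def)
    qed
    have "ennreal (A * \<epsilon> powr real (dim H - dim V))
      = ennreal (C0 * sqrt (pi / D) ^ dim V * sqrt (pi / (2 * D / \<epsilon>\<^sup>2)) ^ (dim H - dim V))"
    proof -
      have "sqrt (pi / (2 * D / \<epsilon>\<^sup>2)) = sqrt (pi / (2 * D)) * \<epsilon>"
        using \<epsilon> by (simp add: real_sqrt_mult real_sqrt_divide)
      then show ?thesis using \<epsilon> by (simp add: A_def power_mult_distrib powr_realpow mult.assoc)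
    qed
    also have "\<dots> = (\<integral>\<^sup>+x. ennreal (exp (- (D * (norm (x - Q x))\<^sup>2 + (2 * D / \<epsilon>\<^sup>2) * (norm (Q x))\<^sup>2))) \<partial>lborel_on H)"
      using D \<epsilon> by (intro C0(2)[symmetric]) auto
    also have "\<dots> = (\<integral>\<^sup>+x. ennreal (exp (- (D * (norm (x - Q x))\<^sup>2 + (2 * D / \<epsilon>\<^sup>2) * (norm (Q x))\<^sup>2))) \<partial>lebesgue_subspace H)"
    proof -
      have "linear Q" using Q by (simp add: orth_proj_def)
      note [measurable] = linear_borel_measurable[OF this]
      show ?thesis by (rule nn_integral_lebesgue_subspace[symmetric]) measurable
    qed
    also have "\<dots> \<le> (\<integral>\<^sup>+x. ennreal (exp (- pi * (G x \<bullet> x)) * (\<Prod>j\<in>?J. rpow (f j (B j x)) (p j))) \<partial>lebesgue_subspace H)"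
      using lower by (intro nn_integral_mono ennreal_leI) (simp add: lborel_subspace_borel)
    also have "\<dots> \<le> ennreal (K * (\<Prod>j\<in>?J. rpow (\<integral>y. f j y \<partial>lebesgue_subspace (Hs j)) (p j)))"
      by (rule ineq) fact
    also have "(\<Prod>j\<in>?J. rpow (\<integral>y. f j y \<partial>lebesgue_subspace (Hs j)) (p j)) = (\<Prod>j\<in>?J. r j powr p j)"
      using fint(2) r0 by (intro prod.cong refl) (simp add: rpow_eq_powr)
    also have "\<dots> = (\<Prod>j\<in>?J. (C j * sqrt pi ^ dim (L j ` V) * sqrt pi ^ q j) powr p j) * \<epsilon> powr (\<Sum>j\<in>?J. p j * real (q j))"
    proof -
      have "r j powr p j = (C j * sqrt pi ^ dim (L j ` V) * sqrt pi ^ q j) powr p j * \<epsilon> powr (p j * real (q j))" if "j \<in> ?J" for j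
        using C(1)[OF that] \<epsilon>
        by (simp add: r_def powr_mult powr_realpow[symmetric] powr_powr mult.commute)
      then have "(\<Prod>j\<in>?J. r j powr p j)
        = (\<Prod>j\<in>?J. (C j * sqrt pi ^ dim (L j ` V) * sqrt pi ^ q j) powr p j * \<epsilon> powr (p j * real (q j)))"
        by (intro prod.cong refl)
      then show ?thesis using \<epsilon> by (simp add: prod.distrib powr_sum)
    qed
    finally have "ennreal (A * \<epsilon> powr real (dim H - dim V)) \<le> ennreal (K' * \<epsilon> powr (\<Sum>j\<in>?J. p j * real (q j)))"
      by (simp add: K'_def mult.assoc)
    moreover have "0 < A * \<epsilon> powr real (dim H - dim V)" using A \<epsilon> by simp
    ultimately show ?thesis by (simp add: ennreal_le_iff2)
  qed
  have "(\<Sum>j\<in>?J. p j * real (q j)) \<le> real (dim H - dim V)"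
    by (rule powr_le_imp_exponent_le[OF A main])
  moreover have "real (q j) = real (dim (L j ` H)) - real (dim (L j ` V))" if "j \<in> ?J" for j
    unfolding q_def using dim_subset[OF LV(3)[OF that]] by (rule of_nat_diff)
  moreover have "real (dim H - dim V) = real (dim H) - real (dim V)"
    using dim_subset[OF V(2)] by (rule of_nat_diff)
  ultimately show "0 \<le> codim_gap H ?J L p V" by (simp add: codim_gap_def)
qed

section \<open>The characterisation of finiteness\<close>

theorem theorem8p17:
  fixes m :: nat
    and H :: "'a::euclidean_space set"
    and Hs :: "nat \<Rightarrow> 'b::euclidean_space set"
    and B :: "nat \<Rightarrow> 'a \<Rightarrow> 'b"
    and p :: "nat \<Rightarrow> real"
    and G :: "'a \<Rightarrow> 'a"
  assumes "brascamp_lieb_datum m H Hs B p"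
    and "nondegenerate m H Hs B"
    and "positive_definite_on H G"
  shows "(\<exists>K::real. 0 \<le> K \<and> (\<forall>f. bl_input m Hs f \<longrightarrow>
            (\<integral>\<^sup>+x. ennreal (exp (- pi * (G x \<bullet> x)) * (\<Prod>j\<in>{1..m}. rpow (f j (B j x)) (p j)))
               \<partial>lebesgue_subspace H)
            \<le> ennreal (K * (\<Prod>j\<in>{1..m}. rpow (\<integral>y. f j y \<partial>lebesgue_subspace (Hs j)) (p j)))))
     \<longleftrightarrow>
         (\<forall>V. subspace V \<and> V \<subseteq> H \<longrightarrow>
            real (quotient_dim H V) \<ge> (\<Sum>j\<in>{1..m}. p j * real (quotient_dim (Hs j) (B j ` V))))"
    (is "?ineq \<longleftrightarrow> ?cond")
proof -
  let ?J = "{1..m}"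
  have H: "subspace H" and lin: "\<And>j. j \<in> ?J \<Longrightarrow> linear_map_on H (Hs j) (B j)"
    and p: "\<And>j. j \<in> ?J \<Longrightarrow> 0 \<le> p j" and sub: "\<And>j. j \<in> ?J \<Longrightarrow> subspace (Hs j)"
    using assms(1) by (auto simp: brascamp_lieb_datum_def m_transformation_def m_exponent_def)
  have "\<forall>j\<in>?J. \<exists>g. linear g \<and> (\<forall>x\<in>H. g x = B j x)"
    using linear_map_on_extend[OF lin H] by metis
  from bchoice[OF this] obtain L where L: "\<And>j. j \<in> ?J \<Longrightarrow> linear (L j)" "\<And>j x. j \<in> ?J \<Longrightarrow> x \<in> H \<Longrightarrow> L j x = B j x"
    by blast
  have img: "B j ` V = L j ` V" if "j \<in> ?J" "V \<subseteq> H" for j V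
    using L(2)[OF that(1)] that(2) by (intro image_cong) auto
  have Hs: "Hs j = L j ` H" if "j \<in> ?J" for j
    using assms(2) img[OF that, of H] that by (auto simp: nondegenerate_def)
  have "?cond \<longleftrightarrow> dim_cond H ?J L p"
  proof -
    have "(\<Sum>j\<in>?J. p j * real (quotient_dim (Hs j) (B j ` V))) \<le> real (quotient_dim H V) \<longleftrightarrow> 0 \<le> codim_gap H ?J L p V"
      if V: "subspace V" "V \<subseteq> H" for V
    proof -
      have 1: "real (quotient_dim H V) = real (dim H) - real (dim V)"
        by (simp add: quotient_dim_eq[OF H V] of_nat_diff dim_subset[OF V(2)])
      have "real (quotient_dim (Hs j) (B j ` V)) = real (dim (L j ` H)) - real (dim (L j ` V))" if j: "j \<in> ?J" for j
      proof -
        have s: "subspace (L j ` V)" "L j ` V \<subseteq> L j ` H"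
          using linear_subspace_image[OF L(1)[OF j] V(1)] V(2) by auto
        show ?thesis
          using quotient_dim_eq[OF sub[OF j], of "L j ` V"] s dim_subset[OF s(2)]
          by (simp add: Hs[OF j] img[OF j V(2)] of_nat_diff)
      qed
      then have "(\<Sum>j\<in>?J. p j * real (quotient_dim (Hs j) (B j ` V)))
        = (\<Sum>j\<in>?J. p j * (real (dim (L j ` H)) - real (dim (L j ` V))))"
        by (intro sum.cong) auto
      then show ?thesis by (simp add: codim_gap_def 1)
    qed
    then show ?thesis by (auto simp: dim_cond_def)
  qed
  moreover have "dim_cond H ?J L p" if ?ineq
  proof -
    have G: "linear_map_on H H G" using assms(3) by (simp add: positive_definite_on_def)
    show ?thesis
      using that by (elim exE conjE) (rule dim_cond_if_inequality[OF H Hs[symmetric] L p G], auto)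
  qed
  moreover have ?ineq if "dim_cond H ?J L p"
  proof -
    obtain a where a: "0 < a" "\<And>x. x \<in> H \<Longrightarrow> a * (norm x)\<^sup>2 \<le> G x \<bullet> x"
      using positive_definite_lower_bound[OF assms(3) H] by blast
    have "BL (pi * a) H ?J L p"
      using a(1) by (intro BL_if_dim_cond H L p that) auto
    then show ?thesis
      by (rule inequality_if_BL) (use sub Hs L p a in auto)
  qed
  ultimately show ?thesis by blast
qed

end
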